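(* Let $f=au^2+2bu+c\in P_{4,4}$, where $a,b,c\in\mathbb{R}[x,y,z]$ are forms of degrees $2,3,4$, respectively, and let $\Delta:=ac-b^2$. (1) Let $j\in\{0,1\}$. If there exists $q\in\Sigma_{3,2}$ (a form in $x,y,z$) such that $q^jf\in\Sigma_{4,4+2j}$, then there exist finitely many forms $p_k,q_k\in\mathbb{R}[x,y,z]$, with $\deg p_k=1+j$ and $\deg q_k=2+j$, such that $$a\,q^j\Delta=\sum_k (a\,q_k-b\,p_k)^2\in\Sigma_{3,8+2j}.$$ (2) Conversely, for $j=0$: if there exist finitely many forms $p_k,q_k\in\mathbb{R}[x,y,z]$ of degrees $1$ and $2$, respectively, such that $a\Delta=\sum_k(a\,q_k-b\,p_k)^2$, then every form $g=au^2+2b'u+c'\in P_{4,4}$, with $b',c'\in\mathbb{R}[x,y,z]$ forms of degrees $3$ and $4$, whose discriminant satisfies $ac'-b'^2=\Delta$, is a sum of squares, i.e. $g\in\Sigma_{4,4}$.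
   Context: A form is a homogeneous polynomial with real coefficients; the zero polynomial is regarded as a form of every degree. $P_{n,2d}$ denotes the convex cone of forms of degree $2d$ in $n$ variables with real coefficients that are nonnegative on $\mathbb{R}^n$. $\Sigma_{n,2d}\subseteq P_{n,2d}$ denotes the subcone of forms that are sums of squares of real polynomials. Quaternary forms here are in the variables $x,y,z,u$; ternary forms are in $x,y,z$. For a form $au^2+2bu+c$ with $a,b,c\in\mathbb{R}[x,y,z]$, its discriminant is $ac-b^2$. The convention $q^0=1$ is used. *)

theory Defs
  imports Complex_Main "HOL-Library.Poly_Mapping"
begin

text \<open>
  Real polynomials in the variables \<open>X\<^sub>0, X\<^sub>1, X\<^sub>2, \<dots>\<close>. Polynomials in \<open>n\<close> variables are those in
  which only \<open>X\<^sub>0, \<dots>, X\<^sub>n\<^sub>-\<^sub>1\<close> occur, so that \<open>\<real>[x,y,z]\<close> is a subset of \<open>\<real>[x,y,z,u]\<close>, with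
  \<open>x, y, z, u\<close> being \<open>X\<^sub>0, X\<^sub>1, X\<^sub>2, X\<^sub>3\<close>.
\<close>

type_synonym rpoly = "(nat \<Rightarrow>\<^sub>0 nat) \<Rightarrow>\<^sub>0 real"

definition mon_degree :: "(nat \<Rightarrow>\<^sub>0 nat) \<Rightarrow> nat" where
  "mon_degree m = (\<Sum>i\<in>Poly_Mapping.keys m. Poly_Mapping.lookup m i)"

definition eval_mon :: "(nat \<Rightarrow> real) \<Rightarrow> (nat \<Rightarrow>\<^sub>0 nat) \<Rightarrow> real" where
  "eval_mon v m = (\<Prod>i\<in>Poly_Mapping.keys m. v i ^ Poly_Mapping.lookup m i)"

definition eval_poly :: "(nat \<Rightarrow> real) \<Rightarrow> rpoly \<Rightarrow> real" where
  "eval_poly v p = (\<Sum>m\<in>Poly_Mapping.keys p. Poly_Mapping.lookup p m * eval_mon v m)"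

definition polys :: "nat \<Rightarrow> rpoly set" where
  "polys n = {p. \<forall>m\<in>Poly_Mapping.keys p. Poly_Mapping.keys m \<subseteq> {..<n}}"

text \<open>The zero polynomial is a form of every degree.\<close>

definition forms :: "nat \<Rightarrow> nat \<Rightarrow> rpoly set" where
  "forms n d = {p \<in> polys n. \<forall>m\<in>Poly_Mapping.keys p. mon_degree m = d}"

text \<open>
  In the next two definitions \<open>d\<close> is the degree itself, as in the notation \<open>P\<^sub>n\<^sub>,\<^sub>d\<close> and
  \<open>\<Sigma>\<^sub>n\<^sub>,\<^sub>d\<close> (for even \<open>d\<close>). A point of \<open>\<real>\<^sup>n\<close> is given by the values
  \<open>v 0, \<dots>, v (n - 1)\<close>; a polynomial in \<open>polys n\<close> does not depend on the other values of \<open>v\<close>.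
\<close>

definition psd_forms :: "nat \<Rightarrow> nat \<Rightarrow> rpoly set" where
  "psd_forms n d = {p \<in> forms n d. \<forall>v. eval_poly v p \<ge> 0}"

definition sos_forms :: "nat \<Rightarrow> nat \<Rightarrow> rpoly set" where
  "sos_forms n d =
     {p \<in> forms n d. \<exists>N::nat. \<exists>h. (\<forall>k<N. h k \<in> polys n) \<and> p = (\<Sum>k<N. (h k)\<^sup>2)}"

definition U :: rpoly where
  "U = Poly_Mapping.single (Poly_Mapping.single 3 1) 1"

definition quad_in_u :: "rpoly \<Rightarrow> rpoly \<Rightarrow> rpoly \<Rightarrow> rpoly" where
  "quad_in_u a b c = a * U\<^sup>2 + 2 * b * U + c"

definition discr :: "rpoly \<Rightarrow> rpoly \<Rightarrow> rpoly \<Rightarrow> rpoly" where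
  "discr a b c = a * c - b\<^sup>2"

end

theory Submission
  imports Defs "HOL-Analysis.Analysis"
begin

text \<open>
  The first claim is a Gram matrix computation. If \<open>q\<^sup>j f = \<Sum> h\<^sub>k\<^sup>2\<close>, no cancellation can occur among the
  extreme monomials of the squares, so every \<open>h\<^sub>k\<close> is homogeneous of half the degree and at most
  linear in \<open>u\<close>, say \<open>h\<^sub>k = p\<^sub>k u + r\<^sub>k\<close> (\<open>sum_squares_weight_ge\<close>). Comparing the coefficients of \<open>u\<close> gives
  \<open>\<Sum> p\<^sub>k\<^sup>2 = q\<^sup>j a\<close>, \<open>\<Sum> p\<^sub>k r\<^sub>k = q\<^sup>j b\<close>, \<open>\<Sum> r\<^sub>k\<^sup>2 = q\<^sup>j c\<close>, and expanding \<open>\<Sum> (a r\<^sub>k - b p\<^sub>k)\<^sup>2\<close> yields \<open>a q\<^sup>j \<Delta>\<close>.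

  For the second claim one has to divide by \<open>a\<close>, and the argument depends on the nonnegative quadratic
  form \<open>a\<close>. Write \<open>a = \<alpha> (l\<^sup>2 + s)\<close> with \<open>\<alpha> > 0\<close>, where \<open>l\<close> is linear and \<open>s \<ge> 0\<close> does not involve one of the
  variables of \<open>l\<close>.

  If \<open>a = 0\<close>, then \<open>b' = 0\<close>, and the claim is that every nonnegative ternary quartic \<open>c'\<close> is a sum of
  squares. This is Hilbert's theorem of 1888 (\<open>Hilbert_ternary_quartic\<close>). Following Choi and Lam, a
  nonzero nonnegative ternary quartic dominates the square of some nonzero quadratic form
  (\<open>psd_quartic_ge_square\<close>), by a case distinction on its real zeros. A maximality argument then
  exhausts the quartic by squares: since a space of dimension 6 cannot hold seven linearly independent
  quadratic forms, any further square can be absorbed into a sum of seven squares.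

  If \<open>s = 0\<close>, then \<open>a\<close> is a multiple of \<open>l\<^sup>2\<close>. Nonnegativity makes \<open>l\<close> divide \<open>b\<close> and \<open>b'\<close>, and a linear form
  that divides a sum of squares divides each of the summands; so the representation of \<open>a \<Delta>\<close> can be
  divided by powers of \<open>l\<close> until it reads off a representation of \<open>g\<close> (\<open>sos_of_degenerate\<close>).

  If \<open>s \<noteq> 0\<close>, then \<open>a\<close> is prime (\<open>quadratic_prime\<close>): reduction modulo \<open>a\<close> amounts to evaluation at the
  complex points \<open>l = \<i> \<surd>s\<close>. When \<open>a\<close> divides \<open>b\<close>, it divides \<open>b'\<close> too, and completing the square in \<open>u\<close>
  suffices (\<open>sos_of_prime_dvd\<close>). Otherwise primality forces \<open>\<Sum> p\<^sub>k\<^sup>2 = \<nu> a\<close> with a constant \<open>\<nu> > 0\<close> and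
  \<open>2 \<Sum> p\<^sub>k r\<^sub>k = (1 + \<nu>) b - a M\<close>. For \<open>\<nu> = 1\<close> and \<open>M = 0\<close> this would be a Gram representation of \<open>f\<close>; in
  general an explicit identity corrects it (\<open>gram_shift_identity\<close>). Finally \<open>a\<close> divides
  \<open>(b' - b) (b' + b)\<close>, so \<open>g\<close> arises from \<open>f\<close> by a substitution \<open>u \<mapsto> \<plusminus>(u + n)\<close>.
\<close>

section \<open>Evaluation of polynomials and rings of polynomials\<close>

abbreviation "lookup \<equiv> Poly_Mapping.lookup"
abbreviation "keys \<equiv> Poly_Mapping.keys"
abbreviation "single \<equiv> Poly_Mapping.single"

definition Const :: "real \<Rightarrow> rpoly" where
  "Const c = single 0 c"

definition Var :: "nat \<Rightarrow> rpoly" where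
  "Var i = single (single i 1) 1"

definition polys_on :: "nat set \<Rightarrow> rpoly set" where
  "polys_on I = {p. \<forall>m\<in>keys p. keys m \<subseteq> I}"

lemma polys_eq: "polys n = polys_on {..<n}"
  by (simp add: polys_def polys_on_def)

lemma U_eq: "U = Var 3"
  by (simp add: U_def Var_def)

lemma sum_monomials: "p = (\<Sum>m\<in>keys p. single m (lookup p m))"
  for p :: "'a \<Rightarrow>\<^sub>0 'b::comm_monoid_add"
proof (rule poly_mapping_eqI)
  fix k
  have "lookup (\<Sum>m\<in>keys p. single m (lookup p m)) k
      = (\<Sum>m\<in>keys p. if m = k then lookup p m else 0)"
    unfolding lookup_sum lookup_single by (intro sum.cong) (auto simp: when_def)
  also have "\<dots> = lookup p k"
    by (simp add: in_keys_iff)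
  finally show "lookup p k = lookup (\<Sum>m\<in>keys p. single m (lookup p m)) k" ..
qed

lemma monomial_induct:
  fixes p :: rpoly
  assumes "P 0" "\<And>p q. P p \<Longrightarrow> P q \<Longrightarrow> P (p + q)"
    and "\<And>m c. m \<in> keys p \<Longrightarrow> P (single m c)"
  shows "P p"
proof -
  have "P (\<Sum>m\<in>M. single m (lookup p m))" if "finite M" "M \<subseteq> keys p" for M
    using that by (induction M rule: finite_induct) (auto intro: assms)
  from this[of "keys p"] show ?thesis by (simp flip: sum_monomials)
qed

text \<open>
  Evaluation takes values in any commutative real algebra: real points decide identities and
  inequalities, and complex points decide divisibility by quadratic forms.
\<close>

definition evm :: "(nat \<Rightarrow> 'a) \<Rightarrow> (nat \<Rightarrow>\<^sub>0 nat) \<Rightarrow> 'a::{real_algebra_1,comm_ring_1}" where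
  "evm v m = (\<Prod>i\<in>keys m. v i ^ lookup m i)"

definition ev :: "(nat \<Rightarrow> 'a) \<Rightarrow> rpoly \<Rightarrow> 'a::{real_algebra_1,comm_ring_1}" where
  "ev v p = (\<Sum>m\<in>keys p. of_real (lookup p m) * evm v m)"

lemma eval_poly_eq: "eval_poly v p = ev v p"
  by (simp add: eval_poly_def ev_def eval_mon_def evm_def)

lemma evm_superset:
  assumes "finite A" "keys m \<subseteq> A"
  shows "evm v m = (\<Prod>i\<in>A. v i ^ lookup m i)"
  unfolding evm_def using assms by (intro prod.mono_neutral_left) (auto simp: in_keys_iff)

lemma evm_add: "evm v (m + n) = evm v m * evm v n"
proof -
  let ?A = "keys m \<union> keys n"
  have "evm v (m + n) = (\<Prod>i\<in>?A. v i ^ lookup (m + n) i)"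
    by (rule evm_superset) (use keys_add[of m n] in auto)
  moreover have "evm v m = (\<Prod>i\<in>?A. v i ^ lookup m i)" "evm v n = (\<Prod>i\<in>?A. v i ^ lookup n i)"
    by (rule evm_superset; simp)+
  ultimately show ?thesis by (simp add: lookup_add power_add prod.distrib)
qed

lemma ev_superset:
  assumes "finite A" "keys p \<subseteq> A"
  shows "ev v p = (\<Sum>m\<in>A. of_real (lookup p m) * evm v m)"
  unfolding ev_def using assms by (intro sum.mono_neutral_left) (auto simp: in_keys_iff)

lemma ev_add: "ev v (p + q) = ev v p + ev v q"
proof -
  let ?A = "keys p \<union> keys q"
  have "ev v (p + q) = (\<Sum>m\<in>?A. of_real (lookup (p + q) m) * evm v m)"
    by (rule ev_superset) (use keys_add[of p q] in auto)
  moreover have "ev v p = (\<Sum>m\<in>?A. of_real (lookup p m) * evm v m)"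
    "ev v q = (\<Sum>m\<in>?A. of_real (lookup q m) * evm v m)"
    by (rule ev_superset; simp)+
  ultimately show ?thesis by (simp add: lookup_add sum.distrib distrib_right)
qed

lemma ev_0 [simp]: "ev v 0 = 0"
  by (simp add: ev_def)

lemma ev_single: "ev v (single m c) = of_real c * evm v m"
  by (simp add: ev_def)

lemma ev_mult: "ev v (p * q) = ev v p * ev v q"
proof (induction p rule: monomial_induct)
  case (3 m c)
  show ?case
  proof (induction q rule: monomial_induct)
    case (3 n d)
    show ?case by (simp add: mult_single ev_single evm_add)
  qed (simp_all add: ev_add distrib_left)
qed (simp_all add: ev_add distrib_right)

lemma ev_Const [simp]: "ev v (Const c) = of_real c"
  by (simp add: Const_def ev_single evm_def)

lemma ev_1 [simp]: "ev v 1 = 1"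
  using ev_Const[of v 1] by (simp add: Const_def)

lemma ev_Var [simp]: "ev v (Var i) = v i"
  by (simp add: Var_def ev_single evm_def)

lemma ev_minus: "ev v (- p) = - ev v p"
  using ev_add[of v p "- p"] by (simp add: add_eq_0_iff)

lemma ev_diff: "ev v (p - q) = ev v p - ev v q"
  using ev_add[of v p "- q"] by (simp add: ev_minus)

lemma ev_power: "ev v (p ^ n) = ev v p ^ n"
  by (induction n) (auto simp: ev_mult)

lemma ev_sum: "ev v (sum f A) = (\<Sum>x\<in>A. ev v (f x))"
  by (induction A rule: infinite_finite_induct) (auto simp: ev_add)

lemma ev_numeral: "ev v (numeral n) = numeral n"
proof -
  have "(numeral n :: rpoly) = Const (numeral n)" by (simp add: Const_def)
  then show ?thesis by (metis ev_Const of_real_numeral)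
qed

lemmas ev_simps = ev_add ev_mult ev_minus ev_diff ev_power ev_sum ev_numeral

lemma ev_cong:
  assumes "p \<in> polys_on I" "\<And>i. i \<in> I \<Longrightarrow> v i = w i"
  shows "ev v p = ev w p"
  unfolding ev_def evm_def
proof (intro sum.cong prod.cong refl arg_cong2[of _ _ _ _ "(*)"])
  fix m i assume "m \<in> keys p" "i \<in> keys m"
  then have "i \<in> I" using assms(1) by (auto simp: polys_on_def)
  then show "v i ^ lookup m i = w i ^ lookup m i" by (simp add: assms(2))
qed

lemma ev_of_real:
  fixes v :: "nat \<Rightarrow> real"
  shows "ev (\<lambda>i. of_real (v i)) p = (of_real (ev v p) :: 'a::{real_algebra_1,comm_ring_1})"
  by (simp add: ev_def evm_def)

lemma keys_Const: "keys (Const c) \<subseteq> {0}"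
  by (simp add: Const_def)

lemma polys_on_mono: "I \<subseteq> J \<Longrightarrow> p \<in> polys_on I \<Longrightarrow> p \<in> polys_on J"
  by (auto simp: polys_on_def)

lemma polys_on_0 [simp, intro]: "0 \<in> polys_on I"
  by (simp add: polys_on_def)

lemma polys_on_Const [simp, intro]: "Const c \<in> polys_on I"
  using keys_Const by (force simp: polys_on_def)

lemma polys_on_1 [simp, intro]: "1 \<in> polys_on I"
  using polys_on_Const[of 1] by (simp add: Const_def)

lemma polys_on_numeral [simp, intro]: "numeral n \<in> polys_on I"
  using polys_on_Const[of "numeral n"] by (simp add: Const_def)

lemma polys_on_Var [intro]: "i \<in> I \<Longrightarrow> Var i \<in> polys_on I"
  by (auto simp: polys_on_def Var_def)

lemma polys_on_add [intro]: "p \<in> polys_on I \<Longrightarrow> q \<in> polys_on I \<Longrightarrow> p + q \<in> polys_on I"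
  using keys_add[of p q] by (auto simp: polys_on_def)

lemma polys_on_mult [intro]: "p \<in> polys_on I \<Longrightarrow> q \<in> polys_on I \<Longrightarrow> p * q \<in> polys_on I"
proof -
  assume *: "p \<in> polys_on I" "q \<in> polys_on I"
  have "keys m \<subseteq> I" if m: "m \<in> keys (p * q)" for m
  proof -
    obtain a b where "m = a + b" "a \<in> keys p" "b \<in> keys q"
      using keys_mult[of p q] m by blast
    then show ?thesis using * keys_add[of a b] by (auto simp: polys_on_def subset_eq)
  qed
  then show ?thesis by (simp add: polys_on_def)
qed

lemma polys_on_minus [intro]: "p \<in> polys_on I \<Longrightarrow> - p \<in> polys_on I"
  by (auto simp: polys_on_def in_keys_iff)

lemma polys_on_diff [intro]: "p \<in> polys_on I \<Longrightarrow> q \<in> polys_on I \<Longrightarrow> p - q \<in> polys_on I"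
  using polys_on_add[of p I "- q"] by auto

lemma polys_on_power [intro]: "p \<in> polys_on I \<Longrightarrow> p ^ n \<in> polys_on I"
  by (induction n) auto

lemma polys_on_sum [intro]: "(\<And>x. x \<in> A \<Longrightarrow> f x \<in> polys_on I) \<Longrightarrow> sum f A \<in> polys_on I"
  by (induction A rule: infinite_finite_induct) auto

lemma polys_on_single: "keys m \<subseteq> I \<Longrightarrow> single m c \<in> polys_on I"
  by (auto simp: polys_on_def)

lemma mon_degree_superset:
  "finite A \<Longrightarrow> keys m \<subseteq> A \<Longrightarrow> mon_degree m = (\<Sum>i\<in>A. lookup m i)"
  unfolding mon_degree_def by (intro sum.mono_neutral_left) (auto simp: in_keys_iff)

lemma mon_degree_add: "mon_degree (m + n) = mon_degree m + mon_degree n"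
proof -
  let ?A = "keys m \<union> keys n"
  have "mon_degree (m + n) = (\<Sum>i\<in>?A. lookup (m + n) i)"
    by (rule mon_degree_superset) (use keys_add[of m n] in auto)
  moreover have "mon_degree m = (\<Sum>i\<in>?A. lookup m i)" "mon_degree n = (\<Sum>i\<in>?A. lookup n i)"
    by (rule mon_degree_superset; simp)+
  ultimately show ?thesis by (simp add: lookup_add sum.distrib)
qed

lemma forms_polys_on: "p \<in> forms n d \<Longrightarrow> p \<in> polys_on {..<n}"
  by (simp add: forms_def polys_eq)

lemma forms_0 [simp]: "0 \<in> forms n d"
  by (simp add: forms_def polys_eq)

lemma forms_add: "p \<in> forms n d \<Longrightarrow> q \<in> forms n d \<Longrightarrow> p + q \<in> forms n d"
  using keys_add[of p q] by (auto simp: forms_def polys_eq)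

lemma forms_mult: "p \<in> forms n d \<Longrightarrow> q \<in> forms n e \<Longrightarrow> p * q \<in> forms n (d + e)"
proof -
  assume *: "p \<in> forms n d" "q \<in> forms n e"
  have "mon_degree m = d + e" if m: "m \<in> keys (p * q)" for m
  proof -
    obtain a b where "m = a + b" "a \<in> keys p" "b \<in> keys q"
      using keys_mult[of p q] m by blast
    then show ?thesis using * by (auto simp: forms_def mon_degree_add)
  qed
  then show ?thesis using * by (auto simp: forms_def polys_eq)
qed

lemma forms_minus: "p \<in> forms n d \<Longrightarrow> - p \<in> forms n d"
  by (auto simp: forms_def polys_eq in_keys_iff)

lemma forms_diff: "p \<in> forms n d \<Longrightarrow> q \<in> forms n d \<Longrightarrow> p - q \<in> forms n d"
  using forms_add[of p n d "- q"] forms_minus by simp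

lemma forms_1: "1 \<in> forms n 0"
  by (simp add: forms_def polys_eq mon_degree_def)

lemma forms_power: "p \<in> forms n d \<Longrightarrow> p ^ k \<in> forms n (k * d)"
  by (induction k) (auto simp: forms_1 intro: forms_mult)

lemma forms_Var: "i < n \<Longrightarrow> Var i \<in> forms n 1"
  by (auto simp: forms_def polys_eq Var_def mon_degree_def polys_on_def)

lemma forms_Const: "Const c \<in> forms n 0"
  by (auto simp: forms_def polys_eq Const_def mon_degree_def polys_on_def)

lemma single_Var_power: "single (single i j) 1 = Var i ^ j"
proof (induction j)
  case (Suc j)
  have "(single i (Suc j) :: nat \<Rightarrow>\<^sub>0 nat) = single i j + single i 1"
    by (simp flip: single_add)
  then have "single (single i (Suc j)) (1::real) = single (single i j) 1 * Var i"
    by (simp add: Var_def mult_single)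
  then show ?case using Suc by simp
qed simp

lemma single_split:
  assumes "lookup m i = j"
  shows "single m c = single (m - single i j) c * Var i ^ j"
    and "keys (m - single i j) = keys m - {i}"
proof -
  have "m = (m - single i j) + single i j"
    using assms by (intro poly_mapping_eqI) (auto simp: lookup_add lookup_minus lookup_single when_def)
  then show "single m c = single (m - single i j) c * Var i ^ j"
    by (metis mult.right_neutral mult_single single_Var_power)
  show "keys (m - single i j) = keys m - {i}"
    using assms by (auto simp: in_keys_iff lookup_minus lookup_single when_def split: if_splits)
qed

text \<open>
  A polynomial regarded as a univariate polynomial in one variable: collect the monomials according to
  their exponent of that variable.
\<close>

lemma polys_on_insertE:
  assumes "p \<in> polys_on (insert i I)"
  obtains N Q where "\<And>j. Q j \<in> polys_on (I - {i})" "p = (\<Sum>j\<le>(N::nat). Q j * Var i ^ j)"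
proof -
  define Q where "Q j = (\<Sum>m\<in>{m\<in>keys p. lookup m i = j}. single (m - single i j) (lookup p m))" for j
  define N where "N = (\<Sum>m\<in>keys p. lookup m i)"
  have N: "lookup m i \<le> N" if "m \<in> keys p" for m
    unfolding N_def using that by (intro member_le_sum) auto
  have "p = (\<Sum>m\<in>keys p. single m (lookup p m))" by (rule sum_monomials)
  also have "\<dots> = (\<Sum>j\<le>N. \<Sum>m\<in>{m\<in>keys p. lookup m i = j}. single m (lookup p m))"
    by (rule sum.group[symmetric]) (use N in auto)
  also have "\<dots> = (\<Sum>j\<le>N. Q j * Var i ^ j)"
    unfolding Q_def sum_distrib_right by (intro sum.cong refl single_split) auto
  finally have "p = (\<Sum>j\<le>N. Q j * Var i ^ j)" .
  moreover have "Q j \<in> polys_on (I - {i})" for j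
    unfolding Q_def using assms
    by (intro polys_on_sum polys_on_single) (auto simp: single_split polys_on_def)
  ultimately show thesis using that by blast
qed

text \<open>
  Induction on the variables: for fixed values of the others, the polynomial vanishes identically as a
  univariate polynomial in the last one, hence so do its coefficients. Polynomial identities can
  therefore be checked at real points.
\<close>

lemma ev_eq_0:
  fixes p :: rpoly
  assumes "\<And>v::nat\<Rightarrow>real. ev v p = 0"
  shows "p = 0"
proof -
  have "p = 0" if "finite I" "p \<in> polys_on I" "\<And>v::nat\<Rightarrow>real. ev v p = 0" for I p
    using that
  proof (induction I arbitrary: p rule: finite_induct)
    case empty
    have "m = 0" if "m \<in> keys p" for m
      using empty(1) that by (auto simp: polys_on_def)
    then have "keys p \<subseteq> {0}" by auto
    then have "p = Const (lookup p 0)"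
      by (intro poly_mapping_eqI) (auto simp: Const_def lookup_single when_def in_keys_iff)
    with empty(2)[of "\<lambda>_. 0"] show ?case
      by (metis Const_def ev_Const of_real_eq_0_iff single_zero)
  next
    case (insert i I)
    obtain N Q where Q: "\<And>j. Q j \<in> polys_on (I - {i})" "p = (\<Sum>j\<le>(N::nat). Q j * Var i ^ j)"
      using polys_on_insertE insert.prems(1) by blast
    have "Q j = 0" if j: "j \<le> N" for j
    proof (rule insert.IH)
      show "Q j \<in> polys_on I" using Q(1) polys_on_mono by blast
      fix v :: "nat \<Rightarrow> real"
      have "(\<Sum>j\<le>N. ev v (Q j) * x ^ j) = 0" for x
      proof -
        have "ev (v(i:=x)) p = 0" by (rule insert.prems)
        moreover have "ev (v(i:=x)) (Q j) = ev v (Q j)" for j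
          by (rule ev_cong[OF Q(1)]) auto
        ultimately show ?thesis by (simp add: Q(2) ev_simps)
      qed
      then show "ev v (Q j) = 0" using polyfun_eq_0[of "\<lambda>j. ev v (Q j)" N] j by auto
    qed
    then show ?case using Q(2) by simp
  qed
  from this[of "\<Union>(keys ` keys p)" p] assms show ?thesis
    by (auto simp: polys_on_def)
qed

lemma rpoly_eqI:
  fixes p q :: rpoly
  assumes "\<And>v::nat\<Rightarrow>real. ev v p = ev v q"
  shows "p = q"
  using ev_eq_0[of "p - q"] assms by (simp add: ev_diff)

section \<open>From a sum of squares to the discriminant\<close>

lemma lookup_mult_sum:
  fixes p q :: rpoly
  shows "lookup (p * q) m = (\<Sum>a\<in>keys p. \<Sum>b\<in>keys q. if a + b = m then lookup p a * lookup q b else 0)"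
proof -
  have "p * q = (\<Sum>a\<in>keys p. \<Sum>b\<in>keys q. single (a + b) (lookup p a * lookup q b))"
    by (subst sum_monomials[of p], subst sum_monomials[of q])
      (simp add: sum_product mult_single)
  then show ?thesis by (simp add: lookup_sum lookup_single when_def)
qed

text \<open>
  Among the monomials of all \<open>h\<^sub>k\<close> take those of least weight, and of these the least one \<open>m\<^sub>0\<close> in the
  monomial order. Then \<open>m\<^sub>0 + m\<^sub>0\<close> cannot be written as another sum of two such monomials, so its coefficient in
  the sum of squares is a sum of squares of real numbers, one of them nonzero. Hence the minimal weight of
  the sum is exactly twice the minimal weight of the \<open>h\<^sub>k\<close>. Weights may be negative, which turns upper
  bounds on degrees into instances of the same statement.
\<close>

lemma sum_squares_weight_ge:
  fixes h :: "nat \<Rightarrow> rpoly" and w :: "(nat \<Rightarrow>\<^sub>0 nat) \<Rightarrow> int"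
  assumes add: "\<And>a b. w (a + b) = w a + w b"
    and P: "\<And>m. m \<in> keys (\<Sum>k<N. (h k)\<^sup>2) \<Longrightarrow> w m \<ge> 2 * d"
    and "k < N" "m \<in> keys (h k)"
  shows "w m \<ge> d"
proof -
  define M where "M = (\<Union>k<N. keys (h k))"
  define \<mu> where "\<mu> = Min (w ` M)"
  define M0 where "M0 = {m\<in>M. w m = \<mu>}"
  define m0 where "m0 = Min M0"
  have M: "finite M" "m \<in> M" using assms(3,4) by (auto simp: M_def)
  then have "\<mu> \<in> w ` M" unfolding \<mu>_def by (intro Min_in) auto
  then have M0: "finite M0" "M0 \<noteq> {}" using M(1) by (auto simp: M0_def)
  then have m0: "m0 \<in> M0" unfolding m0_def by (rule Min_in)
  have w_ge: "w a \<ge> \<mu>" if "a \<in> M" for a using that M(1) by (simp add: \<mu>_def)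
  have unique: "a = m0 \<and> b = m0" if ab: "a \<in> M" "b \<in> M" "a + b = m0 + m0" for a b
  proof -
    have "w a + w b = \<mu> + \<mu>" using ab(3) add m0 by (metis (mono_tags) M0_def mem_Collect_eq)
    then have "w a = \<mu>" "w b = \<mu>" using w_ge[OF ab(1)] w_ge[OF ab(2)] by auto
    then have "m0 \<le> a" "m0 \<le> b" using ab M0(1) by (auto simp: m0_def M0_def intro!: Min_le)
    then show ?thesis
      using ab(3) by (metis add_less_le_mono add_le_less_mono less_irrefl order.not_eq_order_implies_strict)
  qed
  have sq: "lookup ((h k)\<^sup>2) (m0 + m0) = (lookup (h k) m0)\<^sup>2" if k: "k < N" for k
  proof -
    have "lookup ((h k)\<^sup>2) (m0 + m0)
        = (\<Sum>a\<in>keys (h k). \<Sum>b\<in>keys (h k). if a = m0 then if b = m0 then (lookup (h k) m0)\<^sup>2 else 0 else 0)"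
      unfolding power2_eq_square[of "h k"] lookup_mult_sum
    proof (intro sum.cong refl)
      fix a b assume "a \<in> keys (h k)" "b \<in> keys (h k)"
      then have "a \<in> M" "b \<in> M" using k by (auto simp: M_def)
      then show "(if a + b = m0 + m0 then lookup (h k) a * lookup (h k) b else 0)
          = (if a = m0 then if b = m0 then (lookup (h k) m0)\<^sup>2 else 0 else 0)"
        using unique[of a b] by (auto simp: power2_eq_square)
    qed
    also have "\<dots> = (\<Sum>a\<in>keys (h k). if a = m0 then \<Sum>b\<in>keys (h k). if b = m0 then (lookup (h k) m0)\<^sup>2 else 0 else 0)"
      by (intro sum.cong) auto
    also have "\<dots> = (lookup (h k) m0)\<^sup>2"
      by (simp add: in_keys_iff)
    finally show ?thesis .
  qed
  obtain k' where k': "k' < N" "m0 \<in> keys (h k')" using m0 by (auto simp: M0_def M_def)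
  have "lookup (\<Sum>k<N. (h k)\<^sup>2) (m0 + m0) = (\<Sum>k<N. (lookup (h k) m0)\<^sup>2)"
    unfolding lookup_sum by (intro sum.cong) (auto simp: sq)
  also have "\<dots> > 0"
    by (rule sum_pos2[of _ k']) (use k' in \<open>auto simp: in_keys_iff\<close>)
  finally have "m0 + m0 \<in> keys (\<Sum>k<N. (h k)\<^sup>2)" by (simp add: in_keys_iff)
  from P[OF this] have "\<mu> \<ge> d" using m0 by (simp add: add M0_def)
  with w_ge[OF M(2)] show ?thesis by simp
qed

lemma sum_squares_forms:
  fixes h :: "nat \<Rightarrow> rpoly"
  assumes "(\<Sum>k<N. (h k)\<^sup>2) \<in> forms n (2 * d)" "k < N" "h k \<in> polys n"
  shows "h k \<in> forms n d"
proof -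
  have "mon_degree m = d" if m: "m \<in> keys (h k)" for m
  proof (rule antisym)
    have "int (mon_degree m) \<ge> int d"
      by (rule sum_squares_weight_ge[where h = h, OF _ _ assms(2) m])
        (use assms(1) in \<open>auto simp: mon_degree_add forms_def\<close>)
    then show "d \<le> mon_degree m" by simp
    have "- int (mon_degree m) \<ge> - int d"
      by (rule sum_squares_weight_ge[where h = h and w = "\<lambda>m. - int (mon_degree m)", OF _ _ assms(2) m])
        (use assms(1) in \<open>auto simp: mon_degree_add forms_def\<close>)
    then show "mon_degree m \<le> d" by simp
  qed
  then show ?thesis using assms(3) by (simp add: forms_def)
qed

definition deg_in_le :: "nat \<Rightarrow> nat \<Rightarrow> rpoly \<Rightarrow> bool" where
  "deg_in_le i d p \<longleftrightarrow> (\<forall>m\<in>keys p. lookup m i \<le> d)"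

lemma deg_in_le_add: "deg_in_le i d p \<Longrightarrow> deg_in_le i d q \<Longrightarrow> deg_in_le i d (p + q)"
  using keys_add[of p q] by (auto simp: deg_in_le_def)

lemma deg_in_le_mult:
  assumes "deg_in_le i d p" "deg_in_le i e q"
  shows "deg_in_le i (d + e) (p * q)"
  unfolding deg_in_le_def
proof
  fix m assume "m \<in> keys (p * q)"
  then obtain a b where "m = a + b" "a \<in> keys p" "b \<in> keys q"
    using keys_mult[of p q] by blast
  then show "lookup m i \<le> d + e" using assms by (auto simp: deg_in_le_def lookup_add intro: add_mono)
qed

lemma deg_in_le_mono: "deg_in_le i d p \<Longrightarrow> d \<le> e \<Longrightarrow> deg_in_le i e p"
  by (auto simp: deg_in_le_def)

lemma deg_in_le_polys_on: "p \<in> polys_on I \<Longrightarrow> i \<notin> I \<Longrightarrow> deg_in_le i 0 p"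
  unfolding deg_in_le_def polys_on_def
  by (metis (mono_tags, lifting) in_keys_iff le_refl mem_Collect_eq subsetD)

lemma deg_in_le_Var: "deg_in_le i 1 (Var i)"
  by (simp add: deg_in_le_def Var_def)

lemma sum_squares_deg_in_le:
  fixes h :: "nat \<Rightarrow> rpoly"
  assumes "deg_in_le i (2 * d) (\<Sum>k<N. (h k)\<^sup>2)" "k < N"
  shows "deg_in_le i d (h k)"
  unfolding deg_in_le_def
proof
  fix m assume m: "m \<in> keys (h k)"
  have "- int (lookup m i) \<ge> - int d"
    by (rule sum_squares_weight_ge[where h = h and w = "\<lambda>m. - int (lookup m i)", OF _ _ assms(2) m])
      (use assms(1) in \<open>auto simp: lookup_add deg_in_le_def\<close>)
  then show "lookup m i \<le> d" by simp
qed

lemma forms_linear_in_last: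
  assumes "h \<in> forms (Suc n) (Suc d)" "deg_in_le n 1 h"
  shows "\<exists>p\<in>forms n d. \<exists>r\<in>forms n (Suc d). h = p * Var n + r"
proof (rule monomial_induct[where p = h])
  show "\<exists>p\<in>forms n d. \<exists>r\<in>forms n (Suc d). 0 = p * Var n + r"
    by (intro bexI[of _ 0]) auto
next
  fix f g
  assume "\<exists>p\<in>forms n d. \<exists>r\<in>forms n (Suc d). f = p * Var n + r"
    "\<exists>p\<in>forms n d. \<exists>r\<in>forms n (Suc d). g = p * Var n + r"
  then obtain p r p' r' where "p \<in> forms n d" "r \<in> forms n (Suc d)" "f = p * Var n + r"
    "p' \<in> forms n d" "r' \<in> forms n (Suc d)" "g = p' * Var n + r'" by blast
  then show "\<exists>p\<in>forms n d. \<exists>r\<in>forms n (Suc d). f + g = p * Var n + r"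
    by (intro bexI[of _ "p + p'"] bexI[of _ "r + r'"]) (auto simp: algebra_simps forms_add)
next
  fix m c assume m: "m \<in> keys h"
  have m': "keys m \<subseteq> {..<Suc n}" "mon_degree m = Suc d" "lookup m n \<le> 1"
    using m assms by (auto simp: forms_def polys_def deg_in_le_def)
  show "\<exists>p\<in>forms n d. \<exists>r\<in>forms n (Suc d). single m c = p * Var n + r"
  proof (cases "lookup m n")
    case 0
    then have "keys m \<subseteq> {..<n}"
      using m'(1) by (metis in_keys_iff lessThan_Suc subset_insert)
    then have "single m c \<in> forms n (Suc d)" using m'(2) by (auto simp: forms_def polys_def)
    then show ?thesis by (intro bexI[of _ 0] bexI[of _ "single m c"]) auto
  next
    case (Suc j)
    then have 1: "lookup m n = 1" using m'(3) by simp
    let ?m = "m - single n 1"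
    have "m = ?m + single n 1"
      using 1 by (intro poly_mapping_eqI) (auto simp: lookup_add lookup_minus lookup_single when_def)
    then have "mon_degree m = mon_degree ?m + mon_degree (single n 1)"
      by (metis mon_degree_add)
    moreover have "mon_degree (single n 1) = 1" by (simp add: mon_degree_def)
    ultimately have "mon_degree ?m = d" using m'(2) by simp
    have "keys ?m \<subseteq> {..<n}"
      using single_split(2)[OF 1] m'(1) by (auto simp: less_Suc_eq)
    with \<open>mon_degree ?m = d\<close> have "single ?m c \<in> forms n d" by (auto simp: forms_def polys_def)
    then show ?thesis
      by (intro bexI[of _ "single ?m c"] bexI[of _ 0]) (auto simp: single_split(1)[OF 1, of c])
  qed
qed

text \<open>
  Comparing coefficients in \<open>t\<close> shows that \<open>q a\<close>, \<open>q b\<close>, \<open>q c\<close> are the entries of the Gram matrix of the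
  vectors \<open>p\<close> and \<open>r\<close>; the right-hand side is the squared length of \<open>a r - b p\<close>.
\<close>

lemma quadratic_gram_identity:
  fixes a b c q :: real and p r :: "nat \<Rightarrow> real"
  assumes "\<And>t. q * (a * t\<^sup>2 + 2 * b * t + c) = (\<Sum>k<N. (p k * t + r k)\<^sup>2)"
  shows "a * q * (a * c - b\<^sup>2) = (\<Sum>k<N. (a * r k - b * p k)\<^sup>2)"
proof -
  define P R S where "P = (\<Sum>k<N. (p k)\<^sup>2)" and "R = (\<Sum>k<N. (r k)\<^sup>2)" and "S = (\<Sum>k<N. p k * r k)"
  have *: "(\<Sum>k<N. (p k * t + r k * s)\<^sup>2) = P * t\<^sup>2 + 2 * S * t * s + R * s\<^sup>2" for t s
    unfolding P_def R_def S_def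
    by (simp add: power2_sum power_mult_distrib sum.distrib sum_distrib_left sum_distrib_right mult_ac)
  have q: "q * (a * t\<^sup>2 + 2 * b * t + c) = P * t\<^sup>2 + 2 * S * t + R" for t
    using assms[of t] *[of t 1] by simp
  have PRS: "R = q * c" "P = q * a" "S = q * b"
    using q[of 0] q[of 1] q[of "-1"] by (auto simp: algebra_simps)
  have "(\<Sum>k<N. (a * r k - b * p k)\<^sup>2) = P * b\<^sup>2 - 2 * S * b * a + R * a\<^sup>2"
    using *[of "- b" a] by (simp add: mult.commute)
  also have "\<dots> = a * q * (a * c - b\<^sup>2)"
    unfolding PRS by (simp add: power2_eq_square algebra_simps)
  finally show ?thesis ..
qed

text \<open>
  Each \<open>h\<^sub>k\<close> inherits half of the degree of the sum and half of its degree in \<open>u\<close>, so it has the shape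
  \<open>p\<^sub>k u + r\<^sub>k\<close> and \<open>quadratic_gram_identity\<close> applies at every point.
\<close>

lemma discriminant_sum_of_squares:
  fixes h :: "nat \<Rightarrow> rpoly"
  assumes a: "a \<in> forms 3 2" and b: "b \<in> forms 3 3" and c: "c \<in> forms 3 4"
    and q: "q \<in> forms 3 (2 * j)"
    and h: "\<And>k. k < N \<Longrightarrow> h k \<in> polys 4"
    and eq: "q * quad_in_u a b c = (\<Sum>k<N. (h k)\<^sup>2)"
    and form: "q * quad_in_u a b c \<in> forms 4 (4 + 2 * j)"
  shows "\<exists>p r. (\<forall>k<N. p k \<in> forms 3 (1 + j) \<and> r k \<in> forms 3 (2 + j)) \<and>
      a * q * discr a b c = (\<Sum>k<N. (a * r k - b * p k)\<^sup>2)"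
proof -
  have pol: "a \<in> polys_on {..<3}" "b \<in> polys_on {..<3}" "c \<in> polys_on {..<3}" "q \<in> polys_on {..<3}"
    using a b c q by (auto simp: forms_polys_on)
  have "deg_in_le 3 2 (q * quad_in_u a b c)"
  proof -
    have "deg_in_le 3 (0 + 2) (q * (a * (Var 3)\<^sup>2 + 2 * b * Var 3 + c))"
    proof (intro deg_in_le_mult deg_in_le_add)
      have 0: "deg_in_le 3 0 a" "deg_in_le 3 0 b" "deg_in_le 3 0 c" "deg_in_le 3 0 (2 :: rpoly)"
        using pol polys_on_numeral by (auto intro!: deg_in_le_polys_on)
      show "deg_in_le 3 0 q" "deg_in_le 3 2 c"
        using pol by (auto intro: deg_in_le_polys_on deg_in_le_mono)
      show "deg_in_le 3 2 (a * (Var 3)\<^sup>2)"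
        using deg_in_le_mult[OF 0(1) deg_in_le_mult[OF deg_in_le_Var deg_in_le_Var]]
        by (simp add: power2_eq_square numeral_2_eq_2)
      show "deg_in_le 3 2 (2 * b * Var 3)"
        using deg_in_le_mult[OF deg_in_le_mult[OF 0(4,2)] deg_in_le_Var] by (auto intro: deg_in_le_mono)
    qed
    then show ?thesis by (simp only: add_0 quad_in_u_def U_eq)
  qed
  then have deg: "deg_in_le 3 1 (h k)" if "k < N" for k
    using sum_squares_deg_in_le[of 3 1 h N k] that by (simp add: eq)
  have "h k \<in> forms 4 (2 + j)" if "k < N" for k
  proof (rule sum_squares_forms[of h N, OF _ that h[OF that]])
    have "4 + 2 * j = 2 * (2 + j)" by simp
    then show "(\<Sum>k<N. (h k)\<^sup>2) \<in> forms 4 (2 * (2 + j))"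
      using form unfolding eq by (simp only:)
  qed
  then have "\<forall>k<N. \<exists>p r. p \<in> forms 3 (1 + j) \<and> r \<in> forms 3 (2 + j) \<and> h k = p * Var 3 + r"
    using forms_linear_in_last[of "h _" 3 "1 + j"] deg by (fastforce simp: eval_nat_numeral)
  then obtain p r where pr: "\<And>k. k < N \<Longrightarrow> p k \<in> forms 3 (1 + j)"
    "\<And>k. k < N \<Longrightarrow> r k \<in> forms 3 (2 + j)" "\<And>k. k < N \<Longrightarrow> h k = p k * Var 3 + r k"
    by metis
  have "a * q * discr a b c = (\<Sum>k<N. (a * r k - b * p k)\<^sup>2)"
  proof (rule rpoly_eqI)
    fix v :: "nat \<Rightarrow> real"
    have ev3: "ev (v(3 := t)) f = ev v f" if "f \<in> polys_on {..<3}" for f t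
      by (rule ev_cong[OF that]) auto
    have "ev v a * ev v q * (ev v a * ev v c - (ev v b)\<^sup>2)
        = (\<Sum>k<N. (ev v a * ev v (r k) - ev v b * ev v (p k))\<^sup>2)"
    proof (rule quadratic_gram_identity)
      fix t
      have "ev (v(3 := t)) (q * quad_in_u a b c) = (\<Sum>k<N. (ev (v(3 := t)) (h k))\<^sup>2)"
        by (simp add: eq ev_simps)
      also have "\<dots> = (\<Sum>k<N. (ev v (p k) * t + ev v (r k))\<^sup>2)"
        by (intro sum.cong refl) (simp add: pr(3) ev_simps ev3 forms_polys_on[OF pr(1)] forms_polys_on[OF pr(2)])
      finally show "ev v q * (ev v a * t\<^sup>2 + 2 * ev v b * t + ev v c)
          = (\<Sum>k<N. (ev v (p k) * t + ev v (r k))\<^sup>2)"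
        by (simp add: quad_in_u_def U_eq ev_simps ev3 pol)
    qed
    then show "ev v (a * q * discr a b c) = ev v (\<Sum>k<N. (a * r k - b * p k)\<^sup>2)"
      by (simp add: ev_simps discr_def)
  qed
  with pr show ?thesis by blast
qed

section \<open>Ternary forms as functions\<close>

text \<open>
  Homogeneous polynomial functions on \<open>\<real>\<^sup>3\<close>, as sums of monomials. In this form closure under products
  and linear substitutions is a short induction, which makes changes of coordinates cheap.
\<close>

inductive form_fun :: "nat \<Rightarrow> (real \<Rightarrow> real \<Rightarrow> real \<Rightarrow> real) \<Rightarrow> bool" where
  monom: "i + j + k = d \<Longrightarrow> form_fun d (\<lambda>x y z. c * x ^ i * y ^ j * z ^ k)"
| add: "form_fun d F \<Longrightarrow> form_fun d G \<Longrightarrow> form_fun d (\<lambda>x y z. F x y z + G x y z)"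

lemma form_fun_cong: "form_fun d F \<Longrightarrow> (\<And>x y z. F x y z = G x y z) \<Longrightarrow> form_fun d G"
proof -
  assume "form_fun d F" "\<And>x y z. F x y z = G x y z"
  moreover from this(2) have "F = G" by (intro ext)
  ultimately show ?thesis by simp
qed

lemma form_fun_monomI: "i + j + k = d \<Longrightarrow> (\<And>x y z. F x y z = c * x ^ i * y ^ j * z ^ k) \<Longrightarrow> form_fun d F"
  by (rule form_fun_cong[OF form_fun.monom]) auto

lemma form_fun_0: "form_fun d (\<lambda>x y z. 0)"
  by (rule form_fun_monomI[of d 0 0 _ _ 0]) auto

lemma form_fun_mult_monom: "form_fun e G \<Longrightarrow> i + j + k = d \<Longrightarrow>
   form_fun (d + e) (\<lambda>x y z. (c * x ^ i * y ^ j * z ^ k) * G x y z)"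
proof (induction rule: form_fun.induct)
  case (monom i' j' k' e c')
  then show ?case
    by (intro form_fun_monomI[of "i+i'" "j+j'" "k+k'" _ _ "c*c'"]) (auto simp: power_add)
next
  case (add e F G)
  then show ?case
    by (intro form_fun_cong[OF form_fun.add[OF add.IH]]) (auto simp: algebra_simps)
qed

lemma form_fun_mult: "form_fun d F \<Longrightarrow> form_fun e G \<Longrightarrow> form_fun (d + e) (\<lambda>x y z. F x y z * G x y z)"
proof (induction rule: form_fun.induct)
  case (monom i j k d c)
  then show ?case using form_fun_mult_monom by blast
next
  case (add d F G)
  then show ?case
    by (intro form_fun_cong[OF form_fun.add[OF add.IH]]) (auto simp: algebra_simps)
qed

lemma form_fun_const: "form_fun 0 (\<lambda>x y z. c)"
  by (rule form_fun_monomI[of 0 0 0 _ _ c]) auto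

lemma form_fun_scale: "form_fun d F \<Longrightarrow> form_fun d (\<lambda>x y z. c * F x y z)"
  using form_fun_mult[OF form_fun_const, of d F c] by simp

lemma form_fun_diff: "form_fun d F \<Longrightarrow> form_fun d G \<Longrightarrow> form_fun d (\<lambda>x y z. F x y z - G x y z)"
  by (rule form_fun_cong[OF form_fun.add[OF _ form_fun_scale[of d G "-1"]]]) auto

lemma form_fun_power: "form_fun d F \<Longrightarrow> form_fun (n * d) (\<lambda>x y z. F x y z ^ n)"
proof (induction n)
  case (Suc n)
  then show ?case using form_fun_mult[of d F "n * d"] by simp
qed (simp add: form_fun_const)

lemma form_fun_sum: "(\<And>k. k \<in> A \<Longrightarrow> form_fun d (F k)) \<Longrightarrow> form_fun d (\<lambda>x y z. \<Sum>k\<in>A. F k x y z)"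
  by (induction A rule: infinite_finite_induct) (auto intro: form_fun_0 form_fun.add)

lemma form_fun_linear: "form_fun 1 (\<lambda>x y z. a * x + b * y + c * z)"
  by (intro form_fun.add; rule form_fun_monomI[of 1 0 0 _ _ a] form_fun_monomI[of 0 1 0 _ _ b] form_fun_monomI[of 0 0 1 _ _ c]; simp)

lemma form_fun_subst:
  assumes "form_fun d F" "form_fun 1 A" "form_fun 1 B" "form_fun 1 C"
  shows "form_fun d (\<lambda>x y z. F (A x y z) (B x y z) (C x y z))"
  using assms(1)
proof (induction rule: form_fun.induct)
  case (monom i j k d c)
  have "form_fun (i * 1 + j * 1 + k * 1) (\<lambda>x y z. A x y z ^ i * B x y z ^ j * C x y z ^ k)"
    by (intro form_fun_mult form_fun_power assms)
  then have "form_fun d (\<lambda>x y z. A x y z ^ i * B x y z ^ j * C x y z ^ k)"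
    using monom by simp
  from form_fun_scale[OF this, of c] show ?case by (simp add: mult.assoc)
qed (auto intro: form_fun.add)

lemma form_fun_homogeneous: "form_fun d F \<Longrightarrow> F (t * x) (t * y) (t * z) = t ^ d * F x y z"
  by (induction rule: form_fun.induct) (auto simp: power_mult_distrib power_add algebra_simps)

lemma form_fun_continuous: "form_fun d F \<Longrightarrow> continuous_on S (\<lambda>(x, y, z). F x y z)"
  unfolding case_prod_unfold by (induction rule: form_fun.induct) (auto intro!: continuous_intros)

lemma form_fun_coeffsE:
  assumes "form_fun d F"
  obtains c where "\<And>x y z. F x y z = (\<Sum>i\<le>d. \<Sum>j\<le>d-i. c i j * x^i * y^j * z^(d-i-j))"
  using assms
proof (induction arbitrary: thesis rule: form_fun.induct)
  case (monom i j k d c)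
  have "c * x^i * y^j * z^k
      = (\<Sum>i'\<le>d. \<Sum>j'\<le>d-i'. (if i' = i then if j' = j then c else 0 else 0) * x^i' * y^j' * z^(d-i'-j'))"
    for x y z
  proof -
    let ?t = "\<lambda>i' j'. (if i' = i then if j' = j then c else 0 else 0) * x^i' * y^j' * z^(d-i'-j')"
    have "(\<Sum>i'\<le>d. \<Sum>j'\<le>d-i'. ?t i' j') = (\<Sum>j'\<le>d-i. ?t i j')"
      using monom(1) by (subst sum.remove[of _ i]) (auto intro!: sum.neutral)
    also have "\<dots> = ?t i j"
      using monom(1) by (subst sum.remove[of _ j]) (auto intro!: sum.neutral)
    also have "\<dots> = c * x^i * y^j * z^k"
      using monom(1) by auto
    finally show ?thesis ..
  qed
  then show ?case by (rule monom(2))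
next
  case (add d F G)
  obtain c where c: "\<And>x y z. F x y z = (\<Sum>i\<le>d. \<Sum>j\<le>d-i. c i j * x^i * y^j * z^(d-i-j))"
    using add.IH(1) by blast
  obtain c' where c': "\<And>x y z. G x y z = (\<Sum>i\<le>d. \<Sum>j\<le>d-i. c' i j * x^i * y^j * z^(d-i-j))"
    using add.IH(2) by blast
  show ?case
    by (rule add.prems[of "\<lambda>i j. c i j + c' i j"]) (simp add: c c' sum.distrib distrib_right)
qed

lemma form_fun_2E:
  assumes "form_fun 2 F"
  obtains a1 a2 a3 b1 b2 b3 where
    "\<And>x y z. F x y z = a1*x^2 + a2*y^2 + a3*z^2 + b1*y*z + b2*x*z + b3*x*y"
proof -
  obtain c where c: "\<And>x y z. F x y z = (\<Sum>i\<le>2. \<Sum>j\<le>2-i. c i j * x^i * y^j * z^(2-i-j))"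
    using form_fun_coeffsE[OF assms] by blast
  show thesis
    by (rule that[of "c 2 0" "c 0 2" "c 0 0" "c 0 1" "c 1 0" "c 1 1"])
      (simp add: c eval_nat_numeral)
qed

text \<open>
  Ordered by powers of \<open>x\<close>; the factor 2 prepares for discriminants with respect to \<open>x\<close>.
\<close>

lemma form_fun_4E:
  assumes "form_fun 4 F"
  obtains e l1 l2 f1 f2 f3 g1 g2 g3 g4 h1 h2 h3 h4 h5 where
    "\<And>x y z. F x y z = e*x^4 + x^3*(l1*y + l2*z) + x^2*(f1*y^2 + f2*y*z + f3*z^2)
       + 2*x*(g1*y^3 + g2*y^2*z + g3*y*z^2 + g4*z^3)
       + (h1*y^4 + h2*y^3*z + h3*y^2*z^2 + h4*y*z^3 + h5*z^4)"
proof -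
  obtain c where c: "\<And>x y z. F x y z = (\<Sum>i\<le>4. \<Sum>j\<le>4-i. c i j * x^i * y^j * z^(4-i-j))"
    using form_fun_coeffsE[OF assms] by blast
  show thesis
    by (rule that[of "c 4 0" "c 3 1" "c 3 0" "c 2 2" "c 2 1" "c 2 0" "c 1 3 / 2" "c 1 2 / 2" "c 1 1 / 2"
          "c 1 0 / 2" "c 0 4" "c 0 3" "c 0 2" "c 0 1" "c 0 0"])
      (simp add: c eval_nat_numeral algebra_simps)
qed

section \<open>Nonnegative functions in one and two variables\<close>

text \<open>
  Compare the minimum of \<open>F\<close> with the maximum of \<open>N\<close> on the unit sphere and extend by homogeneity.
\<close>

lemma homogeneous_lower_bound:
  fixes F N :: "'a::euclidean_space \<Rightarrow> real"
  assumes "continuous_on UNIV F" "continuous_on UNIV N"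
    and F: "\<And>t v. F (t *\<^sub>R v) = t ^ n * F v" and N: "\<And>t v. N (t *\<^sub>R v) = t ^ n * N v"
    and "n > 0" and pos: "\<And>v. v \<noteq> 0 \<Longrightarrow> F v > 0"
  obtains \<epsilon> where "\<epsilon> > 0" "\<And>v. \<epsilon> * N v \<le> F v"
proof -
  let ?S = "sphere (0::'a) 1"
  have ne: "?S \<noteq> {}" by simp
  have "continuous_on ?S F" "continuous_on ?S N"
    using assms(1,2) continuous_on_subset by blast+
  then obtain a b where a: "a \<in> ?S" "\<And>v. v \<in> ?S \<Longrightarrow> F a \<le> F v"
    and b: "b \<in> ?S" "\<And>v. v \<in> ?S \<Longrightarrow> N v \<le> N b"
    using continuous_attains_inf[OF compact_sphere ne] continuous_attains_sup[OF compact_sphere ne]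
    by metis
  have "F a > 0" using a(1) by (intro pos) auto
  define \<epsilon> where "\<epsilon> = F a / (\<bar>N b\<bar> + 1)"
  have "\<epsilon> > 0" using \<open>F a > 0\<close> by (simp add: \<epsilon>_def)
  have "\<epsilon> * N v \<le> F v" for v
  proof (cases "v = 0")
    case True
    then show ?thesis using F[of 0 v] N[of 0 v] \<open>n > 0\<close> by (simp add: power_0_left)
  next
    case False
    let ?w = "v /\<^sub>R norm v"
    have w: "?w \<in> ?S" "v = norm v *\<^sub>R ?w" using False by auto
    have "\<epsilon> * N ?w \<le> \<epsilon> * (\<bar>N b\<bar> + 1)"
      using b(2)[OF w(1)] \<open>\<epsilon> > 0\<close> by (intro mult_left_mono) auto
    also have "\<dots> = F a" by (simp add: \<epsilon>_def add_nonneg_eq_0_iff)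
    also have "\<dots> \<le> F ?w" by (rule a(2)[OF w(1)])
    finally have "norm v ^ n * (\<epsilon> * N ?w) \<le> norm v ^ n * F ?w"
      by (intro mult_left_mono) auto
    then show ?thesis using F[of "norm v" ?w] N[of "norm v" ?w] False by (simp add: mult.left_commute)
  qed
  with \<open>\<epsilon> > 0\<close> show thesis by (rule that)
qed

lemma binary_lower_bound:
  fixes F N :: "real \<Rightarrow> real \<Rightarrow> real"
  assumes "continuous_on UNIV (\<lambda>(y, z). F y z)" "continuous_on UNIV (\<lambda>(y, z). N y z)"
    and "\<And>t y z. F (t * y) (t * z) = t ^ n * F y z" and "\<And>t y z. N (t * y) (t * z) = t ^ n * N y z"
    and "n > 0" and "\<And>y z. y \<noteq> 0 \<or> z \<noteq> 0 \<Longrightarrow> F y z > 0"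
  obtains \<epsilon> where "\<epsilon> > 0" "\<And>y z. \<epsilon> * N y z \<le> F y z"
proof -
  have "(\<lambda>(y, z). F y z) v > 0" if "v \<noteq> 0" for v
    using that assms(6)[of "fst v" "snd v"] by (simp add: case_prod_unfold prod_eq_iff)
  note pos = this
  show thesis
  proof (rule homogeneous_lower_bound[OF assms(1,2) _ _ assms(5) pos])
    fix \<epsilon> :: real
    assume "\<epsilon> > 0" and *: "\<And>v. \<epsilon> * (case v of (y, z) \<Rightarrow> N y z) \<le> (case v of (y, z) \<Rightarrow> F y z)"
    then show thesis using *[of "(_, _)"] that by simp
  qed (auto simp: assms(3,4))
qed

text \<open>
  Cancelling a square from a nonnegative product loses the information at the zeros of that square;
  continuity restores it.
\<close>

lemma nonneg_at_0:
  fixes \<phi> :: "real \<Rightarrow> real"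
  assumes "isCont \<phi> 0" "\<And>t. t \<noteq> 0 \<Longrightarrow> \<phi> t \<ge> 0"
  shows "\<phi> 0 \<ge> 0"
proof (rule tendsto_lowerbound[where F = "at 0" and f = \<phi>])
  show "(\<phi> \<longlongrightarrow> \<phi> 0) (at 0)" using assms(1) by (simp add: isCont_def)
  show "\<forall>\<^sub>F x in at 0. 0 \<le> \<phi> x" using assms(2) by (auto simp: eventually_at_filter)
qed simp

lemma nonneg_quadratic:
  fixes A B C :: real
  assumes "\<And>t. A * t^2 + 2 * B * t + C \<ge> 0"
  shows "A \<ge> 0" "C \<ge> 0" "B^2 \<le> A * C"
proof -
  show C: "C \<ge> 0" using assms[of 0] by simp
  have *: "A + 2 * B * t + C * t^2 \<ge> 0" if "t \<noteq> 0" for t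
  proof -
    have "t^2 * (A * (1/t)^2 + 2 * B * (1/t) + C) \<ge> 0" using assms[of "1/t"] by simp
    also have "t^2 * (A * (1/t)^2 + 2 * B * (1/t) + C) = A + 2 * B * t + C * t^2"
      using that by (simp add: power2_eq_square distrib_left)
    finally show ?thesis .
  qed
  show A: "A \<ge> 0"
    using nonneg_at_0[of "\<lambda>t. A + 2 * B * t + C * t^2"] * by simp
  show "B^2 \<le> A * C"
  proof (cases "A = 0")
    case False
    have "A * (A * (- B / A)^2 + 2 * B * (- B / A) + C) \<ge> 0" using assms[of "- B / A"] A by simp
    also have "A * (A * (- B / A)^2 + 2 * B * (- B / A) + C) = A * C - B^2"
      using False by (simp add: power2_eq_square right_diff_distrib)
    finally show ?thesis by simp
  next
    case True
    have "B = 0"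
    proof (rule ccontr)
      assume "B \<noteq> 0"
      have "2 * B * (- (C + 1) / (2 * B)) + C = -1" using \<open>B \<noteq> 0\<close> by simp
      moreover have "2 * B * (- (C + 1) / (2 * B)) + C \<ge> 0"
        using assms[of "- (C + 1) / (2 * B)"] True by simp
      ultimately show False by simp
    qed
    then show ?thesis using True by simp
  qed
qed

text \<open>
  An odd leading term dominates for large arguments and takes both signs.
\<close>

lemma nonneg_cubic:
  fixes A B C D :: real
  assumes "\<And>t. A * t^3 + B * t^2 + C * t + D \<ge> 0"
  shows "A = 0"
proof (rule ccontr)
  assume "A \<noteq> 0"
  \<comment> \<open>At this distance from the origin the leading term outweighs the sum of all others.\<close>
  define s where "s = 1 + (\<bar>B\<bar> + \<bar>C\<bar> + \<bar>D\<bar>) / \<bar>A\<bar>"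
  have s: "s \<ge> 1" "\<bar>A\<bar> * s = \<bar>A\<bar> + \<bar>B\<bar> + \<bar>C\<bar> + \<bar>D\<bar>"
    using \<open>A \<noteq> 0\<close> by (auto simp: s_def field_simps)
  have s2: "s \<le> s^2" "1 \<le> s^2" using s(1) by (auto simp: power2_eq_square intro: mult_mono[of 1 s 1 s, simplified])
  define t where "t = - sgn A * s"
  have "A * t^3 = - (\<bar>A\<bar> * s) * s^2"
    using \<open>A \<noteq> 0\<close> by (auto simp: t_def sgn_if power3_eq_cube power2_eq_square)
  also have "\<dots> = - (\<bar>A\<bar> * s^2 + \<bar>B\<bar> * s^2 + \<bar>C\<bar> * s^2 + \<bar>D\<bar> * s^2)"
    unfolding s(2) by (simp add: algebra_simps)
  finally have 1: "A * t^3 = \<dots>" .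
  have abs_t: "\<bar>t\<bar> = s" using \<open>A \<noteq> 0\<close> s(1) by (auto simp: t_def sgn_if)
  have "t^2 = s^2" using abs_t by (metis power2_abs)
  then have "B * t^2 \<le> \<bar>B\<bar> * s^2" by (simp add: mult_right_mono)
  moreover have "C * t \<le> \<bar>C\<bar> * s^2"
  proof -
    have "C * t \<le> \<bar>C\<bar> * \<bar>t\<bar>" by (metis abs_ge_self abs_mult)
    also have "\<dots> \<le> \<bar>C\<bar> * s^2" using abs_t s2 by (intro mult_left_mono) auto
    finally show ?thesis .
  qed
  moreover have "D \<le> \<bar>D\<bar> * s^2"
    using mult_left_mono[OF s2(2), of "\<bar>D\<bar>"] by simp
  moreover have "\<bar>A\<bar> * s^2 > 0" using \<open>A \<noteq> 0\<close> s(1) by simp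
  ultimately show False using 1 assms[of t] by linarith
qed

lemma nonneg_binary_quadratic_ge_square:
  fixes p q r :: real
  assumes psd: "\<And>y z. p*y^2 + q*y*z + r*z^2 \<ge> 0" and "p \<noteq> 0 \<or> q \<noteq> 0 \<or> r \<noteq> 0"
  obtains m n where "m \<noteq> 0 \<or> n \<noteq> 0" "\<And>y z. (m*y + n*z)^2 \<le> p*y^2 + q*y*z + r*z^2"
proof -
  have d: "p \<ge> 0" "r \<ge> 0" "(q/2)^2 \<le> p * r"
    using nonneg_quadratic[of p "q/2" r] psd[of _ 1] by auto
  show thesis
  proof (cases "p = 0")
    case True
    then have "q = 0" using d by simp
    then show ?thesis using that[of 0 "sqrt r"] True d assms(2)
      by (auto simp: power_mult_distrib)
  next
    case False
    define m where "m = sqrt p"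
    have m: "m > 0" "m^2 = p" using False d by (auto simp: m_def)
    have "(m*y + (q/(2*m))*z)^2 \<le> p*y^2 + q*y*z + r*z^2" for y z
    proof -
      have "(m*y + (q/(2*m))*z)^2 = m^2*y^2 + q*y*z + (q/(2*m))^2*z^2"
        using m by (simp add: field_simps power2_eq_square)
      moreover have "p > 0" using m by auto
      have "(q/(2*m))^2 = (q/2)^2 / p"
        by (simp add: power_divide power_mult_distrib m(2))
      then have "(q/(2*m))^2 \<le> r"
        using d(3) \<open>p > 0\<close> by (simp add: divide_le_eq mult.commute)
      then have "(q/(2*m))^2*z^2 \<le> r*z^2" by (intro mult_right_mono) auto
      ultimately show ?thesis using m by simp
    qed
    then show ?thesis using that[of m "q/(2*m)"] m by auto
  qed
qed

text \<open>
  At a zero of a nonnegative function both partial derivatives vanish, so the zero is a double one.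
\<close>

lemma nonneg_binary_quadratic_zero:
  fixes p q r :: real
  assumes psd: "\<And>y z. p*y^2 + q*y*z + r*z^2 \<ge> 0"
    and "p*b^2 + q*b*c + r*c^2 = 0" "b \<noteq> 0 \<or> c \<noteq> 0"
  obtains \<kappa> where "\<kappa> \<ge> 0" "\<And>y z. p*y^2 + q*y*z + r*z^2 = \<kappa> * (c*y - b*z)^2"
proof -
  have "p*t^2 + 2*((2*p*b+q*c)/2)*t + 0 \<ge> 0" for t
  proof -
    have "p*t^2 + 2*((2*p*b+q*c)/2)*t + (p*b^2 + q*b*c + r*c^2) = p*(b+t)^2 + q*(b+t)*c + r*c^2"
      by (simp add: power2_eq_square algebra_simps)
    then show ?thesis using psd[of "b+t" c] assms(2) by linarith
  qed
  from nonneg_quadratic(3)[OF this] have 1: "2*p*b + q*c = 0" by simp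
  have "r*t^2 + 2*((2*r*c+q*b)/2)*t + 0 \<ge> 0" for t
  proof -
    have "r*t^2 + 2*((2*r*c+q*b)/2)*t + (p*b^2 + q*b*c + r*c^2) = p*b^2 + q*b*(c+t) + r*(c+t)^2"
      by (simp add: power2_eq_square algebra_simps)
    then show ?thesis using psd[of b "c+t"] assms(2) by linarith
  qed
  from nonneg_quadratic(3)[OF this] have 2: "2*r*c + q*b = 0" by simp
  have pr: "p \<ge> 0" "r \<ge> 0" using psd[of 1 0] psd[of 0 1] by auto
  show thesis
  proof (cases "c = 0")
    case False
    define \<kappa> where "\<kappa> = p / c^2"
    have p: "p = \<kappa> * c^2" using False by (simp add: \<kappa>_def)
    have "c * q = c * (- 2 * \<kappa> * b * c)" using 1 p by (simp add: power2_eq_square algebra_simps)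
    then have q: "q = - 2 * \<kappa> * b * c" using False by (metis mult_left_cancel)
    have "c * r = c * (\<kappa> * b^2)" using 2 q by (simp add: power2_eq_square algebra_simps)
    then have r: "r = \<kappa> * b^2" using False by simp
    show thesis
    proof (rule that[of \<kappa>])
      show "\<kappa> \<ge> 0" using pr by (simp add: \<kappa>_def)
      show "p*y^2 + q*y*z + r*z^2 = \<kappa> * (c*y - b*z)^2" for y z
        unfolding p q r by (simp add: power2_eq_square algebra_simps)
    qed
  next
    case True
    then have "b \<noteq> 0" using assms(3) by simp
    then have "p = 0" "q = 0" using 1 2 True by auto
    then show thesis using that[of "r / b^2"] pr \<open>b \<noteq> 0\<close> True by (simp add: power_mult_distrib)
  qed
qed

lemma binary_quadratic_factor:
  fixes p q r :: real
  assumes "p*b^2 + q*b*c + r*c^2 = 0" "b \<noteq> 0 \<or> c \<noteq> 0"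
  obtains m n where "\<And>y z. p*y^2 + q*y*z + r*z^2 = (c*y - b*z) * (m*y + n*z)"
proof (cases "c = 0")
  case False
  define m n where "m = p / c" and "n = (q + b*m) / c"
  have p: "p = c*m" and q: "q = c*n - b*m" using False by (auto simp: m_def n_def)
  have "c^2 * r = c^2 * (- b*n)" using assms(1) unfolding p q by (simp add: power2_eq_square algebra_simps)
  then have r: "r = - b*n" using False by (metis mult_left_cancel power_not_zero)
  show thesis by (rule that[of m n]) (simp add: p q r power2_eq_square algebra_simps)
next
  case True
  then have "b \<noteq> 0" using assms(2) by simp
  then have "p = 0" using assms(1) True by simp
  then show thesis using that[of "- q / b" "- r / b"] \<open>b \<noteq> 0\<close> True
    by (simp add: power2_eq_square field_simps)
qed

section \<open>Nonnegative quartics dominate squares\<close>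

definition ge_square :: "(real \<Rightarrow> real \<Rightarrow> real \<Rightarrow> real) \<Rightarrow> bool" where
  "ge_square T \<longleftrightarrow> (\<exists>q. form_fun 2 q \<and> (\<exists>x y z. q x y z \<noteq> 0) \<and> (\<forall>x y z. q x y z ^ 2 \<le> T x y z))"

lemma ge_squareI:
  "form_fun 2 q \<Longrightarrow> q x y z \<noteq> 0 \<Longrightarrow> (\<And>x y z. q x y z ^ 2 \<le> T x y z) \<Longrightarrow> ge_square T"
  unfolding ge_square_def by blast

text \<open>
  Dominating a square is invariant under invertible linear changes of coordinates.
\<close>

lemma ge_square_subst:
  assumes "ge_square (\<lambda>x y z. T (A x y z) (B x y z) (C x y z))"
    and "form_fun 1 A'" "form_fun 1 B'" "form_fun 1 C'"
    and 1: "\<And>x y z. A (A' x y z) (B' x y z) (C' x y z) = x"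
    "\<And>x y z. B (A' x y z) (B' x y z) (C' x y z) = y"
    "\<And>x y z. C (A' x y z) (B' x y z) (C' x y z) = z"
    and 2: "\<And>x y z. A' (A x y z) (B x y z) (C x y z) = x"
    "\<And>x y z. B' (A x y z) (B x y z) (C x y z) = y"
    "\<And>x y z. C' (A x y z) (B x y z) (C x y z) = z"
  shows "ge_square T"
proof -
  obtain q x y z where q: "form_fun 2 q" "q x y z \<noteq> 0"
    "\<And>x y z. q x y z ^ 2 \<le> T (A x y z) (B x y z) (C x y z)"
    using assms(1) unfolding ge_square_def by blast
  show ?thesis
  proof (rule ge_squareI)
    show "form_fun 2 (\<lambda>x y z. q (A' x y z) (B' x y z) (C' x y z))"
      by (rule form_fun_subst[OF q(1) assms(2-4)])
    show "q (A' (A x y z) (B x y z) (C x y z)) (B' (A x y z) (B x y z) (C x y z))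
      (C' (A x y z) (B x y z) (C x y z)) \<noteq> 0"
      using q(2) by (simp add: 2)
    show "q (A' x y z) (B' x y z) (C' x y z) ^ 2 \<le> T x y z" for x y z
      using q(3)[of "A' x y z" "B' x y z" "C' x y z"] by (simp add: 1)
  qed
qed

lemma form_fun_1I: "(\<And>x y z. F x y z = a * x + b * y + c * z) \<Longrightarrow> form_fun 1 F"
  by (rule form_fun_cong[OF form_fun_linear[of a b c]]) auto

text \<open>
  Up to the factor \<open>y\<^sub>0\<^sup>2 + z\<^sub>0\<^sup>2\<close> the map \<open>(y, z) \<mapsto> (y\<^sub>0 y - z\<^sub>0 z, z\<^sub>0 y + y\<^sub>0 z)\<close> is a rotation; its purpose is to move
  the point \<open>(1, 0)\<close> to \<open>(y\<^sub>0, z\<^sub>0)\<close>.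
\<close>

lemma rotate_inverse:
  fixes y0 z0 :: real
  assumes "y0 \<noteq> 0 \<or> z0 \<noteq> 0"
  defines "n \<equiv> y0^2 + z0^2"
  shows "y0 * ((y0*y + z0*z) / n) - z0 * ((y0*z - z0*y) / n) = y"
    "z0 * ((y0*y + z0*z) / n) + y0 * ((y0*z - z0*y) / n) = z"
    "(y0*(y0*y - z0*z) + z0*(z0*y + y0*z)) / n = y"
    "(y0*(z0*y + y0*z) - z0*(y0*y - z0*z)) / n = z"
proof -
  have n: "n \<noteq> 0" using assms(1) by (simp add: n_def sum_power2_eq_zero_iff)
  have "y0 * ((y0*y + z0*z) / n) - z0 * ((y0*z - z0*y) / n) = (n * y) / n"
    unfolding n_def by (simp add: diff_divide_distrib[symmetric] power2_eq_square algebra_simps)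
  then show "y0 * ((y0*y + z0*z) / n) - z0 * ((y0*z - z0*y) / n) = y" using n by simp
  have "z0 * ((y0*y + z0*z) / n) + y0 * ((y0*z - z0*y) / n) = (n * z) / n"
    unfolding n_def by (simp add: add_divide_distrib[symmetric] power2_eq_square algebra_simps)
  then show "z0 * ((y0*y + z0*z) / n) + y0 * ((y0*z - z0*y) / n) = z" using n by simp
  have "y0*(y0*y - z0*z) + z0*(z0*y + y0*z) = n * y"
    unfolding n_def by (simp add: power2_eq_square algebra_simps)
  then show "(y0*(y0*y - z0*z) + z0*(z0*y + y0*z)) / n = y" using n by simp
  have "y0*(z0*y + y0*z) - z0*(y0*y - z0*z) = n * z"
    unfolding n_def by (simp add: power2_eq_square algebra_simps)
  then show "(y0*(z0*y + y0*z) - z0*(y0*y - z0*z)) / n = z" using n by simp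
qed

lemma rotate_surj:
  fixes y0 z0 :: real
  assumes "y0 \<noteq> 0 \<or> z0 \<noteq> 0"
  obtains X Y Z where "X + x0*Y = x" "y0*Y - z0*Z = y" "z0*Y + y0*Z = z"
proof -
  let ?Y = "(y0*y + z0*z) / (y0^2 + z0^2)" and ?Z = "(y0*z - z0*y) / (y0^2 + z0^2)"
  show thesis
    by (rule that[of "x - x0*?Y" ?Y ?Z]) (use rotate_inverse[OF assms] in simp_all)
qed

lemma form_fun_rotate:
  assumes "form_fun d T"
  shows "form_fun d (\<lambda>x y z. T (x + x0*y) (y0*y - z0*z) (z0*y + y0*z))"
  by (rule form_fun_subst[OF assms])
    (rule form_fun_1I[of _ 1 x0 0] form_fun_1I[of _ 0 y0 "-z0"] form_fun_1I[of _ 0 z0 y0]; simp)+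

text \<open>
  The change of coordinates fixes \<open>(1, 0, 0)\<close> and sends \<open>(0, 1, 0)\<close> to \<open>(x\<^sub>0, y\<^sub>0, z\<^sub>0)\<close>. It is used to move a
  second distinguished point of a quartic into standard position.
\<close>

lemma ge_square_rotate:
  assumes "y0 \<noteq> 0 \<or> z0 \<noteq> 0"
    and "ge_square (\<lambda>x y z. T (x + x0*y) (y0*y - z0*z) (z0*y + y0*z))"
  shows "ge_square T"
proof -
  define n where "n = y0^2 + z0^2"
  note inv = rotate_inverse[OF assms(1), folded n_def]
  show ?thesis
  proof (rule ge_square_subst[where
      A = "\<lambda>x y z. x + x0*y" and B = "\<lambda>x y z. y0*y - z0*z" and C = "\<lambda>x y z. z0*y + y0*z" and
      A' = "\<lambda>x y z. x - x0 * ((y0*y + z0*z) / n)" and B' = "\<lambda>x y z. (y0*y + z0*z) / n" and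
      C' = "\<lambda>x y z. (y0*z - z0*y) / n"])
    show "form_fun 1 (\<lambda>x y z. x - x0 * ((y0*y + z0*z) / n))"
      by (rule form_fun_1I[of _ 1 "- x0*y0/n" "- x0*z0/n"]) (simp add: add_divide_distrib algebra_simps)
    show "form_fun 1 (\<lambda>x y z. (y0*y + z0*z) / n)"
      by (rule form_fun_1I[of _ 0 "y0/n" "z0/n"]) (simp add: add_divide_distrib)
    show "form_fun 1 (\<lambda>x y z. (y0*z - z0*y) / n)"
      by (rule form_fun_1I[of _ 0 "-z0/n" "y0/n"]) (simp add: diff_divide_distrib)
  qed (simp_all only: inv assms(2) diff_add_cancel add_diff_cancel)
qed

text \<open>
  A positive definite quartic dominates a multiple of \<open>y\<^sup>4\<close>. Otherwise move a zero to \<open>(1, 0)\<close>: then \<open>z\<^sup>2\<close>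
  splits off, and the remaining nonnegative binary quadratic form dominates the square of a linear form.
\<close>

lemma ge_square_binary_quartic:
  assumes T: "\<And>x y z. T x y z = h1*y^4 + h2*y^3*z + h3*y^2*z^2 + h4*y*z^3 + h5*z^4"
    and psd: "\<And>x y z. T x y z \<ge> 0" and nz: "T x' y' z' \<noteq> 0"
  shows "ge_square T"
proof (cases "\<forall>y z. y \<noteq> 0 \<or> z \<noteq> 0 \<longrightarrow> T 0 y z > 0")
  case True
  obtain \<epsilon> where \<epsilon>: "\<epsilon> > 0" "\<And>y z. \<epsilon> * y^4 \<le> T 0 y z"
  proof (rule binary_lower_bound[of "T 0" "\<lambda>y z. y^4" 4])
    show "continuous_on UNIV (\<lambda>(y, z). T 0 y z)"
      unfolding T case_prod_unfold by (intro continuous_intros)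
    show "continuous_on UNIV (\<lambda>(y::real, z::real). y^4)"
      unfolding case_prod_unfold by (intro continuous_intros)
    show "T 0 (t*y) (t*z) = t^4 * T 0 y z" for t y z
      unfolding T by (simp add: power_mult_distrib) (simp add: algebra_simps eval_nat_numeral)
    show "T 0 y z > 0" if "y \<noteq> 0 \<or> z \<noteq> 0" for y z
      using True that by blast
  qed (auto simp: power_mult_distrib)
  have "T x y z = T 0 y z" for x y z by (simp add: T)
  then have "(sqrt \<epsilon> * y^2)^2 \<le> T x y z" for x y z
    using \<epsilon>(1) \<epsilon>(2)[of y z] by (metis (no_types, lifting) less_imp_le mult_2 numeral_Bit0 power_mult power_mult_distrib real_sqrt_pow2)
  moreover have "form_fun 2 (\<lambda>x y z. sqrt \<epsilon> * y^2)"
    by (rule form_fun_monomI[of 0 2 0 _ _ "sqrt \<epsilon>"]) auto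
  moreover have "sqrt \<epsilon> * 1^2 \<noteq> 0" using \<epsilon> by simp
  ultimately show ?thesis by (intro ge_squareI[of "\<lambda>x y z. sqrt \<epsilon> * y^2" _ 1]) auto
next
  case False
  then obtain y0 z0 where yz0: "y0 \<noteq> 0 \<or> z0 \<noteq> 0" "T 0 y0 z0 = 0"
    using psd by (metis less_le)
  define T' where "T' = (\<lambda>x y z. T (x + 0*y) (y0*y - z0*z) (z0*y + y0*z))"
  have "form_fun 4 T"
    by (rule form_fun_cong[OF form_fun.add[OF form_fun.add[OF form_fun.add[OF form_fun.add[OF
      form_fun.monom[of 0 4 0 4 h1] form_fun.monom[of 0 3 1 4 h2]] form_fun.monom[of 0 2 2 4 h3]]
      form_fun.monom[of 0 1 3 4 h4]] form_fun.monom[of 0 0 4 4 h5]]]) (auto simp: T)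
  have "\<exists>k1 k2 k3 k4 k5. \<forall>x y z. T' x y z = k1*y^4 + k2*y^3*z + k3*y^2*z^2 + k4*y*z^3 + k5*z^4"
  proof -
    have "form_fun 4 T'" unfolding T'_def by (rule form_fun_rotate) fact
    then obtain e l1 l2 f1 f2 f3 g1 g2 g3 g4 k1 k2 k3 k4 k5 where
      *: "\<And>x y z. T' x y z = e*x^4 + x^3*(l1*y + l2*z) + x^2*(f1*y^2 + f2*y*z + f3*z^2)
       + 2*x*(g1*y^3 + g2*y^2*z + g3*y*z^2 + g4*z^3)
       + (k1*y^4 + k2*y^3*z + k3*y^2*z^2 + k4*y*z^3 + k5*z^4)"
      using form_fun_4E by blast
    have "T' x y z = T' 0 y z" for x y z by (simp add: T'_def T)
    then have "T' x y z = k1*y^4 + k2*y^3*z + k3*y^2*z^2 + k4*y*z^3 + k5*z^4" for x y z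
      using *[of 0 y z] \<open>T' x y z = T' 0 y z\<close> by (simp only:) simp
    then show ?thesis by blast
  qed
  then obtain k1 k2 k3 k4 k5 where
    T': "\<And>x y z. T' x y z = k1*y^4 + k2*y^3*z + k3*y^2*z^2 + k4*y*z^3 + k5*z^4" by blast
  have psd': "T' x y z \<ge> 0" for x y z by (simp add: T'_def psd)
  have "T' 0 1 0 = 0" using yz0(2) by (simp add: T'_def)
  then have "k1 = 0" by (simp add: T')
  have "k2 = 0"
    using nonneg_cubic[of k2 k3 k4 k5] psd'[of 0 _ 1] by (simp add: T' \<open>k1 = 0\<close>)
  have T'2: "T' x y z = z^2 * (k3*y^2 + k4*y*z + k5*z^2)" for x y z
    by (simp add: T' \<open>k1 = 0\<close> \<open>k2 = 0\<close> algebra_simps eval_nat_numeral)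
  have psdq: "k3*y^2 + k4*y*z + k5*z^2 \<ge> 0" for y z
  proof -
    have *: "k3*y^2 + k4*y*z + k5*z^2 \<ge> 0" if "z \<noteq> 0" for y z
      using psd'[of 0 y z] that by (simp add: T'2 zero_le_mult_iff)
    show ?thesis
      using nonneg_at_0[of "\<lambda>z. k3*y^2 + k4*y*z + k5*z^2"] * by (cases "z = 0") auto
  qed
  have "k3 \<noteq> 0 \<or> k4 \<noteq> 0 \<or> k5 \<noteq> 0"
  proof (rule ccontr)
    assume "\<not> ?thesis"
    then have 0: "T' x y z = 0" for x y z by (simp add: T'2)
    obtain X Y Z where "X + 0*Y = x'" "y0*Y - z0*Z = y'" "z0*Y + y0*Z = z'"
      using rotate_surj[OF yz0(1)] .
    then show False using 0[of X Y Z] nz by (simp add: T'_def)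
  qed
  from nonneg_binary_quadratic_ge_square[OF psdq this] obtain m n where
    mn: "m \<noteq> 0 \<or> n \<noteq> 0" "\<And>y z. (m*y + n*z)^2 \<le> k3*y^2 + k4*y*z + k5*z^2" by blast
  have "form_fun 2 (\<lambda>x y z. z * (m*y + n*z))"
    using form_fun_mult[of 1 "\<lambda>x y z. z" 1 "\<lambda>x y z. m*y + n*z"] form_fun_1I[of _ 0 0 1] form_fun_1I[of _ 0 m n]
    by (simp add: numeral_2_eq_2)
  moreover have "(z * (m*y + n*z))^2 \<le> T' x y z" for x y z
    unfolding T'2 power_mult_distrib using mn(2) by (intro mult_left_mono) auto
  moreover have "1 * (m*(if n = 0 then 1 else 0) + n*1) \<noteq> 0" using mn by auto
  ultimately have "ge_square T'"
    by (intro ge_squareI[of "\<lambda>x y z. z * (m*y + n*z)" 0 "if n = 0 then 1 else 0" 1]) auto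
  then show ?thesis unfolding T'_def by (rule ge_square_rotate[OF yz0(1)])
qed

text \<open>
  At a zero \<open>(1, 0, 0)\<close> the pure power of \<open>x\<close> vanishes, and so does the coefficient of \<open>x\<^sup>3\<close>, since the
  quartic would change its sign in the direction of \<open>x\<close> otherwise. What remains is quadratic in \<open>x\<close>, with
  a discriminant of the right sign.
\<close>

lemma quartic_with_zeroE:
  assumes "form_fun 4 T" and psd: "\<And>x y z. T x y z \<ge> 0" and "T 1 0 0 = 0"
  obtains f1 f2 f3 g1 g2 g3 g4 h1 h2 h3 h4 h5 where
    "\<And>x y z. T x y z = x^2*(f1*y^2 + f2*y*z + f3*z^2)
       + 2*x*(g1*y^3 + g2*y^2*z + g3*y*z^2 + g4*z^3)
       + (h1*y^4 + h2*y^3*z + h3*y^2*z^2 + h4*y*z^3 + h5*z^4)"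
    "\<And>y z. f1*y^2 + f2*y*z + f3*z^2 \<ge> 0"
    "\<And>y z. (g1*y^3 + g2*y^2*z + g3*y*z^2 + g4*z^3)^2
       \<le> (f1*y^2 + f2*y*z + f3*z^2) * (h1*y^4 + h2*y^3*z + h3*y^2*z^2 + h4*y*z^3 + h5*z^4)"
proof -
  obtain e l1 l2 f1 f2 f3 g1 g2 g3 g4 h1 h2 h3 h4 h5 where
    *: "\<And>x y z. T x y z = e*x^4 + x^3*(l1*y + l2*z) + x^2*(f1*y^2 + f2*y*z + f3*z^2)
       + 2*x*(g1*y^3 + g2*y^2*z + g3*y*z^2 + g4*z^3)
       + (h1*y^4 + h2*y^3*z + h3*y^2*z^2 + h4*y*z^3 + h5*z^4)"
    using form_fun_4E[OF assms(1)] by blast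
  have e: "e = 0" using assms(3) by (simp add: *)
  have l: "l1*y + l2*z = 0" for y z
  proof (rule nonneg_cubic)
    fix t
    show "(l1*y + l2*z) * t^3 + (f1*y^2 + f2*y*z + f3*z^2) * t^2
        + (2 * (g1*y^3 + g2*y^2*z + g3*y*z^2 + g4*z^3)) * t
        + (h1*y^4 + h2*y^3*z + h3*y^2*z^2 + h4*y*z^3 + h5*z^4) \<ge> 0"
      using psd[of t y z] unfolding * e by (simp add: algebra_simps)
  qed
  let ?f = "\<lambda>y z. f1*y^2 + f2*y*z + f3*z^2"
  let ?g = "\<lambda>y z. g1*y^3 + g2*y^2*z + g3*y*z^2 + g4*z^3"
  let ?h = "\<lambda>y z. h1*y^4 + h2*y^3*z + h3*y^2*z^2 + h4*y*z^3 + h5*z^4"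
  have T: "T x y z = x^2 * ?f y z + 2*x * ?g y z + ?h y z" for x y z
    unfolding * e l by simp
  have q: "?f y z * t^2 + 2 * ?g y z * t + ?h y z \<ge> 0" for y z t
    using psd[of t y z] unfolding T by (simp add: algebra_simps)
  show thesis
    by (rule that[OF T]) (use nonneg_quadratic[OF q] in auto)
qed

text \<open>
  If the coefficient \<open>f\<close> of \<open>x\<^sup>2\<close> has the zero \<open>(1, 0)\<close>, it is \<open>f\<^sub>3 z\<^sup>2\<close>, and the discriminant condition makes
  \<open>z\<close> divide \<open>g = z G\<close>. Completing the square in \<open>x\<close> then produces the square of a quadratic form with no
  denominators left; for \<open>f\<^sub>3 = 0\<close> the quartic does not involve \<open>x\<close> at all.
\<close>

lemma ge_square_flat_aux:
  assumes "form_fun 4 T" and psd: "\<And>x y z. T x y z \<ge> 0" and nz: "T x' y' z' \<noteq> 0" and "T 1 0 0 = 0"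
    and flat: "\<And>x. T x 1 0 = T 0 1 0"
  shows "ge_square T"
proof -
  obtain f1 f2 f3 g1 g2 g3 g4 h1 h2 h3 h4 h5 where
    T: "\<And>x y z. T x y z = x^2*(f1*y^2 + f2*y*z + f3*z^2)
       + 2*x*(g1*y^3 + g2*y^2*z + g3*y*z^2 + g4*z^3)
       + (h1*y^4 + h2*y^3*z + h3*y^2*z^2 + h4*y*z^3 + h5*z^4)"
    and f: "\<And>y z. f1*y^2 + f2*y*z + f3*z^2 \<ge> 0"
    and d: "\<And>y z. (g1*y^3 + g2*y^2*z + g3*y*z^2 + g4*z^3)^2
       \<le> (f1*y^2 + f2*y*z + f3*z^2) * (h1*y^4 + h2*y^3*z + h3*y^2*z^2 + h4*y*z^3 + h5*z^4)"
    using quartic_with_zeroE[OF assms(1,2,4)] by blast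
  have "f1 = 0" using flat[of 1] flat[of "-1"] by (simp add: T)
  have "f2 = 0"
    using nonneg_quadratic(3)[of 0 "f2/2" f3] f[of _ 1] by (simp add: \<open>f1 = 0\<close>)
  have "g1 = 0" using d[of 1 0] by (simp add: \<open>f1 = 0\<close>)
  define G where "G y z = g2*y^2 + g3*y*z + g4*z^2" for y z
  define H where "H y z = h1*y^4 + h2*y^3*z + h3*y^2*z^2 + h4*y*z^3 + h5*z^4" for y z
  have gG: "g1*y^3 + g2*y^2*z + g3*y*z^2 + g4*z^3 = z * G y z" for y z
    by (simp add: \<open>g1 = 0\<close> G_def algebra_simps eval_nat_numeral)
  have T2: "T x y z = x^2*(f3*z^2) + 2*x*(z * G y z) + H y z" for x y z
    unfolding T gG by (simp add: \<open>f1 = 0\<close> \<open>f2 = 0\<close> H_def)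
  have "f3 \<ge> 0" using f[of 0 1] by simp
  have GH: "(G y z)^2 \<le> f3 * H y z" for y z
  proof -
    have *: "f3 * H y z - (G y z)^2 \<ge> 0" if "z \<noteq> 0" for z
    proof -
      have "z^2 * (G y z)^2 \<le> z^2 * (f3 * H y z)"
        using d[of y z] unfolding gG by (simp add: \<open>f1 = 0\<close> \<open>f2 = 0\<close> H_def power_mult_distrib mult_ac)
      then show ?thesis using that by simp
    qed
    have "isCont (\<lambda>z. f3 * H y z - (G y z)^2) 0"
      unfolding G_def H_def by (intro continuous_intros)
    from nonneg_at_0[OF this *] * show ?thesis by (cases "z = 0") auto
  qed
  show ?thesis
  proof (cases "f3 = 0")
    case True
    have "G y z = 0" for y z using GH[of y z] True by simp
    then have "T x y z = h1*y^4 + h2*y^3*z + h3*y^2*z^2 + h4*y*z^3 + h5*z^4" for x y z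
      by (simp add: T2 True H_def)
    then show ?thesis using psd nz by (rule ge_square_binary_quartic)
  next
    case False
    define m where "m = sqrt f3"
    have m: "m > 0" "m^2 = f3" using False \<open>f3 \<ge> 0\<close> by (auto simp: m_def)
    let ?q = "\<lambda>x y z. m*x*z + (1/m) * G y z"
    have "form_fun 2 ?q"
    proof (intro form_fun.add form_fun_scale)
      show "form_fun 2 (\<lambda>x y z. m*x*z)" by (rule form_fun_monomI[of 1 0 1 _ _ m]) auto
      show "form_fun 2 (\<lambda>x y z. G y z)" unfolding G_def
        by (intro form_fun.add; rule form_fun_monomI[of 0 2 0 _ _ g2] form_fun_monomI[of 0 1 1 _ _ g3]
            form_fun_monomI[of 0 0 2 _ _ g4]; simp)
    qed
    moreover have "?q 0 0 1 \<noteq> 0 \<or> ?q 1 0 1 \<noteq> 0" using m by auto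
    moreover have "?q x y z ^ 2 \<le> T x y z" for x y z
    proof -
      have "?q x y z ^ 2 = m^2*x^2*z^2 + 2*x*z*G y z + (1/m^2) * (G y z)^2"
        using m(1) by (simp add: power2_sum power_mult_distrib power_divide mult_ac)
      also have "(1/m^2) * (G y z)^2 \<le> (1/m^2) * (f3 * H y z)"
        by (intro mult_left_mono GH) simp
      also have "\<dots> = H y z" using m False by simp
      finally show ?thesis by (simp add: T2 m(2) mult_ac)
    qed
    ultimately show ?thesis using ge_squareI by blast
  qed
qed

text \<open>
  Since \<open>T\<close> is nonnegative with the zero \<open>(1, 0, 0)\<close>, it is constant in \<open>x\<close> over \<open>(y\<^sub>0, z\<^sub>0)\<close> exactly when the
  coefficient of \<open>x\<^sup>2\<close> vanishes there. Phrased through \<open>T\<close>, the condition needs no coefficients and is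
  transported by changes of coordinates.
\<close>

lemma ge_square_flat:
  assumes "form_fun 4 T" and psd: "\<And>x y z. T x y z \<ge> 0" and nz: "T x' y' z' \<noteq> 0" and "T 1 0 0 = 0"
    and "y0 \<noteq> 0 \<or> z0 \<noteq> 0" and flat: "\<And>x. T x y0 z0 = T 0 y0 z0"
  shows "ge_square T"
proof (rule ge_square_rotate[OF assms(5), of T 0])
  obtain X Y Z where "X + 0*Y = x'" "y0*Y - z0*Z = y'" "z0*Y + y0*Z = z'"
    using rotate_surj[OF assms(5)] .
  then have "T (X + 0*Y) (y0*Y - z0*Z) (z0*Y + y0*Z) \<noteq> 0" using nz by simp
  then show "ge_square (\<lambda>x y z. T (x + 0*y) (y0*y - z0*z) (z0*y + y0*z))"
    by (intro ge_square_flat_aux[OF form_fun_rotate[OF assms(1)]])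
      (use psd assms(4) flat in auto)
qed

text \<open>
  Because of the second zero, \<open>T = x\<^sup>2 f + 2 x z G + z\<^sup>2 H\<close> with binary quadratic forms. If \<open>f\<close> has a
  zero, \<open>ge_square_flat\<close> applies; so let \<open>f\<close> be positive definite. If \<open>f H - G\<^sup>2\<close> is positive definite as well, then \<open>f T = (x f + z G)\<^sup>2 + z\<^sup>2 (f H - G\<^sup>2)\<close> exceeds a multiple
  of \<open>f z\<^sup>4\<close>. If it has a zero \<open>(b, c)\<close>, express \<open>T\<close> through a suitable \<open>x - \<alpha> z\<close> instead
  of \<open>x\<close>, so that the new \<open>G\<close> and \<open>H\<close> vanish at \<open>(b, c)\<close>. They are \<open>l m\<close> and \<open>\<kappa> l\<^sup>2\<close> with \<open>l = c y - b z\<close> and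
  \<open>m\<^sup>2 \<le> \<kappa> f\<close>. For \<open>\<kappa> > 0\<close> one completes the square in \<open>z l\<close> instead of \<open>x - \<alpha> z\<close>; for \<open>\<kappa> = 0\<close> only
  \<open>(x - \<alpha> z)\<^sup>2 f\<close> is left.
\<close>

lemma ge_square_two_zeros:
  assumes "form_fun 4 T" and psd: "\<And>x y z. T x y z \<ge> 0" and nz: "T x' y' z' \<noteq> 0"
    and "T 1 0 0 = 0" and "T 0 1 0 = 0"
  shows "ge_square T"
proof -
  obtain f1 f2 f3 g1 g2 g3 g4 h1 h2 h3 h4 h5 where
    T: "\<And>x y z. T x y z = x^2*(f1*y^2 + f2*y*z + f3*z^2)
       + 2*x*(g1*y^3 + g2*y^2*z + g3*y*z^2 + g4*z^3)
       + (h1*y^4 + h2*y^3*z + h3*y^2*z^2 + h4*y*z^3 + h5*z^4)"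
    and fpsd: "\<And>y z. f1*y^2 + f2*y*z + f3*z^2 \<ge> 0"
    and d: "\<And>y z. (g1*y^3 + g2*y^2*z + g3*y*z^2 + g4*z^3)^2
       \<le> (f1*y^2 + f2*y*z + f3*z^2) * (h1*y^4 + h2*y^3*z + h3*y^2*z^2 + h4*y*z^3 + h5*z^4)"
    using quartic_with_zeroE[OF assms(1,2,4)] by blast
  have "h1 = 0" using assms(5) by (simp add: T)
  have h2: "2*x*g1 + h2*z = 0" for x z
  proof (rule nonneg_cubic)
    fix y
    show "(2*x*g1 + h2*z) * y^3 + (x^2*f1 + 2*x*g2*z + h3*z^2) * y^2
        + (x^2*f2*z + 2*x*g3*z^2 + h4*z^3) * y + (x^2*f3*z^2 + 2*x*g4*z^3 + h5*z^4) \<ge> 0"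
      using psd[of x y z] unfolding T \<open>h1 = 0\<close> by (simp add: algebra_simps)
  qed
  have "g1 = 0" "h2 = 0" using h2[of 1 0] h2[of 0 1] by auto
  define f where "f y z = f1*y^2 + f2*y*z + f3*z^2" for y z
  define G where "G y z = g2*y^2 + g3*y*z + g4*z^2" for y z
  define H where "H y z = h3*y^2 + h4*y*z + h5*z^2" for y z
  have T2: "T x y z = x^2 * f y z + 2*x*z * G y z + z^2 * H y z" for x y z
    unfolding T \<open>h1 = 0\<close> \<open>g1 = 0\<close> \<open>h2 = 0\<close> f_def G_def H_def
    by (simp add: algebra_simps eval_nat_numeral)
  have f_nonneg: "f y z \<ge> 0" for y z using fpsd by (simp add: f_def)
  have D: "f y z * H y z - (G y z)^2 \<ge> 0" for y z
  proof -
    have *: "f y z * H y z - (G y z)^2 \<ge> 0" if "z \<noteq> 0" for z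
    proof -
      have "z^2 * (G y z)^2 = (g1*y^3 + g2*y^2*z + g3*y*z^2 + g4*z^3)^2"
        by (simp add: \<open>g1 = 0\<close> G_def power_mult_distrib[symmetric] algebra_simps eval_nat_numeral)
      also have "\<dots> \<le> f y z * (z^2 * H y z)"
        using d[of y z] by (simp add: \<open>h1 = 0\<close> \<open>h2 = 0\<close> f_def H_def algebra_simps eval_nat_numeral)
      finally have "z^2 * (G y z)^2 \<le> z^2 * (f y z * H y z)" by (simp add: mult_ac)
      then show ?thesis using that by simp
    qed
    have "isCont (\<lambda>z. f y z * H y z - (G y z)^2) 0"
      unfolding f_def G_def H_def by (intro continuous_intros)
    from nonneg_at_0[OF this *] * show ?thesis by (cases "z = 0") auto
  qed
  show ?thesis
  proof (cases "\<exists>y0 z0. (y0 \<noteq> 0 \<or> z0 \<noteq> 0) \<and> f y0 z0 = 0")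
    case True
    then obtain y0 z0 where 0: "y0 \<noteq> 0 \<or> z0 \<noteq> 0" "f y0 z0 = 0" by blast
    then have "G y0 z0 = 0" using D[of y0 z0] by simp
    then have "T x y0 z0 = T 0 y0 z0" for x by (simp add: T2 0)
    then show ?thesis by (rule ge_square_flat[OF assms(1-4) 0(1)])
  next
    case False
    then have f_pos: "f y z > 0" if "y \<noteq> 0 \<or> z \<noteq> 0" for y z
      using f_nonneg[of y z] that by (metis less_le)
    show ?thesis
    proof (cases "\<exists>b c. (b \<noteq> 0 \<or> c \<noteq> 0) \<and> f b c * H b c - (G b c)^2 = 0")
      case False
      obtain \<epsilon> where \<epsilon>: "\<epsilon> > 0" "\<And>y z. \<epsilon> * (f y z * z^2) \<le> f y z * H y z - (G y z)^2"
      proof (rule binary_lower_bound[of "\<lambda>y z. f y z * H y z - (G y z)^2" "\<lambda>y z. f y z * z^2" 4])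
        show "continuous_on UNIV (\<lambda>(y, z). f y z * H y z - (G y z)^2)"
          unfolding case_prod_unfold f_def G_def H_def by (intro continuous_intros)
        show "continuous_on UNIV (\<lambda>(y, z). f y z * z^2)"
          unfolding case_prod_unfold f_def by (intro continuous_intros)
        show "f (t*y) (t*z) * H (t*y) (t*z) - (G (t*y) (t*z))^2 = t^4 * (f y z * H y z - (G y z)^2)"
          for t y z
          unfolding f_def G_def H_def by (simp add: algebra_simps eval_nat_numeral)
        show "f (t*y) (t*z) * (t*z)^2 = t^4 * (f y z * z^2)" for t y z
          unfolding f_def by (simp add: algebra_simps eval_nat_numeral)
        show "f y z * H y z - (G y z)^2 > 0" if "y \<noteq> 0 \<or> z \<noteq> 0" for y z
          using False D[of y z] that by (metis less_le)
      qed auto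
      have "(sqrt \<epsilon> * z^2)^2 \<le> T x y z" for x y z
      proof (cases "y \<noteq> 0 \<or> z \<noteq> 0")
        case True
        have "f y z * T x y z = (x * f y z + z * G y z)^2 + z^2 * (f y z * H y z - (G y z)^2)"
          unfolding T2 by (simp add: power2_eq_square algebra_simps)
        also have "\<dots> \<ge> z^2 * (\<epsilon> * (f y z * z^2))"
          using mult_left_mono[OF \<epsilon>(2)[of y z] zero_le_power2[of z]]
            zero_le_power2[of "x * f y z + z * G y z"] by linarith
        finally have "f y z * (\<epsilon> * z^2 * z^2) \<le> f y z * T x y z" by (simp add: mult_ac)
        then have "\<epsilon> * z^2 * z^2 \<le> T x y z"
          by (rule mult_left_le_imp_le[OF _ f_pos[OF True]])
        then show ?thesis using \<epsilon>(1) by (simp add: power_mult_distrib power2_eq_square mult_ac)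
      qed (use psd in auto)
      moreover have "form_fun 2 (\<lambda>x y z. sqrt \<epsilon> * z^2)"
        by (rule form_fun_monomI[of 0 0 2 _ _ "sqrt \<epsilon>"]) auto
      moreover have "sqrt \<epsilon> * 1^2 \<noteq> 0" using \<epsilon> by simp
      ultimately show ?thesis by (intro ge_squareI[of "\<lambda>x y z. sqrt \<epsilon> * z^2" _ _ 1]) auto
    next
      case True
      then obtain b c where bc: "b \<noteq> 0 \<or> c \<noteq> 0" "f b c * H b c - (G b c)^2 = 0" by blast
      \<comment> \<open>The shift that moves the double root of the quadratic polynomial in \<open>x\<close> above \<open>(b, c)\<close> to 0.\<close>
      define \<alpha> where "\<alpha> = - G b c / f b c"
      define G2 where "G2 y z = G y z + \<alpha> * f y z" for y z
      define H2 where "H2 y z = H y z + 2 * \<alpha> * G y z + \<alpha>^2 * f y z" for y z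
      have T3: "T x y z = (x - \<alpha>*z)^2 * f y z + 2*(x - \<alpha>*z)*z * G2 y z + z^2 * H2 y z" for x y z
        unfolding T2 G2_def H2_def by (simp add: power2_eq_square algebra_simps)
      have D2: "f y z * H2 y z - (G2 y z)^2 = f y z * H y z - (G y z)^2" for y z
        unfolding G2_def H2_def by (simp add: power2_eq_square algebra_simps)
      have "f b c > 0" using f_pos bc by blast
      have G2_0: "G2 b c = 0" using \<open>f b c > 0\<close> by (simp add: G2_def \<alpha>_def)
      have H2_0: "H2 b c = 0" using D2[of b c] bc(2) G2_0 \<open>f b c > 0\<close> by simp
      have H2_nonneg: "H2 y z \<ge> 0" for y z
      proof (cases "y \<noteq> 0 \<or> z \<noteq> 0")
        case True
        have "f y z * H2 y z \<ge> 0"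
          using D2[of y z] D[of y z] zero_le_power2[of "G2 y z"] by linarith
        then show ?thesis using f_pos[OF True] by (simp add: zero_le_mult_iff)
      qed (simp add: H2_def H_def G_def f_def)
      have H2_eq: "H2 y z = (h3 + 2*\<alpha>*g2 + \<alpha>^2*f1)*y^2 + (h4 + 2*\<alpha>*g3 + \<alpha>^2*f2)*y*z
          + (h5 + 2*\<alpha>*g4 + \<alpha>^2*f3)*z^2" for y z
        unfolding H2_def H_def G_def f_def by (simp add: algebra_simps)
      have G2_eq: "G2 y z = (g2 + \<alpha>*f1)*y^2 + (g3 + \<alpha>*f2)*y*z + (g4 + \<alpha>*f3)*z^2" for y z
        unfolding G2_def G_def f_def by (simp add: algebra_simps)
      obtain \<kappa> where \<kappa>: "\<kappa> \<ge> 0" "\<And>y z. H2 y z = \<kappa> * (c*y - b*z)^2"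
        using nonneg_binary_quadratic_zero[OF H2_nonneg[unfolded H2_eq] H2_0[unfolded H2_eq] bc(1)]
        unfolding H2_eq by blast
      obtain m n where mn: "\<And>y z. G2 y z = (c*y - b*z) * (m*y + n*z)"
        using binary_quadratic_factor[OF G2_0[unfolded G2_eq] bc(1)] unfolding G2_eq by blast
      have fm: "(m*y + n*z)^2 \<le> \<kappa> * f y z" for y z
      proof -
        have *: "\<kappa> * f y z - (m*y + n*z)^2 \<ge> 0" if "c*y - b*z \<noteq> 0" for y z
        proof -
          have "(c*y - b*z)^2 * (\<kappa> * f y z - (m*y + n*z)^2) = f y z * H2 y z - (G2 y z)^2"
            unfolding \<kappa>(2) mn by (simp add: power2_eq_square algebra_simps)
          then have "(c*y - b*z)^2 * (\<kappa> * f y z - (m*y + n*z)^2) \<ge> 0"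
            unfolding D2 using D by simp
          then show ?thesis using that by (simp add: zero_le_mult_iff)
        qed
        show ?thesis
        proof (cases "c*y - b*z = 0")
          case True
          \<comment> \<open>Approach a point with \<open>l = 0\<close> along the normal direction \<open>(c, - b)\<close> of the line.\<close>
          let ?\<phi> = "\<lambda>t. \<kappa> * f (y + t*c) (z - t*b) - (m*(y + t*c) + n*(z - t*b))^2"
          have "?\<phi> t \<ge> 0" if "t \<noteq> 0" for t
          proof (rule *)
            have "c*(y + t*c) - b*(z - t*b) = (c*y - b*z) + t*(b^2 + c^2)"
              by (simp add: power2_eq_square algebra_simps)
            also have "\<dots> \<noteq> 0" using True that bc(1) by (simp add: sum_power2_eq_zero_iff)
            finally show "c*(y + t*c) - b*(z - t*b) \<noteq> 0" .
          qed
          moreover have "isCont ?\<phi> 0" unfolding f_def by (intro continuous_intros)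
          ultimately show ?thesis using nonneg_at_0[of ?\<phi>] by simp
        qed (use * in force)
      qed
      show ?thesis
      proof (cases "\<kappa> = 0")
        case True
        have mz: "m*y + n*z = 0" for y z using fm[of y z] True by simp
        have "f1 \<noteq> 0 \<or> f2 \<noteq> 0 \<or> f3 \<noteq> 0" using f_pos[of 1 0] by (simp add: f_def)
        from nonneg_binary_quadratic_ge_square[OF fpsd this] obtain p q where
          pq: "p \<noteq> 0 \<or> q \<noteq> 0" "\<And>y z. (p*y + q*z)^2 \<le> f y z"
          unfolding f_def by blast
        have "form_fun 2 (\<lambda>x y z. (x - \<alpha>*z) * (p*y + q*z))"
          using form_fun_mult[of 1 "\<lambda>x y z. x - \<alpha>*z" 1 "\<lambda>x y z. p*y + q*z"]
            form_fun_1I[of _ 1 0 "-\<alpha>"] form_fun_1I[of _ 0 p q] by (simp add: numeral_2_eq_2)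
        moreover have "((x - \<alpha>*z) * (p*y + q*z))^2 \<le> T x y z" for x y z
          unfolding T3 \<kappa>(2) mn mz True power_mult_distrib using pq(2)
          by (simp add: mult_left_mono)
        moreover have "((1+\<alpha>*1) - \<alpha>*1) * (p*(if q = 0 then 1 else 0) + q*1) \<noteq> 0"
          using pq(1) by auto
        ultimately show ?thesis
          by (intro ge_squareI[of "\<lambda>x y z. (x - \<alpha>*z) * (p*y + q*z)" "1+\<alpha>*1" "if q = 0 then 1 else 0" 1]) auto
      next
        case False
        define s where "s = sqrt \<kappa>"
        have s: "s > 0" "s^2 = \<kappa>" using False \<kappa>(1) by (auto simp: s_def)
        let ?q = "\<lambda>x y z. s * (z * (c*y - b*z)) + (1/s) * ((x - \<alpha>*z) * (m*y + n*z))"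
        have "form_fun 2 ?q"
        proof (intro form_fun.add form_fun_scale)
          show "form_fun 2 (\<lambda>x y z. z * (c*y - b*z))"
            using form_fun_mult[of 1 "\<lambda>x y z. z" 1 "\<lambda>x y z. c*y - b*z"]
              form_fun_1I[of _ 0 0 1] form_fun_1I[of _ 0 c "-b"] by (simp add: numeral_2_eq_2)
          show "form_fun 2 (\<lambda>x y z. (x - \<alpha>*z) * (m*y + n*z))"
            using form_fun_mult[of 1 "\<lambda>x y z. x - \<alpha>*z" 1 "\<lambda>x y z. m*y + n*z"]
              form_fun_1I[of _ 1 0 "-\<alpha>"] form_fun_1I[of _ 0 m n] by (simp add: numeral_2_eq_2)
        qed
        moreover have "?q x y z ^ 2 \<le> T x y z" for x y z
        proof -
          have "?q x y z ^ 2 = \<kappa> * (z * (c*y - b*z))^2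
              + 2 * (z * (c*y - b*z)) * ((x - \<alpha>*z) * (m*y + n*z))
              + (1/s^2) * ((x - \<alpha>*z)^2 * (m*y + n*z)^2)"
            using s(1) by (simp add: power2_sum power_mult_distrib power_divide s(2)[symmetric] mult_ac)
          also have "(1/s^2) * ((x - \<alpha>*z)^2 * (m*y + n*z)^2) \<le> (1/s^2) * ((x - \<alpha>*z)^2 * (\<kappa> * f y z))"
            by (intro mult_left_mono fm) auto
          also have "\<dots> = (x - \<alpha>*z)^2 * f y z" using s False by simp
          also have "\<kappa> * (z * (c*y - b*z))^2 + 2 * (z * (c*y - b*z)) * ((x - \<alpha>*z) * (m*y + n*z))
              + (x - \<alpha>*z)^2 * f y z = T x y z"
            unfolding T3 \<kappa>(2) mn by (simp add: power2_eq_square algebra_simps)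
          finally show ?thesis by simp
        qed
        \<comment> \<open>This choice makes \<open>l = c y - b z\<close> equal to 1 or to \<open>- b\<close> at \<open>z = 1\<close>.\<close>
        moreover define y1 where "y1 = (if c = 0 then 0 else (b + 1) / c)"
        have "?q (\<alpha>*1) y1 1 \<noteq> 0"
          using bc(1) s(1) by (auto simp: y1_def)
        ultimately show ?thesis by (intro ge_squareI[of ?q "\<alpha>*1" y1 1]) auto
      qed
    qed
  qed
qed

text \<open>
  If the coefficient \<open>f\<close> of \<open>x\<^sup>2\<close> has a zero, \<open>ge_square_flat\<close> applies. If \<open>f\<close> is positive definite, use
  \<open>f T = (x f + g)\<^sup>2 + (f h - g\<^sup>2)\<close>. When the binary sextic \<open>f h - g\<^sup>2\<close> is positive definite, it
  exceeds a multiple of \<open>f\<^sup>3\<close>, and \<open>T\<close> exceeds a multiple of \<open>f\<^sup>2\<close>. A zero of the sextic gives a second zero of \<open>T\<close>.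
\<close>

lemma ge_square_zero_x:
  assumes "form_fun 4 T" and psd: "\<And>x y z. T x y z \<ge> 0" and nz: "T x' y' z' \<noteq> 0"
    and "T 1 0 0 = 0"
  shows "ge_square T"
proof -
  obtain f1 f2 f3 g1 g2 g3 g4 h1 h2 h3 h4 h5 where
    T: "\<And>x y z. T x y z = x^2*(f1*y^2 + f2*y*z + f3*z^2)
       + 2*x*(g1*y^3 + g2*y^2*z + g3*y*z^2 + g4*z^3)
       + (h1*y^4 + h2*y^3*z + h3*y^2*z^2 + h4*y*z^3 + h5*z^4)"
    and fpsd: "\<And>y z. f1*y^2 + f2*y*z + f3*z^2 \<ge> 0"
    and d: "\<And>y z. (g1*y^3 + g2*y^2*z + g3*y*z^2 + g4*z^3)^2
       \<le> (f1*y^2 + f2*y*z + f3*z^2) * (h1*y^4 + h2*y^3*z + h3*y^2*z^2 + h4*y*z^3 + h5*z^4)"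
    using quartic_with_zeroE[OF assms(1,2,4)] by blast
  define f where "f y z = f1*y^2 + f2*y*z + f3*z^2" for y z
  define g where "g y z = g1*y^3 + g2*y^2*z + g3*y*z^2 + g4*z^3" for y z
  define h where "h y z = h1*y^4 + h2*y^3*z + h3*y^2*z^2 + h4*y*z^3 + h5*z^4" for y z
  have T2: "T x y z = x^2 * f y z + 2*x * g y z + h y z" for x y z
    unfolding T f_def g_def h_def by simp
  have D: "f y z * h y z - (g y z)^2 \<ge> 0" for y z
    using d[of y z] unfolding f_def g_def h_def by simp
  show ?thesis
  proof (cases "\<exists>y0 z0. (y0 \<noteq> 0 \<or> z0 \<noteq> 0) \<and> f y0 z0 = 0")
    case True
    then obtain y0 z0 where 0: "y0 \<noteq> 0 \<or> z0 \<noteq> 0" "f y0 z0 = 0" by blast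
    then have "g y0 z0 = 0" using D[of y0 z0] by simp
    then have "T x y0 z0 = T 0 y0 z0" for x by (simp add: T2 0)
    then show ?thesis by (rule ge_square_flat[OF assms(1-4) 0(1)])
  next
    case False
    then have f_pos: "f y z > 0" if "y \<noteq> 0 \<or> z \<noteq> 0" for y z
      using fpsd[of y z] that unfolding f_def by (metis less_le)
    show ?thesis
    proof (cases "\<exists>b c. (b \<noteq> 0 \<or> c \<noteq> 0) \<and> f b c * h b c - (g b c)^2 = 0")
      case False
      obtain \<epsilon> where \<epsilon>: "\<epsilon> > 0" "\<And>y z. \<epsilon> * (f y z)^3 \<le> f y z * h y z - (g y z)^2"
      proof (rule binary_lower_bound[of "\<lambda>y z. f y z * h y z - (g y z)^2" "\<lambda>y z. (f y z)^3" 6])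
        show "continuous_on UNIV (\<lambda>(y, z). f y z * h y z - (g y z)^2)"
          unfolding case_prod_unfold f_def g_def h_def by (intro continuous_intros)
        show "continuous_on UNIV (\<lambda>(y, z). (f y z)^3)"
          unfolding case_prod_unfold f_def by (intro continuous_intros)
        have ft: "f (t*y) (t*z) = t^2 * f y z" and gt: "g (t*y) (t*z) = t^3 * g y z"
          and ht: "h (t*y) (t*z) = t^4 * h y z" for t y z
          unfolding f_def g_def h_def by (simp_all add: algebra_simps eval_nat_numeral)
        show "f (t*y) (t*z) * h (t*y) (t*z) - (g (t*y) (t*z))^2 = t^6 * (f y z * h y z - (g y z)^2)"
          for t y z
          unfolding ft gt ht by (simp add: algebra_simps eval_nat_numeral)
        show "(f (t*y) (t*z))^3 = t^6 * (f y z)^3" for t y z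
          unfolding ft by (simp add: power_mult_distrib flip: power_mult)
        show "f y z * h y z - (g y z)^2 > 0" if "y \<noteq> 0 \<or> z \<noteq> 0" for y z
          using False D[of y z] that by (metis less_le)
      qed auto
      have "(sqrt \<epsilon> * f y z)^2 \<le> T x y z" for x y z
      proof (cases "y \<noteq> 0 \<or> z \<noteq> 0")
        case True
        have "f y z * T x y z = (x * f y z + g y z)^2 + (f y z * h y z - (g y z)^2)"
          unfolding T2 by (simp add: power2_eq_square algebra_simps)
        also have "\<dots> \<ge> \<epsilon> * (f y z)^3"
          using \<epsilon>(2)[of y z] zero_le_power2[of "x * f y z + g y z"] by linarith
        finally have "f y z * (\<epsilon> * (f y z)^2) \<le> f y z * T x y z"
          by (simp add: power2_eq_square power3_eq_cube mult_ac)
        then have "\<epsilon> * (f y z)^2 \<le> T x y z" using f_pos[OF True] by simp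
        then show ?thesis using \<epsilon>(1) by (simp add: power_mult_distrib)
      qed (use psd in \<open>simp add: f_def\<close>)
      moreover have "form_fun 2 (\<lambda>x y z. sqrt \<epsilon> * f y z)"
      proof (rule form_fun_scale)
        show "form_fun 2 (\<lambda>x y z. f y z)" unfolding f_def
          by (intro form_fun.add; rule form_fun_monomI[of 0 2 0 _ _ f1] form_fun_monomI[of 0 1 1 _ _ f2]
            form_fun_monomI[of 0 0 2 _ _ f3]; simp)
      qed
      moreover have "sqrt \<epsilon> * f 1 0 \<noteq> 0" using \<epsilon>(1) f_pos[of 1 0] by simp
      ultimately show ?thesis by (intro ge_squareI[of "\<lambda>x y z. sqrt \<epsilon> * f y z" _ 1 0]) auto
    next
      case True
      then obtain b c where bc: "b \<noteq> 0 \<or> c \<noteq> 0" "f b c * h b c - (g b c)^2 = 0" by blast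
      have "f b c > 0" using f_pos bc by blast
      \<comment> \<open>The double root of the quadratic polynomial in \<open>x\<close> above \<open>(b, c)\<close>.\<close>
      define a where "a = - g b c / f b c"
      have "f b c * T a b c = (a * f b c + g b c)^2 + (f b c * h b c - (g b c)^2)"
        unfolding T2 by (simp add: power2_eq_square algebra_simps)
      also have "\<dots> = 0" using \<open>f b c > 0\<close> bc(2) by (simp add: a_def)
      finally have Ta: "T a b c = 0" using \<open>f b c > 0\<close> by simp
      show ?thesis
      proof (rule ge_square_rotate[OF bc(1), of T a])
        obtain X Y Z where "X + a*Y = x'" "b*Y - c*Z = y'" "c*Y + b*Z = z'"
          using rotate_surj[OF bc(1)] .
        then have "T (X + a*Y) (b*Y - c*Z) (c*Y + b*Z) \<noteq> 0" using nz by simp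
        then show "ge_square (\<lambda>x y z. T (x + a*y) (b*y - c*z) (c*y + b*z))"
          by (intro ge_square_two_zeros[OF form_fun_rotate[OF assms(1)]])
            (use psd assms(4) Ta in auto)
      qed
    qed
  qed
qed

text \<open>
  A positive definite quartic dominates a multiple of \<open>x\<^sup>4\<close>; otherwise a zero is moved to \<open>(1, 0, 0)\<close>.
\<close>

theorem psd_quartic_ge_square:
  assumes "form_fun 4 T" and psd: "\<And>x y z. T x y z \<ge> 0" and nz: "T x' y' z' \<noteq> 0"
  shows "ge_square T"
proof (cases "\<exists>p q r. (p, q, r) \<noteq> (0, 0, 0) \<and> T p q r = 0")
  case False
  obtain \<epsilon> where \<epsilon>: "\<epsilon> > 0"
    "\<And>v. \<epsilon> * (\<lambda>(x, y, z). x^4) v \<le> (\<lambda>(x, y, z). T x y z) v"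
  proof (rule homogeneous_lower_bound[of "\<lambda>(x, y, z). T x y z" "\<lambda>(x, y, z). x^4" 4])
    show "continuous_on UNIV (\<lambda>(x, y, z). T x y z)" by (rule form_fun_continuous) fact
    show "continuous_on UNIV (\<lambda>(x::real, y::real, z::real). x^4)"
      unfolding case_prod_unfold by (intro continuous_intros)
    show "(\<lambda>(x, y, z). T x y z) v > 0" if "v \<noteq> 0" for v
    proof -
      obtain x y z where v: "v = (x, y, z)" by (metis prod.exhaust)
      then have "T x y z \<noteq> 0" using False that by (auto simp: zero_prod_def)
      then show ?thesis using psd[of x y z] by (simp add: v)
    qed
  qed (auto simp: form_fun_homogeneous[OF assms(1)] power_mult_distrib)
  have "(sqrt \<epsilon> * x^2)^2 \<le> T x y z" for x y z
    using \<epsilon>(1) \<epsilon>(2)[of "(x, y, z)"] by (simp add: power_mult_distrib flip: power_mult)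
  moreover have "form_fun 2 (\<lambda>x y z. sqrt \<epsilon> * x^2)"
    by (rule form_fun_monomI[of 2 0 0 _ _ "sqrt \<epsilon>"]) auto
  moreover have "sqrt \<epsilon> * 1^2 \<noteq> 0" using \<epsilon> by simp
  ultimately show ?thesis by (intro ge_squareI[of "\<lambda>x y z. sqrt \<epsilon> * x^2" 1]) auto
next
  case True
  have *: "ge_square T" if "form_fun 4 T" and psd: "\<And>x y z. T x y z \<ge> 0" and nz: "T x' y' z' \<noteq> 0"
    and 0: "T p q r = 0" "p \<noteq> 0" for T p q r x' y' z'
  proof (rule ge_square_subst[where
      A = "\<lambda>x y z. p*x" and B = "\<lambda>x y z. q*x + y" and C = "\<lambda>x y z. r*x + z" and
      A' = "\<lambda>x y z. x/p" and B' = "\<lambda>x y z. y - q*(x/p)" and C' = "\<lambda>x y z. z - r*(x/p)"])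
    show h: "form_fun 1 (\<lambda>x y z. x/p)" "form_fun 1 (\<lambda>x y z. y - q*(x/p))" "form_fun 1 (\<lambda>x y z. z - r*(x/p))"
      using form_fun_1I[of _ "1/p" 0 0] form_fun_1I[of _ "-q/p" 1 0] form_fun_1I[of _ "-r/p" 0 1] by simp_all
    show "ge_square (\<lambda>x y z. T (p*x) (q*x + y) (r*x + z))"
    proof (rule ge_square_zero_x)
      show "form_fun 4 (\<lambda>x y z. T (p*x) (q*x + y) (r*x + z))"
        using form_fun_1I[of _ p 0 0] form_fun_1I[of _ q 1 0] form_fun_1I[of _ r 0 1]
        by (intro form_fun_subst[OF that(1)]) simp_all
      show "T (p*(x'/p)) (q*(x'/p) + (y' - q*(x'/p))) (r*(x'/p) + (z' - r*(x'/p))) \<noteq> 0"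
        using 0 nz by simp
    qed (use psd 0 in auto)
  qed (use 0 in auto)
  have lin: "form_fun 1 (\<lambda>x y z. x)" "form_fun 1 (\<lambda>x y z. y)" "form_fun 1 (\<lambda>x y z. z)"
    using form_fun_1I[of _ 1 0 0] form_fun_1I[of _ 0 1 0] form_fun_1I[of _ 0 0 1] by simp_all
  obtain p q r where pqr: "p \<noteq> 0 \<or> q \<noteq> 0 \<or> r \<noteq> 0" "T p q r = 0" using True by auto
  then consider "p \<noteq> 0" | "q \<noteq> 0" | "r \<noteq> 0" by blast
  then show ?thesis
  proof cases
    case 1
    show ?thesis by (rule *[OF assms pqr(2) 1])
  next
    case 2
    have "ge_square (\<lambda>x y z. T y x z)"
      by (rule *[where T = "\<lambda>x y z. T y x z" and x' = y' and y' = x' and z' = z' and p = q and q = p and r = r])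
        (use psd nz pqr 2 form_fun_subst[OF assms(1) lin(2,1,3)] in auto)
    then show ?thesis
      by (rule ge_square_subst[where A = "\<lambda>x y z. y" and B = "\<lambda>x y z. x" and C = "\<lambda>x y z. z",
          OF _ lin(2,1,3)]) auto
  next
    case 3
    have "ge_square (\<lambda>x y z. T z y x)"
      by (rule *[where T = "\<lambda>x y z. T z y x" and x' = z' and y' = y' and z' = x' and p = r and q = q and r = p])
        (use psd nz pqr 3 form_fun_subst[OF assms(1) lin(3,2,1)] in auto)
    then show ?thesis
      by (rule ge_square_subst[where A = "\<lambda>x y z. z" and B = "\<lambda>x y z. y" and C = "\<lambda>x y z. x",
          OF _ lin(3,2,1)]) auto
  qed
qed

section \<open>Exhausting a quartic by squares\<close>

type_synonym coeffs = "real \<times> real \<times> real \<times> real \<times> real \<times> real"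

definition quadratic_of :: "coeffs \<Rightarrow> real \<Rightarrow> real \<Rightarrow> real \<Rightarrow> real" where
  "quadratic_of = (\<lambda>(a1, a2, a3, b1, b2, b3) x y z. a1*x^2 + a2*y^2 + a3*z^2 + b1*y*z + b2*x*z + b3*x*y)"

lemma quadratic_of_add: "quadratic_of (a + b) x y z = quadratic_of a x y z + quadratic_of b x y z"
  by (simp add: quadratic_of_def case_prod_unfold algebra_simps)

lemma quadratic_of_scaleR: "quadratic_of (c *\<^sub>R a) x y z = c * quadratic_of a x y z"
  by (simp add: quadratic_of_def case_prod_unfold algebra_simps)

lemma quadratic_of_0: "quadratic_of 0 x y z = 0"
  using quadratic_of_scaleR[of 0 0] by simp

lemma quadratic_of_sum: "quadratic_of (sum f A) x y z = (\<Sum>k\<in>A. quadratic_of (f k) x y z)"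
  by (induction A rule: infinite_finite_induct) (auto simp: quadratic_of_0 quadratic_of_add)

lemma continuous_on_quadratic_of [continuous_intros]:
  "continuous_on S f \<Longrightarrow> continuous_on S (\<lambda>w. quadratic_of (f w) x y z)"
  unfolding quadratic_of_def case_prod_unfold by (intro continuous_intros)

lemma form_fun_quadratic_of: "form_fun 2 (quadratic_of a)"
proof -
  obtain a1 a2 a3 b1 b2 b3 where a: "a = (a1, a2, a3, b1, b2, b3)" by (metis prod.exhaust)
  have "form_fun 2 (\<lambda>x y z. a1*x^2 + a2*y^2 + a3*z^2 + b1*y*z + b2*x*z + b3*x*y)"
    by (rule form_fun_cong[OF form_fun.add[OF form_fun.add[OF form_fun.add[OF form_fun.add[OF form_fun.add[OF
      form_fun.monom[of 2 0 0 2 a1] form_fun.monom[of 0 2 0 2 a2]] form_fun.monom[of 0 0 2 2 a3]]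
      form_fun.monom[of 0 1 1 2 b1]] form_fun.monom[of 1 0 1 2 b2]] form_fun.monom[of 1 1 0 2 b3]]]) auto
  then show ?thesis by (simp add: quadratic_of_def a)
qed

lemma form_fun_2_quadratic_ofE:
  assumes "form_fun 2 q"
  obtains a where "q = quadratic_of a"
proof -
  obtain a1 a2 a3 b1 b2 b3 where
    "\<And>x y z. q x y z = a1*x^2 + a2*y^2 + a3*z^2 + b1*y*z + b2*x*z + b3*x*y"
    using form_fun_2E[OF assms] by blast
  then have "q = quadratic_of (a1, a2, a3, b1, b2, b3)" by (intro ext) (simp add: quadratic_of_def)
  then show thesis by (rule that)
qed

text \<open>
  A linear functional that is positive on the squares of nonzero quadratic forms, because a quadratic form
  is determined by its values at these six points.
\<close>

definition six_point_sum :: "(real \<Rightarrow> real \<Rightarrow> real \<Rightarrow> real) \<Rightarrow> real" where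
  "six_point_sum F = F 1 0 0 + F 0 1 0 + F 0 0 1 + F 0 1 1 + F 1 0 1 + F 1 1 0"

lemma quadratic_of_six_zero:
  assumes "quadratic_of a 1 0 0 = 0" "quadratic_of a 0 1 0 = 0" "quadratic_of a 0 0 1 = 0"
    "quadratic_of a 0 1 1 = 0" "quadratic_of a 1 0 1 = 0" "quadratic_of a 1 1 0 = 0"
  shows "a = 0"
  using assms by (cases a) (simp add: quadratic_of_def zero_prod_def)

lemma six_point_sum_quadratic_of_square_pos: "a \<noteq> 0 \<Longrightarrow> six_point_sum (\<lambda>x y z. (quadratic_of a x y z)^2) > 0"
proof (rule ccontr)
  assume "a \<noteq> 0" "\<not> six_point_sum (\<lambda>x y z. (quadratic_of a x y z)^2) > 0"
  then have "six_point_sum (\<lambda>x y z. (quadratic_of a x y z)^2) = 0"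
    unfolding six_point_sum_def by (smt (verit) zero_le_power2)
  then have "a = 0"
    unfolding six_point_sum_def by (intro quadratic_of_six_zero) (smt (verit) zero_le_power2 zero_eq_power2)+
  with \<open>a \<noteq> 0\<close> show False by simp
qed

text \<open>
  The number 7 comes from here: seven quadratic forms in a space of dimension 6 satisfy a
  nontrivial relation, which is normalised to unit length.
\<close>

lemma seven_dependent:
  fixes Q :: "coeffs ^ 7"
  obtains c :: "real ^ 7" where "(\<Sum>k\<in>UNIV. (c $ k)^2) = 1" "(\<Sum>k\<in>UNIV. c $ k *\<^sub>R Q $ k) = 0"
proof -
  define L where "L c = (\<Sum>k\<in>UNIV. c $ k *\<^sub>R Q $ k)" for c :: "real ^ 7"
  have "linear L"
    by (rule linearI) (auto simp: L_def scaleR_add_left sum.distrib scaleR_sum_right)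
  have "\<not> inj L"
  proof
    assume "inj L"
    with \<open>linear L\<close> have "dim (L ` UNIV) = dim (UNIV :: (real ^ 7) set)"
      by (intro dim_image_eq) auto
    moreover have "dim (L ` UNIV) \<le> DIM(coeffs)" by (rule dim_subset_UNIV)
    ultimately show False by simp
  qed
  then obtain c where c: "c \<noteq> 0" "L c = 0"
    using \<open>linear L\<close> linear_injective_0 by blast
  define d where "d = c /\<^sub>R norm c"
  have "norm d = 1" using c by (simp add: d_def)
  then have "(\<Sum>k\<in>UNIV. (d $ k)^2) = 1"
    by (simp add: norm_vec_def L2_set_def)
  moreover have "L d = 0" using c(2) \<open>linear L\<close> by (simp add: d_def linear_scale)
  ultimately show thesis using that by (simp add: L_def)
qed

text \<open>
  The septuples of quadratic forms whose sum of squares stays below \<open>T\<close> form a compact set, so some septuple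
  \<open>Q\<close> maximises the functional \<open>six_point_sum\<close>. If the remainder were nonzero, it would dominate the square of some
  \<open>q \<noteq> 0\<close>. With a relation \<open>\<Sum> c\<^sub>k Q\<^sub>k = 0\<close> of unit length, replacing \<open>Q\<^sub>k\<close> by \<open>Q\<^sub>k + c\<^sub>k q\<close> adds exactly \<open>q\<^sup>2\<close> to the sum
  of squares, and contradicts maximality.
\<close>

theorem psd_quartic_sum_of_squares:
  assumes "form_fun 4 T" and psd: "\<And>x y z. T x y z \<ge> 0"
  obtains N and q :: "nat \<Rightarrow> real \<Rightarrow> real \<Rightarrow> real \<Rightarrow> real"
  where "\<And>k. k < N \<Longrightarrow> form_fun 2 (q k)" "\<And>x y z. T x y z = (\<Sum>k<N. (q k x y z)^2)"
proof -
  define S where "S Q x y z = (\<Sum>k\<in>UNIV. (quadratic_of (Q $ k) x y z)^2)" for Q :: "coeffs ^ 7" and x y z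
  define K where "K = {Q. \<forall>x y z. S Q x y z \<le> T x y z}"
  define \<Lambda> where "\<Lambda> Q = six_point_sum (S Q)" for Q
  have cont_S: "continuous_on A (\<lambda>Q. S Q x y z)" for A x y z
    unfolding S_def by (intro continuous_intros)
  have cont: "continuous_on A \<Lambda>" for A
    unfolding \<Lambda>_def six_point_sum_def by (intro continuous_intros cont_S)
  have \<Lambda>_sum: "\<Lambda> Q = (\<Sum>k\<in>UNIV. six_point_sum (\<lambda>x y z. (quadratic_of (Q $ k) x y z)^2))" for Q
    unfolding \<Lambda>_def six_point_sum_def S_def by (simp add: sum.distrib)
  have six_nonneg: "six_point_sum (\<lambda>x y z. (quadratic_of a x y z)^2) \<ge> 0" for a
    by (simp add: six_point_sum_def)
  obtain \<epsilon> where \<epsilon>: "\<epsilon> > 0" "\<And>Q. \<epsilon> * norm Q ^ 2 \<le> \<Lambda> Q"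
  proof (rule homogeneous_lower_bound[of \<Lambda> "\<lambda>Q. norm Q ^ 2" 2])
    show "continuous_on UNIV \<Lambda>" by (rule cont)
    show "continuous_on UNIV (\<lambda>Q::coeffs ^ 7. norm Q ^ 2)" by (intro continuous_intros)
    show "\<Lambda> (t *\<^sub>R Q) = t^2 * \<Lambda> Q" for t Q
      unfolding \<Lambda>_def six_point_sum_def S_def
      by (simp add: quadratic_of_scaleR power_mult_distrib distrib_left sum_distrib_left)
    show "norm (t *\<^sub>R Q) ^ 2 = t^2 * norm Q ^ 2" for t and Q :: "coeffs ^ 7"
      by (simp add: power_mult_distrib)
    show "\<Lambda> Q > 0" if "Q \<noteq> 0" for Q
    proof -
      obtain k where k: "Q $ k \<noteq> 0"
        using \<open>Q \<noteq> 0\<close> unfolding vec_eq_iff by auto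
      show ?thesis unfolding \<Lambda>_sum
        by (rule sum_pos2[of _ k]) (auto simp: six_nonneg intro: six_point_sum_quadratic_of_square_pos[OF k])
    qed
  qed auto
  have "bounded K"
  proof -
    have "norm Q \<le> sqrt (six_point_sum T / \<epsilon>)" if "Q \<in> K" for Q
    proof -
      have "\<Lambda> Q \<le> six_point_sum T"
        using that unfolding \<Lambda>_def six_point_sum_def K_def by (intro add_mono) auto
      with \<epsilon>(2)[of Q] have "\<epsilon> * norm Q ^ 2 \<le> six_point_sum T" by linarith
      then have "norm Q ^ 2 \<le> six_point_sum T / \<epsilon>" using \<epsilon>(1) by (simp add: field_simps)
      then show ?thesis by (rule real_le_rsqrt)
    qed
    then show ?thesis by (auto simp: bounded_iff)
  qed
  moreover have "closed K"
    unfolding K_def by (intro closed_Collect_all closed_Collect_le cont_S continuous_on_const)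
  ultimately have "compact K" by (simp add: compact_eq_bounded_closed)
  moreover have "0 \<in> K" using psd by (simp add: K_def S_def quadratic_of_0)
  then have "K \<noteq> {}" by blast
  ultimately obtain Q where Q: "Q \<in> K" "\<And>Q'. Q' \<in> K \<Longrightarrow> \<Lambda> Q' \<le> \<Lambda> Q"
    using continuous_attains_sup[of K \<Lambda>] cont by blast
  define R where "R x y z = T x y z - S Q x y z" for x y z
  have "form_fun 4 R"
  proof -
    have "form_fun (2 * 2) (\<lambda>x y z. (quadratic_of (Q $ k) x y z)^2)" for k by (rule form_fun_power[OF form_fun_quadratic_of])
    then show ?thesis unfolding R_def S_def by (intro form_fun_diff assms form_fun_sum) simp
  qed
  moreover have "R x y z \<ge> 0" for x y z using Q(1) by (simp add: R_def K_def)
  ultimately have "R x y z = 0" for x y z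
  proof (rule_tac ccontr)
    assume "form_fun 4 R" "\<And>x y z. R x y z \<ge> 0" "R x y z \<noteq> 0"
    then have "ge_square R" by (rule psd_quartic_ge_square)
    then obtain q x0 y0 z0 where q: "form_fun 2 q" "q x0 y0 z0 \<noteq> 0" "\<And>x y z. (q x y z)^2 \<le> R x y z"
      unfolding ge_square_def by blast
    obtain a where a: "q = quadratic_of a" using form_fun_2_quadratic_ofE[OF q(1)] .
    have "a \<noteq> 0" using q(2) a by (auto simp: quadratic_of_0)
    obtain c :: "real ^ 7" where c: "(\<Sum>k\<in>UNIV. (c $ k)^2) = 1" "(\<Sum>k\<in>UNIV. c $ k *\<^sub>R Q $ k) = 0"
      using seven_dependent .
    define Q' where "Q' = (\<chi> k. Q $ k + c $ k *\<^sub>R a)"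
    have S: "S Q' x y z = S Q x y z + (q x y z)^2" for x y z
    proof -
      have "S Q' x y z = (\<Sum>k\<in>UNIV. (quadratic_of (Q $ k) x y z)^2
          + 2 * quadratic_of a x y z * (c $ k * quadratic_of (Q $ k) x y z) + (quadratic_of a x y z)^2 * (c $ k)^2)"
        unfolding S_def Q'_def by (intro sum.cong) (auto simp: quadratic_of_add quadratic_of_scaleR power2_eq_square algebra_simps)
      also have "\<dots> = S Q x y z + 2 * quadratic_of a x y z * (\<Sum>k\<in>UNIV. c $ k * quadratic_of (Q $ k) x y z)
          + (quadratic_of a x y z)^2 * (\<Sum>k\<in>UNIV. (c $ k)^2)"
        by (simp only: sum.distrib sum_distrib_left S_def)
      also have "(\<Sum>k\<in>UNIV. c $ k * quadratic_of (Q $ k) x y z) = quadratic_of (\<Sum>k\<in>UNIV. c $ k *\<^sub>R Q $ k) x y z"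
        by (simp add: quadratic_of_sum quadratic_of_scaleR)
      finally show ?thesis by (simp add: c a quadratic_of_0)
    qed
    have "Q' \<in> K" using q(3) by (auto simp: K_def S R_def algebra_simps)
    then have "\<Lambda> Q' \<le> \<Lambda> Q" by (rule Q(2))
    moreover have "\<Lambda> Q' = \<Lambda> Q + six_point_sum (\<lambda>x y z. (quadratic_of a x y z)^2)"
      unfolding \<Lambda>_def six_point_sum_def S a by simp
    ultimately show False using six_point_sum_quadratic_of_square_pos[OF \<open>a \<noteq> 0\<close>] by linarith
  qed
  then have T: "T x y z = (\<Sum>k\<in>UNIV. (quadratic_of (Q $ k) x y z)^2)" for x y z
    by (simp add: R_def S_def)
  obtain h where h: "bij_betw h {0..<CARD(7)} (UNIV :: 7 set)"
    using ex_bij_betw_nat_finite[of "UNIV :: 7 set"] by auto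
  have "T x y z = (\<Sum>k<7. (quadratic_of (Q $ h k) x y z)^2)" for x y z
    unfolding T using sum.reindex_bij_betw[OF h, of "\<lambda>k. (quadratic_of (Q $ k) x y z)^2"]
    by (simp add: atLeast0LessThan)
  then show thesis using that[of 7 "\<lambda>k. quadratic_of (Q $ h k)"] form_fun_quadratic_of by blast
qed

section \<open>Divisibility by linear and quadratic forms\<close>

lemma polys_on_insert_induct [consumes 1, case_names base add Var]:
  assumes P: "P \<in> polys_on (insert i I)"
    and base: "\<And>A. A \<in> polys_on I \<Longrightarrow> D A"
    and add: "\<And>A B. D A \<Longrightarrow> D B \<Longrightarrow> D (A + B)"
    and Var: "\<And>A. D A \<Longrightarrow> D (A * Var i)"
  shows "D P"
proof -
  obtain N Q where Q: "\<And>j. Q j \<in> polys_on (I - {i})" "P = (\<Sum>j\<le>(N::nat). Q j * Var i ^ j)"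
    using polys_on_insertE[OF P] by blast
  have QI: "Q j \<in> polys_on I" for j using Q(1) polys_on_mono by blast
  have 1: "D (A * Var i ^ j)" if "A \<in> polys_on I" for A j
    by (induction j) (use base that Var in \<open>auto simp: mult.assoc[symmetric] power_Suc2 simp del: power_Suc\<close>)
  have "D (\<Sum>j\<le>n. Q j * Var i ^ j)" for n
    by (induction n) (use 1 QI add in \<open>auto simp del: power_Suc\<close>, use 1[of "Q 0" 0] QI in auto)
  then show ?thesis by (simp add: Q(2))
qed

lemma divide_linear:
  assumes "P \<in> polys_on (insert i I)" "i \<notin> I" "L \<in> polys_on I"
  obtains Q A where "Q \<in> polys_on (insert i I)" "A \<in> polys_on I" "P = (Var i + L) * Q + A"
proof -
  have "\<exists>Q A. Q \<in> polys_on (insert i I) \<and> A \<in> polys_on I \<and> P = (Var i + L) * Q + A"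
    using assms(1)
  proof (induction rule: polys_on_insert_induct)
    case (base A)
    then show ?case by (intro exI[of _ 0] exI[of _ A]) auto
  next
    case (add A B)
    then obtain Q A' Q' B' where "Q \<in> polys_on (insert i I)" "A' \<in> polys_on I" "A = (Var i + L) * Q + A'"
      "Q' \<in> polys_on (insert i I)" "B' \<in> polys_on I" "B = (Var i + L) * Q' + B'" by blast
    then show ?case
      by (intro exI[of _ "Q + Q'"] exI[of _ "A' + B'"]) (auto simp: algebra_simps)
  next
    case (Var A)
    then obtain Q A' where *: "Q \<in> polys_on (insert i I)" "A' \<in> polys_on I" "A = (Var i + L) * Q + A'"
      by blast
    have "A' \<in> polys_on (insert i I)" "Var i \<in> polys_on (insert i I)"
      using *(2) by (auto intro: polys_on_mono[of I])
    then show ?case using * assms(3)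
      by (intro exI[of _ "Q * Var i + A'"] exI[of _ "- A' * L"])
        (auto simp: algebra_simps)
  qed
  then show thesis using that by blast
qed

text \<open>
  Division by \<open>a\<close>, which is monic in one variable up to a constant. Remainders are expanded in powers of \<open>l\<close>
  instead of the variable itself, because \<open>l\<^sup>2\<close> is \<open>- s\<close> modulo \<open>a\<close>.
\<close>

lemma divide_quadratic:
  assumes "P \<in> polys_on (insert i I)" "i \<notin> I" "L \<in> polys_on I" "s \<in> polys_on I" "\<alpha> \<noteq> 0"
    and l: "l = Var i + L" and a: "a = Const \<alpha> * (l\<^sup>2 + s)"
  obtains Q A B where "Q \<in> polys_on (insert i I)" "A \<in> polys_on I" "B \<in> polys_on I" "P = a * Q + A + B * l"
proof -
  have inv: "Const (1/\<alpha>) * Const \<alpha> = 1"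
    using \<open>\<alpha> \<noteq> 0\<close> by (simp add: Const_def mult_single)
  have lI: "l \<in> polys_on (insert i I)" "L \<in> polys_on (insert i I)"
    using assms(3) by (auto simp: l intro!: polys_on_add intro: polys_on_mono[of I])
  have "\<exists>Q A B. Q \<in> polys_on (insert i I) \<and> A \<in> polys_on I \<and> B \<in> polys_on I \<and> P = a * Q + A + B * l"
    using assms(1)
  proof (induction rule: polys_on_insert_induct)
    case (base A)
    then show ?case by (intro exI[of _ 0] exI[of _ A] exI[of _ 0]) auto
  next
    case (add P1 P2)
    then obtain Q A B Q' A' B' where "Q \<in> polys_on (insert i I)" "A \<in> polys_on I" "B \<in> polys_on I"
      "P1 = a * Q + A + B * l" "Q' \<in> polys_on (insert i I)" "A' \<in> polys_on I" "B' \<in> polys_on I"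
      "P2 = a * Q' + A' + B' * l" by blast
    then show ?case
      by (intro exI[of _ "Q + Q'"] exI[of _ "A + A'"] exI[of _ "B + B'"]) (auto simp: algebra_simps)
  next
    case (Var P)
    then obtain Q A B where *: "Q \<in> polys_on (insert i I)" "A \<in> polys_on I" "B \<in> polys_on I"
      "P = a * Q + A + B * l" by blast
    have BI: "B \<in> polys_on (insert i I)" using *(3) by (auto intro: polys_on_mono[of I])
    have X: "Var i = l - L" by (simp add: l)
    have "B * l * l = a * (Const (1/\<alpha>) * B) - B * s"
    proof -
      have "a * (Const (1/\<alpha>) * B) = (Const (1/\<alpha>) * Const \<alpha>) * (B * (l\<^sup>2 + s))"
        unfolding a by (simp only: mult_ac)
      then show ?thesis unfolding inv by (simp add: power2_eq_square algebra_simps)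
    qed
    then have "P * Var i = a * (Q * Var i + Const (1/\<alpha>) * B) + (- A * L - B * s) + (A - B * L) * l"
      unfolding *(4) X by (simp add: algebra_simps)
    moreover have "Q * Var i + Const (1/\<alpha>) * B \<in> polys_on (insert i I)"
      using *(1) BI by (intro polys_on_add polys_on_mult polys_on_Const polys_on_Var) auto
    moreover have "- A * L - B * s \<in> polys_on I" "A - B * L \<in> polys_on I"
      using * assms(3,4) by auto
    ultimately show ?case by blast
  qed
  then show thesis using that by blast
qed

text \<open>
  Let \<open>A\<^sub>j + B\<^sub>j l\<close> be the remainders of the two factors. The polynomial \<open>a\<close> vanishes at the complex points
  with \<open>l = \<i> \<surd>s\<close>, so there one of the \<open>A\<^sub>j + \<i> \<surd>s B\<^sub>j\<close> is zero. As \<open>A\<^sub>j\<close>, \<open>B\<^sub>j\<close> and \<open>\<surd>s\<close> are real, the polynomial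
  \<open>s (A\<^sub>1\<^sup>2 + B\<^sub>1\<^sup>2) (A\<^sub>2\<^sup>2 + B\<^sub>2\<^sup>2)\<close> vanishes at every real point; hence one of its factors is zero.
\<close>

lemma quadratic_prime:
  assumes "i \<notin> I" "L \<in> polys_on I" "s \<in> polys_on I" "\<alpha> \<noteq> 0"
    and l: "l = Var i + L" and a: "a = Const \<alpha> * (l\<^sup>2 + s)"
    and s_nonneg: "\<And>v :: nat \<Rightarrow> real. ev v s \<ge> 0" and "s \<noteq> 0"
    and P: "P1 \<in> polys_on (insert i I)" "P2 \<in> polys_on (insert i I)" and eq: "P1 * P2 = a * R"
  shows "(\<exists>Q\<in>polys_on (insert i I). P1 = a * Q) \<or> (\<exists>Q\<in>polys_on (insert i I). P2 = a * Q)"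
proof -
  obtain Q1 A1 B1 where Q1: "Q1 \<in> polys_on (insert i I)" and 1: "A1 \<in> polys_on I" "B1 \<in> polys_on I"
    and P1: "P1 = a * Q1 + A1 + B1 * l"
    using divide_quadratic[OF P(1) assms(1-4) l a] by blast
  obtain Q2 A2 B2 where Q2: "Q2 \<in> polys_on (insert i I)" and 2: "A2 \<in> polys_on I" "B2 \<in> polys_on I"
    and P2: "P2 = a * Q2 + A2 + B2 * l"
    using divide_quadratic[OF P(2) assms(1-4) l a] by blast
  have "s * (A1\<^sup>2 + B1\<^sup>2) * (A2\<^sup>2 + B2\<^sup>2) = 0"
  proof (rule ev_eq_0)
    fix v :: "nat \<Rightarrow> real"
    \<comment> \<open>The point over \<open>v\<close> where \<open>l = \<i> \<surd>s\<close>.\<close>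
    define cv :: "nat \<Rightarrow> complex" where
      "cv = (\<lambda>k. of_real (v k))(i := \<i> * of_real (sqrt (ev v s)) - of_real (ev v L))"
    have cv: "ev cv p = of_real (ev v p)" if "p \<in> polys_on I" for p
    proof -
      have "ev cv p = ev (\<lambda>k. of_real (v k)) p"
        by (rule ev_cong[OF that]) (use assms(1) in \<open>auto simp: cv_def\<close>)
      then show ?thesis by (simp add: ev_of_real)
    qed
    have cl: "ev cv l = \<i> * of_real (sqrt (ev v s))"
      by (simp add: l ev_simps cv assms(2)) (simp add: cv_def)
    have "(of_real (sqrt (ev v s)) :: complex)\<^sup>2 = of_real (ev v s)"
      using s_nonneg[of v] by (simp flip: of_real_power)
    then have "ev cv a = 0"
      by (simp add: a ev_simps cl cv assms(3) power_mult_distrib)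
    then have "(ev cv A1 + ev cv B1 * ev cv l) * (ev cv A2 + ev cv B2 * ev cv l) = 0"
      using arg_cong[OF eq, of "ev cv"] by (simp add: P1 P2 ev_simps)
    then have "ev cv A1 + ev cv B1 * ev cv l = 0 \<or> ev cv A2 + ev cv B2 * ev cv l = 0" by simp
    then have "(ev v A1 = 0 \<and> ev v B1 * sqrt (ev v s) = 0) \<or> (ev v A2 = 0 \<and> ev v B2 * sqrt (ev v s) = 0)"
      using 1 2 by (auto simp: cv cl complex_eq_iff)
    then show "ev v (s * (A1\<^sup>2 + B1\<^sup>2) * (A2\<^sup>2 + B2\<^sup>2)) = 0"
      using s_nonneg[of v] by (auto simp: ev_simps)
  qed
  then have "A1\<^sup>2 + B1\<^sup>2 = 0 \<or> A2\<^sup>2 + B2\<^sup>2 = 0" using \<open>s \<noteq> 0\<close> by simp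
  moreover have "A = 0 \<and> B = 0" if "A\<^sup>2 + B\<^sup>2 = 0" for A B :: rpoly
  proof -
    have "ev v A = 0 \<and> ev v B = 0" for v :: "nat \<Rightarrow> real"
      using arg_cong[OF that, of "ev v"] by (simp add: ev_simps sum_power2_eq_zero_iff)
    then show ?thesis using ev_eq_0 by blast
  qed
  ultimately consider "A1 = 0" "B1 = 0" | "A2 = 0" "B2 = 0" by blast
  then show ?thesis
  proof cases
    case 1
    then have "P1 = a * Q1" using P1 by simp
    then show ?thesis using Q1 by blast
  next
    case 2
    then have "P2 = a * Q2" using P2 by simp
    then show ?thesis using Q2 by blast
  qed
qed

lemma linear_dvd_if_zero:
  assumes "P \<in> polys_on (insert i I)" "i \<notin> I" "L \<in> polys_on I"
    and 0: "\<And>v :: nat \<Rightarrow> real. v i = - ev v L \<Longrightarrow> ev v P = 0"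
  shows "\<exists>Q\<in>polys_on (insert i I). P = (Var i + L) * Q"
proof -
  obtain Q A where *: "Q \<in> polys_on (insert i I)" "A \<in> polys_on I" "P = (Var i + L) * Q + A"
    using divide_linear[OF assms(1-3)] .
  have "A = 0"
  proof (rule ev_eq_0)
    fix v :: "nat \<Rightarrow> real"
    let ?w = "v(i := - ev v L)"
    have w: "ev ?w p = ev v p" if "p \<in> polys_on I" for p
      by (rule ev_cong[OF that]) (use assms(2) in auto)
    have "ev ?w P = 0" by (rule 0) (simp add: w assms(3))
    then show "ev v A = 0" by (simp add: *(3) ev_simps w assms(3) *(2))
  qed
  then show ?thesis using * by auto
qed

text \<open>
  On the real hyperplane where the linear form vanishes, a vanishing sum of squares forces every summand to
  vanish.
\<close>

lemma linear_dvd_sum_squares: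
  fixes P :: "nat \<Rightarrow> rpoly"
  assumes "\<And>k. k < N \<Longrightarrow> P k \<in> polys_on (insert i I)" "i \<notin> I" "L \<in> polys_on I"
    and eq: "(\<Sum>k<N. (P k)\<^sup>2) = (Var i + L) * R" and "k < N"
  shows "\<exists>Q\<in>polys_on (insert i I). P k = (Var i + L) * Q"
proof (rule linear_dvd_if_zero[OF assms(1)[OF \<open>k < N\<close>] assms(2,3)])
  fix v :: "nat \<Rightarrow> real" assume v: "v i = - ev v L"
  have "(\<Sum>k<N. (ev v (P k))\<^sup>2) = 0"
    using arg_cong[OF eq, of "ev v"] v by (simp add: ev_simps)
  then show "ev v (P k) = 0" using \<open>k < N\<close> by (simp add: sum_nonneg_eq_0_iff)
qed

text \<open>
  The remainder \<open>s\<close> is nonnegative, since up to the factor \<open>\<alpha>\<close> it is the value of \<open>a\<close> at the points where the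
  square vanishes.
\<close>

lemma complete_square:
  assumes "i \<notin> I" "\<beta> \<in> polys_on I" "\<gamma> \<in> polys_on I" "\<alpha> > 0"
    and a: "a = Const \<alpha> * (Var i)\<^sup>2 + 2 * \<beta> * Var i + \<gamma>"
    and psd: "\<And>v :: nat \<Rightarrow> real. ev v a \<ge> 0"
  obtains L s where "L \<in> polys_on I" "s \<in> polys_on I" "a = Const \<alpha> * ((Var i + L)\<^sup>2 + s)"
    "\<And>v :: nat \<Rightarrow> real. ev v s \<ge> 0"
proof -
  define L where "L = Const (1/\<alpha>) * \<beta>"
  define s where "s = Const (1/\<alpha>) * \<gamma> - L\<^sup>2"
  have LI: "L \<in> polys_on I" "s \<in> polys_on I" using assms by (auto simp: L_def s_def)
  have eq: "a = Const \<alpha> * ((Var i + L)\<^sup>2 + s)"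
    by (rule rpoly_eqI)
      (use \<open>\<alpha> > 0\<close> in \<open>simp add: a L_def s_def ev_simps power2_eq_square field_simps\<close>)
  have "ev v s \<ge> 0" for v :: "nat \<Rightarrow> real"
  proof -
    let ?w = "v(i := - ev v L)"
    have w: "ev ?w p = ev v p" if "p \<in> polys_on I" for p
      by (rule ev_cong[OF that]) (use assms(1) in auto)
    have "ev ?w a = \<alpha> * ev v s" by (simp add: eq ev_simps w LI)
    then show ?thesis using psd[of ?w] \<open>\<alpha> > 0\<close> by (simp add: zero_le_mult_iff)
  qed
  then show thesis using LI eq that by blast
qed

section \<open>Forms as polynomials and as functions\<close>

lemma ev_forms_form_fun:
  assumes "p \<in> forms 3 d"
  obtains F where "form_fun d F" "\<And>v. ev v p = F (v 0) (v 1) (v 2)"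
proof -
  have "\<exists>F. form_fun d F \<and> (\<forall>v. ev v p = F (v 0) (v 1) (v 2))"
  proof (rule monomial_induct[where p = p])
    show "\<exists>F. form_fun d F \<and> (\<forall>v. ev v 0 = F (v 0) (v 1) (v 2))" by (intro exI[of _ "\<lambda>x y z. 0"]) (simp add: form_fun_0)
  next
    fix p q
    assume "\<exists>F. form_fun d F \<and> (\<forall>v. ev v p = F (v 0) (v 1) (v 2))"
      "\<exists>F. form_fun d F \<and> (\<forall>v. ev v q = F (v 0) (v 1) (v 2))"
    then obtain F G where "form_fun d F" "\<forall>v. ev v p = F (v 0) (v 1) (v 2)"
      "form_fun d G" "\<forall>v. ev v q = G (v 0) (v 1) (v 2)" by blast
    then show "\<exists>F. form_fun d F \<and> (\<forall>v. ev v (p + q) = F (v 0) (v 1) (v 2))"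
      by (intro exI[of _ "\<lambda>x y z. F x y z + G x y z"]) (auto simp: ev_add intro: form_fun.add)
  next
    fix m c assume "m \<in> keys p"
    then have m: "keys m \<subseteq> {..<3}" "mon_degree m = d"
      using assms by (auto simp: forms_def polys_def)
    have 3: "{..<3} = {0, 1, 2 :: nat}" by auto
    have "mon_degree m = (\<Sum>i<3. lookup m i)" by (rule mon_degree_superset) (use m in auto)
    then have "lookup m 0 + lookup m 1 + lookup m 2 = d" using m(2) by (simp add: 3)
    moreover have "ev v (single m c) = c * v 0 ^ lookup m 0 * v 1 ^ lookup m 1 * v 2 ^ lookup m 2"
      for v :: "nat \<Rightarrow> real"
      unfolding ev_single evm_superset[OF finite_lessThan m(1)] by (simp add: 3)
    ultimately show "\<exists>F. form_fun d F \<and> (\<forall>v. ev v (single m c) = F (v 0) (v 1) (v 2))"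
      by (intro exI[of _ "\<lambda>x y z. c * x ^ lookup m 0 * y ^ lookup m 1 * z ^ lookup m 2"])
        (auto intro: form_fun.monom)
  qed
  then show thesis using that by blast
qed

lemma form_fun_formE:
  assumes "form_fun d F"
  obtains p where "p \<in> forms 3 d" "\<And>v. ev v p = F (v 0) (v 1) (v 2)"
proof -
  from assms have "\<exists>p\<in>forms 3 d. \<forall>v. ev v p = F (v 0) (v 1) (v 2)"
  proof (induction rule: form_fun.induct)
    case (monom i j k d c)
    have "Const c * Var 0 ^ i * Var 1 ^ j * Var 2 ^ k \<in> forms 3 (0 + i * 1 + j * 1 + k * 1)"
      by (intro forms_mult forms_Const forms_power forms_Var) auto
    then show ?case using monom
      by (intro bexI[of _ "Const c * Var 0 ^ i * Var 1 ^ j * Var 2 ^ k"]) (auto simp: ev_simps)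
  next
    case (add d F G)
    then obtain p q where "p \<in> forms 3 d" "\<forall>v. ev v p = F (v 0) (v 1) (v 2)"
      "q \<in> forms 3 d" "\<forall>v. ev v q = G (v 0) (v 1) (v 2)" by blast
    then show ?case by (intro bexI[of _ "p + q"]) (auto simp: ev_add forms_add)
  qed
  then show thesis using that by blast
qed

theorem Hilbert_ternary_quartic:
  assumes T: "T \<in> forms 3 4" and psd: "\<And>v :: nat \<Rightarrow> real. ev v T \<ge> 0"
  obtains N and h :: "nat \<Rightarrow> rpoly" where "\<And>k. k < N \<Longrightarrow> h k \<in> forms 3 2" "T = (\<Sum>k<N. (h k)\<^sup>2)"
proof -
  obtain F where F: "form_fun 4 F" "\<And>v. ev v T = F (v 0) (v 1) (v 2)"
    using ev_forms_form_fun[OF T] by blast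
  have "F x y z \<ge> 0" for x y z
    using psd[of "(\<lambda>_. 0)(0 := x, 1 := y, 2 := z)"] by (simp add: F(2))
  then obtain N and q :: "nat \<Rightarrow> real \<Rightarrow> real \<Rightarrow> real \<Rightarrow> real"
    where q: "\<And>k. k < N \<Longrightarrow> form_fun 2 (q k)" "\<And>x y z. F x y z = (\<Sum>k<N. (q k x y z)^2)"
    using psd_quartic_sum_of_squares[OF F(1)] by blast
  have "\<forall>k<N. \<exists>p. p \<in> forms 3 2 \<and> (\<forall>v. ev v p = q k (v 0) (v 1) (v 2))"
    using form_fun_formE[OF q(1)] by metis
  then obtain h where h: "\<And>k. k < N \<Longrightarrow> h k \<in> forms 3 2"
    "\<And>k v. k < N \<Longrightarrow> ev v (h k) = q k (v 0) (v 1) (v 2)" by metis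
  have "T = (\<Sum>k<N. (h k)\<^sup>2)"
    by (rule rpoly_eqI) (simp add: F(2) q(2) h(2) ev_simps)
  with h(1) show thesis by (rule that)
qed

lemma ev_forms_homogeneous:
  fixes t :: real
  assumes "p \<in> forms 3 d"
  shows "ev (\<lambda>i. t * v i) p = t ^ d * ev v p"
proof -
  obtain F where F: "form_fun d F" "\<And>v. ev v p = F (v 0) (v 1) (v 2)"
    using ev_forms_form_fun[OF assms] by blast
  show ?thesis unfolding F(2) by (rule form_fun_homogeneous[OF F(1)])
qed

lemma isCont_ev_ray:
  fixes v :: "nat \<Rightarrow> real"
  shows "isCont (\<lambda>t. ev (\<lambda>i. t * v i) p) x"
  unfolding ev_def evm_def by (intro continuous_intros)

text \<open>
  Some variable has a positive coefficient in the diagonal: if all the diagonal coefficients are zero,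
  nonnegativity kills the mixed ones.
\<close>

lemma psd_quadratic_complete_square:
  assumes a: "a \<in> forms 3 2" and "a \<noteq> 0" and psd: "\<And>v :: nat \<Rightarrow> real. ev v a \<ge> 0"
  obtains i \<alpha> I L s where "insert i I = {..<3}" "i \<notin> I" "\<alpha> > 0" "L \<in> polys_on I" "s \<in> polys_on I"
    "a = Const \<alpha> * ((Var i + L)\<^sup>2 + s)" "\<And>v :: nat \<Rightarrow> real. ev v s \<ge> 0"
proof -
  note goal = that
  obtain F where F: "form_fun 2 F" "\<And>v. ev v a = F (v 0) (v 1) (v 2)"
    using ev_forms_form_fun[OF a] by blast
  obtain a1 a2 a3 b1 b2 b3 where
    F2: "\<And>x y z. F x y z = a1*x^2 + a2*y^2 + a3*z^2 + b1*y*z + b2*x*z + b3*x*y"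
    using form_fun_2E[OF F(1)] by blast
  have pos: "a1*x^2 + a2*y^2 + a3*z^2 + b1*y*z + b2*x*z + b3*x*y \<ge> 0" for x y z
    using psd[of "(\<lambda>_. 0)(0 := x, 1 := y, 2 := z)"] by (simp add: F(2) F2)
  have ge: "a1 \<ge> 0" "a2 \<ge> 0" "a3 \<ge> 0" using pos[of 1 0 0] pos[of 0 1 0] pos[of 0 0 1] by auto
  have "a1 > 0 \<or> a2 > 0 \<or> a3 > 0"
  proof (rule ccontr)
    assume "\<not> ?thesis"
    then have 0: "a1 = 0" "a2 = 0" "a3 = 0" using ge by auto
    have "b1 = 0" "b2 = 0" "b3 = 0"
      using pos[of 0 1 1] pos[of 0 1 "-1"] pos[of 1 0 1] pos[of 1 0 "-1"] pos[of 1 1 0] pos[of 1 "-1" 0]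
      by (auto simp: 0)
    then have "a = 0" by (intro ev_eq_0) (simp add: F(2) F2 0)
    with \<open>a \<noteq> 0\<close> show False by simp
  qed
  then consider "a1 > 0" | "a2 > 0" | "a3 > 0" by blast
  then show thesis
  proof cases
    case 1
    show thesis
    proof (rule complete_square[OF _ _ _ 1 _ psd])
      show "a = Const a1 * (Var 0)\<^sup>2 + 2 * (Const (b3/2) * Var 1 + Const (b2/2) * Var 2) * Var 0
          + (Const a2 * (Var 1)\<^sup>2 + Const a3 * (Var 2)\<^sup>2 + Const b1 * Var 1 * Var 2)"
        by (rule rpoly_eqI) (simp add: ev_simps F(2) F2 algebra_simps)
      show "(0::nat) \<notin> {1, 2}" by simp
      show thesis if "L \<in> polys_on {1,2}" "s \<in> polys_on {1,2}" "a = Const a1 * ((Var 0 + L)\<^sup>2 + s)"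
        "\<And>v :: nat \<Rightarrow> real. ev v s \<ge> 0" for L s
        by (rule goal[of 0 "{1,2}" a1 L s]) (use 1 that in auto)
    qed (intro polys_on_add polys_on_mult polys_on_power polys_on_Const polys_on_Var; simp)+
  next
    case 2
    show thesis
    proof (rule complete_square[OF _ _ _ 2 _ psd])
      show "a = Const a2 * (Var 1)\<^sup>2 + 2 * (Const (b3/2) * Var 0 + Const (b1/2) * Var 2) * Var 1
          + (Const a1 * (Var 0)\<^sup>2 + Const a3 * (Var 2)\<^sup>2 + Const b2 * Var 0 * Var 2)"
        by (rule rpoly_eqI) (simp add: ev_simps F(2) F2 algebra_simps)
      show "(1::nat) \<notin> {0, 2}" by simp
      show thesis if "L \<in> polys_on {0,2}" "s \<in> polys_on {0,2}" "a = Const a2 * ((Var 1 + L)\<^sup>2 + s)"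
        "\<And>v :: nat \<Rightarrow> real. ev v s \<ge> 0" for L s
        by (rule goal[of 1 "{0,2}" a2 L s]) (use 2 that in auto)
    qed (intro polys_on_add polys_on_mult polys_on_power polys_on_Const polys_on_Var; simp)+
  next
    case 3
    show thesis
    proof (rule complete_square[OF _ _ _ 3 _ psd])
      show "a = Const a3 * (Var 2)\<^sup>2 + 2 * (Const (b2/2) * Var 0 + Const (b1/2) * Var 1) * Var 2
          + (Const a1 * (Var 0)\<^sup>2 + Const a2 * (Var 1)\<^sup>2 + Const b3 * Var 0 * Var 1)"
        by (rule rpoly_eqI) (simp add: ev_simps F(2) F2 algebra_simps)
      show "(2::nat) \<notin> {0, 1}" by simp
      show thesis if "L \<in> polys_on {0,1}" "s \<in> polys_on {0,1}" "a = Const a3 * ((Var 2 + L)\<^sup>2 + s)"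
        "\<And>v :: nat \<Rightarrow> real. ev v s \<ge> 0" for L s
        by (rule goal[of 2 "{0,1}" a3 L s]) (use 3 that in auto)
    qed (intro polys_on_add polys_on_mult polys_on_power polys_on_Const polys_on_Var; simp)+
  qed
qed

text \<open>
  Multiplying by the square of a variable reduces quadratic to quartic forms, because that variable divides
  each summand in a sum of squares that it divides.
\<close>

lemma psd_quadratic_sum_of_squares:
  assumes a: "a \<in> forms 3 2" and psd: "\<And>v :: nat \<Rightarrow> real. ev v a \<ge> 0"
  obtains N and h :: "nat \<Rightarrow> rpoly" where "\<And>k. k < N \<Longrightarrow> h k \<in> polys_on {..<3}" "a = (\<Sum>k<N. (h k)\<^sup>2)"
proof -
  have "(Var 0)\<^sup>2 * a \<in> forms 3 (2 * 1 + 2)"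
    by (intro forms_mult forms_power forms_Var a) simp
  then have "(Var 0)\<^sup>2 * a \<in> forms 3 4" by simp
  moreover have "ev v ((Var 0)\<^sup>2 * a) \<ge> 0" for v :: "nat \<Rightarrow> real" by (simp add: ev_simps psd)
  ultimately obtain N and h :: "nat \<Rightarrow> rpoly"
    where h: "\<And>k. k < N \<Longrightarrow> h k \<in> forms 3 2" "(Var 0)\<^sup>2 * a = (\<Sum>k<N. (h k)\<^sup>2)"
    using Hilbert_ternary_quartic by blast
  have I: "insert 0 {1, 2} = {..<3::nat}" by auto
  have "\<exists>Q\<in>polys_on (insert 0 {1,2}). h k = (Var 0 + 0) * Q" if "k < N" for k
  proof (rule linear_dvd_sum_squares[OF _ _ _ _ that])
    show "(\<Sum>k<N. (h k)\<^sup>2) = (Var 0 + 0) * (Var 0 * a)"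
      unfolding h(2)[symmetric] by (simp add: power2_eq_square mult.assoc)
    show "h k \<in> polys_on (insert 0 {1, 2})" if "k < N" for k
      unfolding I by (rule forms_polys_on[OF h(1)[OF that]])
  qed auto
  then have "\<forall>k<N. \<exists>Q. Q \<in> polys_on {..<3} \<and> h k = Var 0 * Q" unfolding I by auto
  then obtain g where g: "\<And>k. k < N \<Longrightarrow> g k \<in> polys_on {..<3}" "\<And>k. k < N \<Longrightarrow> h k = Var 0 * g k"
    by metis
  have "(Var 0)\<^sup>2 * a = (Var 0)\<^sup>2 * (\<Sum>k<N. (g k)\<^sup>2)"
    unfolding h(2) by (simp add: g(2) power_mult_distrib sum_distrib_left)
  moreover have "Var 0 \<noteq> 0" by (simp add: Var_def flip: keys_eq_empty)
  ultimately have "a = (\<Sum>k<N. (g k)\<^sup>2)" by simp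
  with g(1) show thesis by (rule that)
qed

text \<open>
  Membership in \<open>sos_forms\<close> apart from homogeneity, which spares the bookkeeping of degrees while
  representations are assembled.
\<close>

definition is_sos :: "nat \<Rightarrow> rpoly \<Rightarrow> bool" where
  "is_sos n p \<longleftrightarrow> (\<exists>N::nat. \<exists>h. (\<forall>k<N. h k \<in> polys n) \<and> p = (\<Sum>k<N. (h k)\<^sup>2))"

lemma is_sos_add_square:
  assumes "is_sos n p" "h \<in> polys n"
  shows "is_sos n (p + h\<^sup>2)"
proof -
  obtain N g where "\<forall>k<N. g k \<in> polys n" "p = (\<Sum>k<(N::nat). (g k)\<^sup>2)"
    using assms(1) unfolding is_sos_def by blast
  then show ?thesis unfolding is_sos_def using assms(2)
    by (intro exI[of _ "Suc N"] exI[of _ "g(N := h)"]) (auto simp: less_Suc_eq intro!: sum.cong)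
qed

lemma is_sos_sum_squares:
  fixes h :: "nat \<Rightarrow> rpoly"
  assumes "\<And>k. k < N \<Longrightarrow> h k \<in> polys n"
  shows "is_sos n (\<Sum>k<N. (h k)\<^sup>2)"
  unfolding is_sos_def using assms by (intro exI[of _ N] exI[of _ h]) simp

lemma is_sos_add:
  assumes "is_sos n p" "is_sos n q"
  shows "is_sos n (p + q)"
proof -
  obtain N g where g: "\<forall>k<N. g k \<in> polys n" "q = (\<Sum>k<(N::nat). (g k)\<^sup>2)"
    using assms(2) unfolding is_sos_def by blast
  have "is_sos n (p + (\<Sum>k<M. (g k)\<^sup>2))" if "M \<le> N" for M
    using that
    by (induction M) (use assms(1) g(1) is_sos_add_square in \<open>auto simp: add.assoc[symmetric]\<close>)
  then show ?thesis using g(2) by blast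
qed

lemma psd_quad_in_u:
  fixes v :: "nat \<Rightarrow> real"
  assumes "a \<in> polys_on {..<3}" "b \<in> polys_on {..<3}" "c \<in> polys_on {..<3}"
    and "quad_in_u a b c \<in> psd_forms 4 4"
  shows "ev v a \<ge> 0" "ev v c \<ge> 0" "(ev v b)\<^sup>2 \<le> ev v a * ev v c"
proof -
  have "ev v a * t\<^sup>2 + 2 * ev v b * t + ev v c \<ge> 0" for t
  proof -
    have ev3: "ev (v(3 := t)) f = ev v f" if "f \<in> polys_on {..<3}" for f
      by (rule ev_cong[OF that]) auto
    have "ev (v(3 := t)) (quad_in_u a b c) \<ge> 0"
      using assms(4) by (simp add: psd_forms_def eval_poly_eq)
    then show ?thesis by (simp add: quad_in_u_def U_eq ev_simps ev3 assms)
  qed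
  from nonneg_quadratic[OF this] show "ev v a \<ge> 0" "ev v c \<ge> 0" "(ev v b)\<^sup>2 \<le> ev v a * ev v c" .
qed

section \<open>Sums of squares from representations of the discriminant\<close>

text \<open>
  Put \<open>t = r + \<mu> p\<close> with \<open>\<mu> = M / (2 \<nu>)\<close>, \<open>\<theta> = 2 \<surd>\<nu> / (1 + \<nu>)\<close> and \<open>\<kappa> = (1 - \<nu>) / (1 + \<nu>)\<close>. The vectors \<open>p / \<surd>\<nu>\<close> and
  \<open>\<theta> t\<close> have the inner products \<open>a\<close> and \<open>b\<close> that a Gram representation of \<open>a y\<^sup>2 + 2 b y + c\<close> requires, as the
  term \<open>\<mu> p\<close> removes the multiple of \<open>a\<close> from \<open>p \<cdot> r\<close>. Only the constant term falls short, and since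
  \<open>\<theta>\<^sup>2 + \<kappa>\<^sup>2 = 1\<close>, the defect is the squared length of \<open>\<kappa> t - \<mu> p\<close>.
\<close>

lemma gram_shift_identity:
  fixes a b c y \<nu> M :: real and p r :: "nat \<Rightarrow> real"
  assumes "\<nu> > 0" and P: "(\<Sum>k<N. (p k)\<^sup>2) = \<nu> * a"
    and S: "2 * (\<Sum>k<N. p k * r k) = (1 + \<nu>) * b - a * M"
    and R: "(\<Sum>k<N. (r k)\<^sup>2) = c - b * M"
  shows "a * y\<^sup>2 + 2 * b * y + c
    = (\<Sum>k<N. (1 / sqrt \<nu> * p k * y + 2 * sqrt \<nu> / (1 + \<nu>) * (r k + M / (2 * \<nu>) * p k))\<^sup>2)
    + (\<Sum>k<N. ((1 - \<nu>) / (1 + \<nu>) * (r k + M / (2 * \<nu>) * p k) - M / (2 * \<nu>) * p k)\<^sup>2)"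
proof -
  define \<theta> \<kappa> \<mu> \<sigma> where "\<theta> = 2 * sqrt \<nu> / (1 + \<nu>)" and "\<kappa> = (1 - \<nu>) / (1 + \<nu>)"
    and "\<mu> = M / (2 * \<nu>)" and "\<sigma> = 1 / sqrt \<nu>"
  define S' where "S' = (\<Sum>k<N. p k * r k)"
  have \<sigma>: "\<sigma>\<^sup>2 * \<nu> = 1" "\<sigma> * \<theta> * (1 + \<nu>) = 2"
    using \<open>\<nu> > 0\<close> by (auto simp: \<sigma>_def \<theta>_def power_divide divide_eq_eq)
  have "\<theta>\<^sup>2 + \<kappa>\<^sup>2 = (4 * \<nu> + (1 - \<nu>)\<^sup>2) / (1 + \<nu>)\<^sup>2"
    using \<open>\<nu> > 0\<close> by (simp add: \<theta>_def \<kappa>_def power_divide power_mult_distrib add_divide_distrib)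
  also have "4 * \<nu> + (1 - \<nu>)\<^sup>2 = (1 + \<nu>)\<^sup>2" by (simp add: power2_eq_square algebra_simps)
  finally have \<theta>\<kappa>: "\<theta>\<^sup>2 + \<kappa>\<^sup>2 = 1" using \<open>\<nu> > 0\<close> by simp
  have \<kappa>: "\<kappa> * (1 + \<nu>) = 1 - \<nu>" using \<open>\<nu> > 0\<close> by (simp add: \<kappa>_def)
  have M: "M = 2 * \<nu> * \<mu>" using \<open>\<nu> > 0\<close> by (simp add: \<mu>_def)
  have *: "(\<Sum>k<N. (x * p k + z * r k)\<^sup>2) = x\<^sup>2 * (\<nu> * a) + 2 * x * z * S' + z\<^sup>2 * (c - b * M)" for x z
    unfolding P[symmetric] R[symmetric] S'_def
    by (simp add: power2_sum power_mult_distrib sum.distrib sum_distrib_left mult_ac)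
  have S': "2 * S' = (1 + \<nu>) * b - a * M" using S by (simp add: S'_def)
  have "(\<Sum>k<N. (\<sigma> * p k * y + \<theta> * (r k + \<mu> * p k))\<^sup>2) + (\<Sum>k<N. (\<kappa> * (r k + \<mu> * p k) - \<mu> * p k)\<^sup>2)
      = (\<Sum>k<N. ((\<sigma> * y + \<theta> * \<mu>) * p k + \<theta> * r k)\<^sup>2) + (\<Sum>k<N. ((\<kappa> * \<mu> - \<mu>) * p k + \<kappa> * r k)\<^sup>2)"
    by (simp add: algebra_simps)
  also have "\<dots> = ((\<sigma> * y + \<theta> * \<mu>)\<^sup>2 + (\<kappa> * \<mu> - \<mu>)\<^sup>2) * (\<nu> * a)
      + (2 * S') * ((\<sigma> * y + \<theta> * \<mu>) * \<theta> + (\<kappa> * \<mu> - \<mu>) * \<kappa>) + (\<theta>\<^sup>2 + \<kappa>\<^sup>2) * (c - b * M)"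
    unfolding * by (simp add: algebra_simps)
  also have "(\<sigma> * y + \<theta> * \<mu>)\<^sup>2 + (\<kappa> * \<mu> - \<mu>)\<^sup>2
      = \<sigma>\<^sup>2 * y\<^sup>2 + 2 * \<sigma> * \<theta> * \<mu> * y + (\<theta>\<^sup>2 + \<kappa>\<^sup>2) * \<mu>\<^sup>2 - 2 * \<kappa> * \<mu>\<^sup>2 + \<mu>\<^sup>2"
    by (simp add: power2_eq_square algebra_simps)
  also have "(\<sigma> * y + \<theta> * \<mu>) * \<theta> + (\<kappa> * \<mu> - \<mu>) * \<kappa> = \<sigma> * \<theta> * y + (\<theta>\<^sup>2 + \<kappa>\<^sup>2) * \<mu> - \<kappa> * \<mu>"
    by (simp add: power2_eq_square algebra_simps)
  also have "(\<sigma>\<^sup>2 * y\<^sup>2 + 2 * \<sigma> * \<theta> * \<mu> * y + (\<theta>\<^sup>2 + \<kappa>\<^sup>2) * \<mu>\<^sup>2 - 2 * \<kappa> * \<mu>\<^sup>2 + \<mu>\<^sup>2) * (\<nu> * a)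
      + 2 * S' * (\<sigma> * \<theta> * y + (\<theta>\<^sup>2 + \<kappa>\<^sup>2) * \<mu> - \<kappa> * \<mu>) + (\<theta>\<^sup>2 + \<kappa>\<^sup>2) * (c - b * M)
    = (\<sigma>\<^sup>2 * \<nu>) * a * y\<^sup>2 + (\<sigma> * \<theta> * (1 + \<nu>)) * b * y + c + b * \<mu> * ((1 + \<nu>) - \<kappa> * (1 + \<nu>) - 2 * \<nu>)"
    unfolding \<theta>\<kappa> S' M by (simp add: power2_eq_square algebra_simps)
  also have "\<dots> = a * y\<^sup>2 + 2 * b * y + c"
    unfolding \<sigma> \<kappa> by simp
  finally show ?thesis unfolding \<theta>_def \<kappa>_def \<mu>_def \<sigma>_def by simp
qed

text \<open>
  With \<open>b = l b\<^sub>1\<close> and \<open>b' = l b\<^sub>2\<close>, the discriminant is \<open>l\<^sup>2 E\<close> where \<open>E = \<alpha> c - b\<^sub>1\<^sup>2 = \<alpha> c' - b\<^sub>2\<^sup>2\<close>. Dividing the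
  representation of \<open>a \<Delta>\<close> by \<open>l\<^sup>2\<close> twice leaves \<open>\<alpha> E\<close> as a sum of squares, while
  \<open>\<alpha> g = (\<alpha> l u + b\<^sub>2)\<^sup>2 + E\<close>.
\<close>

lemma sos_of_degenerate:
  fixes p r :: "nat \<Rightarrow> rpoly"
  assumes i: "insert i I = {..<3}" "i \<notin> I" "\<alpha> > 0" "L \<in> polys_on I"
    and l: "l = Var i + L" and a: "a = Const \<alpha> * l\<^sup>2"
    and pol: "b \<in> polys_on {..<3}" "c \<in> polys_on {..<3}" "b' \<in> polys_on {..<3}" "c' \<in> polys_on {..<3}"
      "\<And>k. k < N \<Longrightarrow> p k \<in> polys_on {..<3}" "\<And>k. k < N \<Longrightarrow> r k \<in> polys_on {..<3}"
    and le: "\<And>v :: nat \<Rightarrow> real. (ev v b)\<^sup>2 \<le> ev v a * ev v c" "\<And>v :: nat \<Rightarrow> real. (ev v b')\<^sup>2 \<le> ev v a * ev v c'"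
    and eq: "a * discr a b c = (\<Sum>k<N. (a * r k - b * p k)\<^sup>2)" and d: "discr a b' c' = discr a b c"
  shows "is_sos 4 (quad_in_u a b' c')"
proof -
  have dvd: "\<exists>Q\<in>polys_on {..<3}. f = l * Q"
    if "f \<in> polys_on {..<3}" "\<And>v :: nat \<Rightarrow> real. (ev v f)\<^sup>2 \<le> ev v a * ev v g" for f g
  proof -
    have "ev v f = 0" if "v i = - ev v L" for v :: "nat \<Rightarrow> real"
      using \<open>\<And>v. (ev v f)\<^sup>2 \<le> ev v a * ev v g\<close>[of v] that by (simp add: a l ev_simps)
    then show ?thesis
      using linear_dvd_if_zero[OF that(1)[folded i(1)] i(2,4)] unfolding i(1) l by blast
  qed
  obtain b1 where b1: "b1 \<in> polys_on {..<3}" "b = l * b1" using dvd[OF pol(1) le(1)] by blast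
  obtain b2 where b2: "b2 \<in> polys_on {..<3}" "b' = l * b2" using dvd[OF pol(3) le(2)] by blast
  have lpol: "l \<in> polys_on {..<3}" unfolding i(1)[symmetric] l using i(4)
    by (auto intro!: polys_on_add intro: polys_on_mono[of I])
  have "l \<noteq> 0"
  proof
    assume "l = 0"
    then have "ev ((\<lambda>_. 0)(i := x)) l = 0" for x :: real by simp
    moreover have "ev ((\<lambda>_. 0)(i := x)) L = ev (\<lambda>_. 0) L" for x :: real
      by (rule ev_cong[OF i(4)]) (use i(2) in auto)
    ultimately have "x + ev (\<lambda>_. 0) L = 0" for x :: real by (simp add: l ev_simps)
    from this[of 0] this[of 1] show False by simp
  qed
  define E where "E = Const \<alpha> * c - b1\<^sup>2"
  have E: "discr a b c = l\<^sup>2 * E"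
    by (simp add: discr_def E_def a b1(2) power2_eq_square algebra_simps)
  have "l\<^sup>2 * (Const \<alpha> * c' - b2\<^sup>2) = l\<^sup>2 * E"
    using d unfolding E by (simp add: discr_def a b2(2) power2_eq_square algebra_simps)
  then have E': "Const \<alpha> * c' - b2\<^sup>2 = E" using \<open>l \<noteq> 0\<close> by simp
  have "l\<^sup>2 * (\<Sum>k<N. (Const \<alpha> * l * r k - b1 * p k)\<^sup>2) = (\<Sum>k<N. (a * r k - b * p k)\<^sup>2)"
    unfolding sum_distrib_left a b1(2)
    by (intro sum.cong refl) (simp add: power2_eq_square algebra_simps)
  also have "\<dots> = l\<^sup>2 * (Const \<alpha> * l\<^sup>2 * E)" unfolding eq[symmetric] E by (simp add: a mult_ac)
  finally have sum: "(\<Sum>k<N. (Const \<alpha> * l * r k - b1 * p k)\<^sup>2) = Const \<alpha> * l\<^sup>2 * E"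
    using \<open>l \<noteq> 0\<close> by simp
  have "\<exists>Q\<in>polys_on (insert i I). Const \<alpha> * l * r k - b1 * p k = (Var i + L) * Q" if "k < N" for k
  proof (rule linear_dvd_sum_squares[OF _ i(2,4) _ that])
    show "(\<Sum>k<N. (Const \<alpha> * l * r k - b1 * p k)\<^sup>2) = (Var i + L) * (Const \<alpha> * l * E)"
      unfolding sum by (simp add: l power2_eq_square mult_ac)
    show "Const \<alpha> * l * r k - b1 * p k \<in> polys_on (insert i I)" if "k < N" for k
      unfolding i(1) using pol(5,6) b1 lpol that by auto
  qed
  then have "\<forall>k<N. \<exists>w. w \<in> polys_on {..<3} \<and> Const \<alpha> * l * r k - b1 * p k = l * w"
    unfolding i(1) l by blast
  then obtain w where w: "\<And>k. k < N \<Longrightarrow> w k \<in> polys_on {..<3}"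
    "\<And>k. k < N \<Longrightarrow> Const \<alpha> * l * r k - b1 * p k = l * w k" by metis
  have "l\<^sup>2 * (\<Sum>k<N. (w k)\<^sup>2) = (\<Sum>k<N. (Const \<alpha> * l * r k - b1 * p k)\<^sup>2)"
    unfolding sum_distrib_left by (intro sum.cong refl) (simp add: w(2) power_mult_distrib)
  then have "l\<^sup>2 * (\<Sum>k<N. (w k)\<^sup>2) = l\<^sup>2 * (Const \<alpha> * E)"
    unfolding sum by (simp only: mult_ac)
  then have wE: "(\<Sum>k<N. (w k)\<^sup>2) = Const \<alpha> * E" using \<open>l \<noteq> 0\<close> by simp
  have "quad_in_u a b' c' = (\<Sum>k<N. (Const (1/\<alpha>) * w k)\<^sup>2) + (Const (1 / sqrt \<alpha>) * (Const \<alpha> * l * U + b2))\<^sup>2"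
  proof (rule rpoly_eqI)
    fix v :: "nat \<Rightarrow> real"
    have 1: "\<alpha> * ev v c' - (ev v b2)\<^sup>2 = ev v E" using arg_cong[OF E', of "ev v"] by (simp add: ev_simps)
    have 2: "(\<Sum>k<N. (ev v (w k))\<^sup>2) = \<alpha> * ev v E"
      using arg_cong[OF wE, of "ev v"] by (simp add: ev_simps)
    have "(\<Sum>k<N. (1/\<alpha> * ev v (w k))\<^sup>2) = (1/\<alpha>)\<^sup>2 * (\<alpha> * ev v E)"
      unfolding 2[symmetric] sum_distrib_left power_mult_distrib ..
    also have "\<dots> = ev v c' - (ev v b2)\<^sup>2 / \<alpha>"
      unfolding 1[symmetric] using \<open>\<alpha> > 0\<close> by (simp add: power2_eq_square field_simps)
    moreover have "(1 / sqrt \<alpha> * (\<alpha> * ev v l * v 3 + ev v b2))\<^sup>2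
        = \<alpha> * (ev v l)\<^sup>2 * (v 3)\<^sup>2 + 2 * (ev v l * ev v b2) * v 3 + (ev v b2)\<^sup>2 / \<alpha>"
      using \<open>\<alpha> > 0\<close> by (simp add: power_mult_distrib power_divide) (simp add: power2_eq_square field_simps)
    ultimately show "ev v (quad_in_u a b' c')
        = ev v ((\<Sum>k<N. (Const (1/\<alpha>) * w k)\<^sup>2) + (Const (1 / sqrt \<alpha>) * (Const \<alpha> * l * U + b2))\<^sup>2)"
      by (simp add: quad_in_u_def a b2(2) U_eq ev_simps)
  qed
  also have "is_sos 4 \<dots>"
    unfolding U_eq
  proof (intro is_sos_add_square is_sos_sum_squares)
    have 34: "f \<in> polys_on {..<3} \<Longrightarrow> f \<in> polys_on {..<4}" for f
      by (rule polys_on_mono) auto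
    show "Const (1/\<alpha>) * w k \<in> polys 4" if "k < N" for k
      unfolding polys_eq using w(1)[OF that] 34 by auto
    show "Const (1 / sqrt \<alpha>) * (Const \<alpha> * l * Var 3 + b2) \<in> polys 4"
      unfolding polys_eq using 34 lpol b2(1)
      by (intro polys_on_mult polys_on_add polys_on_Const polys_on_Var) auto
  qed
  finally show ?thesis .
qed

text \<open>
  Completing the square gives \<open>g = a (u + b\<^sub>2)\<^sup>2 + (c' - a b\<^sub>2\<^sup>2)\<close>. The last term is \<open>\<Delta> / a\<close>, and dividing the
  representation of \<open>a \<Delta>\<close> by \<open>a\<^sup>2\<close> exhibits it as \<open>\<Sum> (r\<^sub>k - b\<^sub>1 p\<^sub>k)\<^sup>2\<close>.
\<close>

lemma sos_of_prime_dvd: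
  fixes p r :: "nat \<Rightarrow> rpoly"
  assumes a: "a \<in> forms 3 2" "a \<noteq> 0" "\<And>v :: nat \<Rightarrow> real. ev v a \<ge> 0"
    and b: "b = a * b1" "b1 \<in> polys_on {..<3}" and b': "b' = a * b2" "b2 \<in> polys_on {..<3}"
    and pol: "\<And>k. k < N \<Longrightarrow> p k \<in> polys_on {..<3}" "\<And>k. k < N \<Longrightarrow> r k \<in> polys_on {..<3}"
    and eq: "a * discr a b c = (\<Sum>k<N. (a * r k - b * p k)\<^sup>2)" and d: "discr a b' c' = discr a b c"
  shows "is_sos 4 (quad_in_u a b' c')"
proof -
  define E where "E = (\<Sum>k<N. (r k - b1 * p k)\<^sup>2)"
  have 34: "f \<in> polys_on {..<3} \<Longrightarrow> f \<in> polys_on {..<4}" for f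
    by (rule polys_on_mono) auto
  have "a\<^sup>2 * E = (\<Sum>k<N. (a * r k - b * p k)\<^sup>2)"
    unfolding E_def sum_distrib_left b(1)
    by (intro sum.cong refl) (simp add: power2_eq_square algebra_simps)
  also have "\<dots> = a\<^sup>2 * (c' - a * b2\<^sup>2)"
    unfolding eq[symmetric] d[symmetric] b'(1)
    by (simp add: discr_def power2_eq_square algebra_simps)
  finally have E: "c' - a * b2\<^sup>2 = E" using a(2) by simp
  obtain M and h :: "nat \<Rightarrow> rpoly" where
    h: "\<And>k. k < M \<Longrightarrow> h k \<in> polys_on {..<3}" "a = (\<Sum>k<M. (h k)\<^sup>2)"
    using psd_quadratic_sum_of_squares[OF a(1,3)] by blast
  have "quad_in_u a b' c' = a * (U + b2)\<^sup>2 + (c' - a * b2\<^sup>2)"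
    by (simp add: quad_in_u_def b'(1) power2_eq_square algebra_simps)
  also have "a * (U + b2)\<^sup>2 = (\<Sum>k<M. (h k * (U + b2))\<^sup>2)"
    by (subst h(2)) (simp add: sum_distrib_right power_mult_distrib)
  finally have "quad_in_u a b' c' = (\<Sum>k<M. (h k * (U + b2))\<^sup>2) + (\<Sum>k<N. (r k - b1 * p k)\<^sup>2)"
    by (simp add: E E_def)
  also have "is_sos 4 \<dots>"
    unfolding U_eq
  proof (intro is_sos_add is_sos_sum_squares)
    show "h k * (Var 3 + b2) \<in> polys 4" if "k < M" for k
      unfolding polys_eq using h(1)[OF that] b'(2) 34
      by (intro polys_on_mult polys_on_add polys_on_Var) auto
    show "r k - b1 * p k \<in> polys 4" if "k < N" for k
      unfolding polys_eq using pol[OF that] b(2) 34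
      by (intro polys_on_mult polys_on_diff) auto
  qed
  finally show ?thesis .
qed

text \<open>
  By homogeneity the quotient is constant along rays through the points where \<open>a\<close> does not vanish, so
  there it agrees with its value at the origin.
\<close>

lemma form_quotient_constant:
  assumes "a \<in> forms 3 2" "P \<in> forms 3 2" "P = a * Q"
  obtains \<nu> where "P = a * Const \<nu>"
proof
  let ?c = "ev (\<lambda>_. 0 :: real) Q"
  show "P = a * Const ?c"
  proof (rule rpoly_eqI)
    fix v :: "nat \<Rightarrow> real"
    define \<phi> where "\<phi> t = ev v a * (ev (\<lambda>i. t * v i) Q - ev v Q)" for t
    have \<phi>: "\<phi> t = 0" if "t \<noteq> 0" for t
    proof -
      have "ev (\<lambda>i. t * v i) P = ev (\<lambda>i. t * v i) a * ev (\<lambda>i. t * v i) Q" "ev v P = ev v a * ev v Q"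
        by (simp_all add: assms(3) ev_mult)
      then have "t\<^sup>2 * (ev v a * ev v Q) = t\<^sup>2 * ev v a * ev (\<lambda>i. t * v i) Q"
        by (simp add: ev_forms_homogeneous[OF assms(1)] ev_forms_homogeneous[OF assms(2)])
      then show ?thesis using that by (auto simp: \<phi>_def)
    qed
    have "isCont \<phi> 0" "isCont (\<lambda>t. - \<phi> t) 0"
      unfolding \<phi>_def by (intro continuous_intros isCont_ev_ray)+
    then have "\<phi> 0 \<ge> 0" "- \<phi> 0 \<ge> 0"
      by (auto intro!: nonneg_at_0[of \<phi>] nonneg_at_0[of "\<lambda>t. - \<phi> t", simplified] simp: \<phi>)
    then show "ev v P = ev v (a * Const ?c)"
      by (auto simp: \<phi>_def assms(3) ev_mult)
  qed
qed

text \<open>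
  Modulo \<open>a\<close>, the representation of \<open>a \<Delta>\<close> reads \<open>b\<^sup>2 \<Sum> p\<^sub>k\<^sup>2 = 0\<close>, so \<open>\<Sum> p\<^sub>k\<^sup>2 = \<nu> a\<close>. Cancelling \<open>a\<close> and reducing
  modulo \<open>a\<close> once more yields \<open>2 \<Sum> p\<^sub>k r\<^sub>k = (1 + \<nu>) b - a M\<close> and \<open>\<Sum> r\<^sub>k\<^sup>2 = c - b M\<close>, the hypotheses of
  \<open>gram_shift_identity\<close>. Applying that identity with \<open>y = \<plusminus>(u + n)\<close> represents \<open>g\<close>.
\<close>

lemma sos_of_prime_not_dvd:
  fixes p r :: "nat \<Rightarrow> rpoly"
  assumes a: "a \<in> forms 3 2" "a \<noteq> 0" "\<And>v :: nat \<Rightarrow> real. ev v a \<ge> 0"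
    and prime: "\<And>f g h. f \<in> polys_on {..<3} \<Longrightarrow> g \<in> polys_on {..<3} \<Longrightarrow> f * g = a * h \<Longrightarrow>
      (\<exists>Q\<in>polys_on {..<3}. f = a * Q) \<or> (\<exists>Q\<in>polys_on {..<3}. g = a * Q)"
    and b: "b \<in> polys_on {..<3}" "\<And>Q. Q \<in> polys_on {..<3} \<Longrightarrow> b \<noteq> a * Q" and "b' \<in> polys_on {..<3}"
    and p: "\<And>k. k < N \<Longrightarrow> p k \<in> forms 3 1" and r: "\<And>k. k < N \<Longrightarrow> r k \<in> polys_on {..<3}"
    and eq: "a * discr a b c = (\<Sum>k<N. (a * r k - b * p k)\<^sup>2)" and d: "discr a b' c' = discr a b c"
  shows "is_sos 4 (quad_in_u a b' c')"
proof -
  define P R S where "P = (\<Sum>k<N. (p k)\<^sup>2)" and "R = (\<Sum>k<N. (r k)\<^sup>2)" and "S = (\<Sum>k<N. p k * r k)"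
  have pp: "p k \<in> polys_on {..<3}" if "k < N" for k using p[OF that] by (rule forms_polys_on)
  have RSpol: "R \<in> polys_on {..<3}" "S \<in> polys_on {..<3}"
    unfolding R_def S_def using pp r by (auto intro!: polys_on_sum)
  have expand: "(\<Sum>k<N. (a * r k - b * p k)\<^sup>2) = a\<^sup>2 * R - 2 * a * b * S + b\<^sup>2 * P"
    unfolding P_def R_def S_def
    by (simp add: power2_eq_square algebra_simps sum.distrib sum_subtractf sum_distrib_left)
  have P: "P \<in> forms 3 2"
  proof -
    have "(\<Sum>k<n. (p k)\<^sup>2) \<in> forms 3 (2 * 1)" if "n \<le> N" for n
      using that
    proof (induction n)
      case (Suc n)
      then show ?case using forms_power[OF p[of n], of 2] by (auto intro: forms_add)
    qed simp
    then show ?thesis by (simp add: P_def)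
  qed
  have "b * (b * P) = a * (discr a b c - a * R + 2 * b * S)"
    using eq unfolding expand by (simp add: power2_eq_square algebra_simps)
  then have "\<exists>Q\<in>polys_on {..<3}. b * P = a * Q"
    using prime[OF b(1) polys_on_mult[OF b(1) forms_polys_on[OF P]]] b(2) by blast
  then obtain Q where "P = a * Q" using prime[OF b(1) forms_polys_on[OF P]] b(2) by blast
  then obtain \<nu> where \<nu>: "P = a * Const \<nu>" using form_quotient_constant[OF a(1) P] by blast
  obtain v :: "nat \<Rightarrow> real" where "ev v a \<noteq> 0" using ev_eq_0 a(2) by blast
  then have av: "ev v a > 0" using a(3)[of v] by simp
  have "ev v a * \<nu> = (\<Sum>k<N. (ev v (p k))\<^sup>2)"
    using arg_cong[OF \<nu>, of "ev v"] by (simp add: P_def ev_simps)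
  also have "\<dots> \<ge> 0" by (intro sum_nonneg) simp
  finally have "\<nu> \<ge> 0" using av by (simp add: zero_le_mult_iff)
  have main: "b * ((1 + Const \<nu>) * b - 2 * S) = a * (c - R)"
  proof -
    have "a * (b * ((1 + Const \<nu>) * b - 2 * S)) = a * (a * (c - R))"
      using eq unfolding expand \<nu> by (simp add: discr_def power2_eq_square algebra_simps)
    then show ?thesis using a(2) by simp
  qed
  then have "\<exists>Q\<in>polys_on {..<3}. (1 + Const \<nu>) * b - 2 * S = a * Q"
    using prime[of b "(1 + Const \<nu>) * b - 2 * S" "c - R"] b RSpol by auto
  then obtain M where M: "M \<in> polys_on {..<3}" "(1 + Const \<nu>) * b - 2 * S = a * M" by blast
  have "a * (b * M) = a * (c - R)" using main unfolding M(2) by (simp add: mult_ac)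
  then have "b * M = c - R" using a(2) by simp
  then have R: "R = c - b * M" by simp
  \<comment> \<open>For \<open>\<nu> = 0\<close> all \<open>p\<^sub>k\<close> vanish, and then \<open>a\<close> divides \<open>b\<close>.\<close>
  have "\<nu> \<noteq> 0"
  proof
    assume "\<nu> = 0"
    then have "P = 0" by (simp add: \<nu> Const_def)
    have "ev w (p k) = 0" if "k < N" for k and w :: "nat \<Rightarrow> real"
    proof -
      have "(\<Sum>k<N. (ev w (p k))\<^sup>2) = 0"
        using arg_cong[OF \<open>P = 0\<close>, of "ev w"] by (simp add: P_def ev_simps)
      then show ?thesis using that by (simp add: sum_nonneg_eq_0_iff)
    qed
    then have "S = 0" unfolding S_def using ev_eq_0 by (intro sum.neutral) auto
    then have "b = a * M" using M(2) \<open>\<nu> = 0\<close> by (simp add: Const_def)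
    with b(2)[OF M(1)] show False by simp
  qed
  with \<open>\<nu> \<ge> 0\<close> have "\<nu> > 0" by simp
  have "(b' - b) * (b' + b) = a * (c' - c)"
    using d by (simp add: discr_def power2_eq_square algebra_simps)
  then have "(\<exists>n\<in>polys_on {..<3}. b' - b = a * n) \<or> (\<exists>n\<in>polys_on {..<3}. b' + b = a * n)"
    using b(1) assms(7) by (intro prime) auto
  then obtain n and \<epsilon> :: rpoly where n: "n \<in> polys_on {..<3}" "b' = \<epsilon> * b + a * n" "\<epsilon> * \<epsilon> = 1"
    and \<epsilon>: "\<epsilon> = 1 \<or> \<epsilon> = - 1"
  proof (elim disjE bexE)
    fix n assume "n \<in> polys_on {..<3}" "b' - b = a * n"
    then show thesis using that[of n 1] by (simp add: algebra_simps)
  next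
    fix n assume "n \<in> polys_on {..<3}" "b' + b = a * n"
    then show thesis using that[of n "-1"] by (simp add: algebra_simps)
  qed
  have "a * c' = a * (a * n\<^sup>2 + 2 * \<epsilon> * b * n + c)"
  proof -
    have "a * c' = a * c - b\<^sup>2 + b'\<^sup>2" using d by (simp add: discr_def algebra_simps)
    also have "b'\<^sup>2 = (\<epsilon> * \<epsilon>) * b\<^sup>2 + 2 * \<epsilon> * a * b * n + a\<^sup>2 * n\<^sup>2"
      unfolding n(2) by (simp add: power2_eq_square algebra_simps)
    finally show ?thesis unfolding n(3) by (simp add: power2_eq_square algebra_simps)
  qed
  then have c': "c' = a * n\<^sup>2 + 2 * \<epsilon> * b * n + c" using a(2) by simp
  define Y where "Y = \<epsilon> * (U + n)"
  have g: "quad_in_u a b' c' = a * Y\<^sup>2 + 2 * b * Y + c"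
  proof -
    have "a * Y\<^sup>2 + 2 * b * Y + c = (\<epsilon> * \<epsilon>) * (a * (U + n)\<^sup>2) + 2 * \<epsilon> * b * (U + n) + c"
      unfolding Y_def by (simp add: power2_eq_square algebra_simps)
    then show ?thesis unfolding n(3) quad_in_u_def n(2) c'
      by (simp add: power2_eq_square algebra_simps)
  qed
  define t where "t k = r k + Const (1 / (2 * \<nu>)) * M * p k" for k
  have "a * Y\<^sup>2 + 2 * b * Y + c
      = (\<Sum>k<N. (Const (1 / sqrt \<nu>) * p k * Y + Const (2 * sqrt \<nu> / (1 + \<nu>)) * t k)\<^sup>2)
      + (\<Sum>k<N. (Const ((1 - \<nu>) / (1 + \<nu>)) * t k - Const (1 / (2 * \<nu>)) * M * p k)\<^sup>2)"
  proof (rule rpoly_eqI)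
    fix v :: "nat \<Rightarrow> real"
    have "ev v a * (ev v Y)\<^sup>2 + 2 * ev v b * ev v Y + ev v c
      = (\<Sum>k<N. (1 / sqrt \<nu> * ev v (p k) * ev v Y
          + 2 * sqrt \<nu> / (1 + \<nu>) * (ev v (r k) + ev v M / (2 * \<nu>) * ev v (p k)))\<^sup>2)
      + (\<Sum>k<N. ((1 - \<nu>) / (1 + \<nu>) * (ev v (r k) + ev v M / (2 * \<nu>) * ev v (p k))
          - ev v M / (2 * \<nu>) * ev v (p k))\<^sup>2)"
    proof (rule gram_shift_identity[OF \<open>\<nu> > 0\<close>])
      show "(\<Sum>k<N. (ev v (p k))\<^sup>2) = \<nu> * ev v a"
        using arg_cong[OF \<nu>, of "ev v"] by (simp add: P_def ev_simps)
      show "2 * (\<Sum>k<N. ev v (p k) * ev v (r k)) = (1 + \<nu>) * ev v b - ev v a * ev v M"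
        using arg_cong[OF M(2), of "ev v"] by (simp add: S_def ev_simps)
      show "(\<Sum>k<N. (ev v (r k))\<^sup>2) = ev v c - ev v b * ev v M"
        using arg_cong[OF R, of "ev v"] by (simp add: R_def ev_simps)
    qed
    then show "ev v (a * Y\<^sup>2 + 2 * b * Y + c) = ev v
       ((\<Sum>k<N. (Const (1 / sqrt \<nu>) * p k * Y + Const (2 * sqrt \<nu> / (1 + \<nu>)) * t k)\<^sup>2)
      + (\<Sum>k<N. (Const ((1 - \<nu>) / (1 + \<nu>)) * t k - Const (1 / (2 * \<nu>)) * M * p k)\<^sup>2))"
      by (simp add: t_def ev_simps)
  qed
  moreover have "is_sos 4 \<dots>"
  proof (intro is_sos_add is_sos_sum_squares)
    have 34: "f \<in> polys_on {..<3} \<Longrightarrow> f \<in> polys_on {..<4}" for f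
      by (rule polys_on_mono) auto
    have Y: "Y \<in> polys_on {..<4}"
      unfolding Y_def U_eq using \<epsilon> 34[OF n(1)] by (auto intro!: polys_on_mult polys_on_add polys_on_Var polys_on_minus)
    have t: "t k \<in> polys_on {..<4}" if "k < N" for k
      unfolding t_def using 34[OF r[OF that]] 34[OF pp[OF that]] 34[OF M(1)]
      by (intro polys_on_add polys_on_mult polys_on_Const)
    show "Const (1 / sqrt \<nu>) * p k * Y + Const (2 * sqrt \<nu> / (1 + \<nu>)) * t k \<in> polys 4"
      if "k < N" for k
      unfolding polys_eq using Y t[OF that] 34[OF pp[OF that]]
      by (intro polys_on_add polys_on_mult polys_on_Const)
    show "Const ((1 - \<nu>) / (1 + \<nu>)) * t k - Const (1 / (2 * \<nu>)) * M * p k \<in> polys 4"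
      if "k < N" for k
      unfolding polys_eq using t[OF that] 34[OF pp[OF that]] 34[OF M(1)]
      by (intro polys_on_diff polys_on_mult polys_on_Const)
  qed
  ultimately show ?thesis by (simp add: g)
qed

lemma completion_sum_of_squares:
  fixes p r :: "nat \<Rightarrow> rpoly"
  assumes a: "a \<in> forms 3 2" and b: "b \<in> forms 3 3" and c: "c \<in> forms 3 4"
    and f: "quad_in_u a b c \<in> psd_forms 4 4"
    and p: "\<And>k. k < N \<Longrightarrow> p k \<in> forms 3 1" and r: "\<And>k. k < N \<Longrightarrow> r k \<in> forms 3 2"
    and eq: "a * discr a b c = (\<Sum>k<N. (a * r k - b * p k)\<^sup>2)"
    and b': "b' \<in> forms 3 3" and c': "c' \<in> forms 3 4"
    and g: "quad_in_u a b' c' \<in> psd_forms 4 4" and d: "discr a b' c' = discr a b c"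
  shows "is_sos 4 (quad_in_u a b' c')"
proof -
  have pol: "a \<in> polys_on {..<3}" "b \<in> polys_on {..<3}" "c \<in> polys_on {..<3}"
    "b' \<in> polys_on {..<3}" "c' \<in> polys_on {..<3}"
    using a b c b' c' by (auto intro: forms_polys_on)
  have polp: "p k \<in> polys_on {..<3}" and polr: "r k \<in> polys_on {..<3}" if "k < N" for k
    using p[OF that] r[OF that] by (auto intro: forms_polys_on)
  note psd_f = psd_quad_in_u[OF pol(1,2,3) f]
  note psd_g = psd_quad_in_u[OF pol(1,4,5) g]
  show ?thesis
  proof (cases "a = 0")
    case True
    have "b' = 0" by (rule ev_eq_0) (use psd_g(3) True in simp)
    obtain N and h :: "nat \<Rightarrow> rpoly" where h: "\<And>k. k < N \<Longrightarrow> h k \<in> forms 3 2" "c' = (\<Sum>k<N. (h k)\<^sup>2)"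
      using Hilbert_ternary_quartic[OF c' psd_g(2)] by blast
    have "is_sos 4 (\<Sum>k<N. (h k)\<^sup>2)"
    proof (rule is_sos_sum_squares)
      show "h k \<in> polys 4" if "k < N" for k
        unfolding polys_eq by (rule polys_on_mono[OF _ forms_polys_on[OF h(1)[OF that]]]) auto
    qed
    then show ?thesis by (simp add: quad_in_u_def True \<open>b' = 0\<close> h(2))
  next
    case False
    obtain i \<alpha> I L s where I: "insert i I = {..<3}" "i \<notin> I" "\<alpha> > 0" "L \<in> polys_on I"
      and s: "s \<in> polys_on I" "a = Const \<alpha> * ((Var i + L)\<^sup>2 + s)" "\<And>v :: nat \<Rightarrow> real. ev v s \<ge> 0"
      by (rule psd_quadratic_complete_square[OF a False psd_f(1)]) (rule that)
    show ?thesis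
    proof (cases "s = 0")
      case True
      show ?thesis
        by (rule sos_of_degenerate[OF I refl _ pol(2-5) polp polr psd_f(3) psd_g(3) eq d])
          (use s(2) True in simp)
    next
      case False
      have prime: "(\<exists>Q\<in>polys_on {..<3}. f = a * Q) \<or> (\<exists>Q\<in>polys_on {..<3}. g = a * Q)"
        if "f \<in> polys_on {..<3}" "g \<in> polys_on {..<3}" "f * g = a * h" for f g h
        using quadratic_prime[OF I(2,4) s(1) _ refl s(2,3) False] I(3) that unfolding I(1) by auto
      show ?thesis
      proof (cases "\<exists>Q\<in>polys_on {..<3}. b = a * Q")
        case True
        then obtain b1 where b1: "b1 \<in> polys_on {..<3}" "b = a * b1" by blast
        have "b' * b' = a * (c' - c + a * b1\<^sup>2)"
          using d unfolding b1(2) by (simp add: discr_def power2_eq_square algebra_simps)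
        then obtain b2 where b2: "b2 \<in> polys_on {..<3}" "b' = a * b2"
          using prime[OF pol(4,4)] by blast
        show ?thesis
          by (rule sos_of_prime_dvd[OF a \<open>a \<noteq> 0\<close> psd_f(1) b1(2,1) b2(2,1) polp polr eq d])
      next
        case False
        show ?thesis
        proof (rule sos_of_prime_not_dvd[OF a \<open>a \<noteq> 0\<close> psd_f(1) _ pol(2) _ pol(4) p polr eq d])
          show "b \<noteq> a * Q" if "Q \<in> polys_on {..<3}" for Q
            using False that by blast
        qed (rule prime)
      qed
    qed
  qed
qed

theorem theorem4:
  fixes a b c f \<Delta> :: rpoly
  assumes "a \<in> forms 3 2" and "b \<in> forms 3 3" and "c \<in> forms 3 4"
    and "f = quad_in_u a b c" and "f \<in> psd_forms 4 4"
    and "\<Delta> = discr a b c"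
  shows
    "(\<forall>j\<in>{0, 1::nat}. \<forall>q\<in>sos_forms 3 2. q ^ j * f \<in> sos_forms 4 (4 + 2 * j) \<longrightarrow>
        (\<exists>(N::nat) p r.
           (\<forall>k<N. p k \<in> forms 3 (1 + j) \<and> r k \<in> forms 3 (2 + j)) \<and>
           a * q ^ j * \<Delta> = (\<Sum>k<N. (a * r k - b * p k)\<^sup>2) \<and>
           a * q ^ j * \<Delta> \<in> sos_forms 3 (8 + 2 * j)))
     \<and>
     ((\<exists>(N::nat) p r.
         (\<forall>k<N. p k \<in> forms 3 1 \<and> r k \<in> forms 3 2) \<and>
         a * \<Delta> = (\<Sum>k<N. (a * r k - b * p k)\<^sup>2)) \<longrightarrow>
      (\<forall>b'\<in>forms 3 3. \<forall>c'\<in>forms 3 4.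
         quad_in_u a b' c' \<in> psd_forms 4 4 \<and> discr a b' c' = \<Delta> \<longrightarrow>
         quad_in_u a b' c' \<in> sos_forms 4 4))"
proof (intro conjI ballI impI)
  fix j q
  assume q: "q \<in> sos_forms 3 2" and quadratic_of: "q ^ j * f \<in> sos_forms 4 (4 + 2 * j)"
  have qj: "q ^ j \<in> forms 3 (2 * j)"
    using forms_power[of q 3 2 j] q by (simp add: sos_forms_def mult.commute)
  obtain N h where h: "\<And>k. k < (N::nat) \<Longrightarrow> h k \<in> polys 4"
    and eq: "q ^ j * quad_in_u a b c = (\<Sum>k<N. (h k)\<^sup>2)"
    and form: "q ^ j * quad_in_u a b c \<in> forms 4 (4 + 2 * j)"
    using quadratic_of unfolding assms(4) sos_forms_def by blast
  obtain p r where pr: "\<And>k. k < N \<Longrightarrow> p k \<in> forms 3 (1 + j)" "\<And>k. k < N \<Longrightarrow> r k \<in> forms 3 (2 + j)"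
    and sum: "a * q ^ j * \<Delta> = (\<Sum>k<N. (a * r k - b * p k)\<^sup>2)"
    using discriminant_sum_of_squares[OF assms(1-3) qj h eq form] unfolding assms(6) by blast
  have "discr a b c \<in> forms 3 6"
    using forms_diff[OF forms_mult[OF assms(1,3)]] forms_power[OF assms(2), of 2]
    by (simp add: discr_def)
  then have "a * q ^ j * \<Delta> \<in> forms 3 (2 + 2 * j + 6)"
    unfolding assms(6) by (intro forms_mult assms(1) qj)
  moreover have "2 + 2 * j + 6 = 8 + 2 * j" by simp
  ultimately have form': "a * q ^ j * \<Delta> \<in> forms 3 (8 + 2 * j)" by (simp only:)
  have "a * r k - b * p k \<in> polys 3" if "k < N" for k
    using pr[OF that] assms(1,2) unfolding polys_eq
    by (intro polys_on_diff polys_on_mult) (auto intro: forms_polys_on)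
  then have "a * q ^ j * \<Delta> \<in> sos_forms 3 (8 + 2 * j)"
    using form' sum unfolding sos_forms_def
    by (intro CollectI conjI exI[of _ N] exI[of _ "\<lambda>k. a * r k - b * p k"]) auto
  then show "\<exists>(N::nat) p r.
           (\<forall>k<N. p k \<in> forms 3 (1 + j) \<and> r k \<in> forms 3 (2 + j)) \<and>
           a * q ^ j * \<Delta> = (\<Sum>k<N. (a * r k - b * p k)\<^sup>2) \<and>
           a * q ^ j * \<Delta> \<in> sos_forms 3 (8 + 2 * j)"
    using pr sum by blast
next
  fix b' c'
  assume "\<exists>(N::nat) p r. (\<forall>k<N. p k \<in> forms 3 1 \<and> r k \<in> forms 3 2) \<and>
         a * \<Delta> = (\<Sum>k<N. (a * r k - b * p k)\<^sup>2)"
  then obtain N p r where pr: "\<And>k. k < (N::nat) \<Longrightarrow> p k \<in> forms 3 1" "\<And>k. k < N \<Longrightarrow> r k \<in> forms 3 2"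
    and sum: "a * discr a b c = (\<Sum>k<N. (a * r k - b * p k)\<^sup>2)"
    unfolding assms(6) by blast
  assume b': "b' \<in> forms 3 3" and c': "c' \<in> forms 3 4"
    and g: "quad_in_u a b' c' \<in> psd_forms 4 4 \<and> discr a b' c' = \<Delta>"
  have "is_sos 4 (quad_in_u a b' c')"
    using g assms(5)
    by (intro completion_sum_of_squares[OF assms(1-3) _ pr sum b' c']) (auto simp: assms(4,6))
  then show "quad_in_u a b' c' \<in> sos_forms 4 4"
    using g unfolding is_sos_def sos_forms_def psd_forms_def by blast
qed

end
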